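(* Let $(R,\mathfrak m)$ be a commutative Noetherian local ring, $\mathfrak a$ a proper ideal of $R$, and $M$ a finitely generated $R$-module with $\operatorname{cd}(\mathfrak a,M)=c>0$. (i) Let $x\in\mathfrak a$ be a regular element on both $M$ and $D_R(H^c_{\mathfrak a}(M))$. Then $M$ is relative Cohen-Macaulay with respect to $\mathfrak a$ if and only if $M/xM$ is relative Cohen-Macaulay with respect to $\mathfrak a$. (ii) Let $\underline{x}=x_1,\ldots,x_n\in\mathfrak a$ be a regular sequence on both $M$ and $D_R(H^c_{\mathfrak a}(M))$. Then $M$ is relative Cohen-Macaulay with respect to $\mathfrak a$ if and only if $M/\underline{x}M$ is relative Cohen-Macaulay with respect to $\mathfrak a$.
   Context: $H^i_{\mathfrak a}(M)$ is the $i$-th local cohomology module of $M$ with respect to $\mathfrak a$, and $\operatorname{cd}(\mathfrak a,M)=\sup\{i\in\mathbb Z\mid H^i_{\mathfrak a}(M)\neq0\}$. A finitely generated $R$-module $M$ is relative Cohen-Macaulay with respect to $\mathfrak a$ if there is precisely one $i$ with $H^i_{\mathfrak a}(M)\ne0$; equivalently, $\operatorname{grade}(\mathfrak a,M)=\operatorname{cd}(\mathfrak a,M)$. For a local ring $(R,\mathfrak m)$, $D_R(-)=\operatorname{Hom}_R(-,E_R(R/\mathfrak m))$ is the Matlis duality functor. *)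

theory Defs
  imports
    "HOL-Algebra.Module"
    "HOL-Algebra.QuotRing"
    "HOL-Algebra.Ideal_Product"
    "HOL-Algebra.Ring_Divisibility"
    "HOL-Library.Extended_Real"
begin

text \<open>The \<open>mult\<close> and \<open>one\<close> fields that a module record inherits from the ring
  record play no role in the locale \<open>module\<close>; they are left \<open>undefined\<close> below.\<close>

section \<open>Rings\<close>

definition local_ring :: "('r, 'k) ring_scheme \<Rightarrow> 'r set \<Rightarrow> bool" where
  "local_ring R \<mm> \<longleftrightarrow>
     cring R \<and> maximalideal \<mm> R \<and> (\<forall>J. maximalideal J R \<longrightarrow> J = \<mm>)"

primrec ideal_power :: "('r, 'k) ring_scheme \<Rightarrow> 'r set \<Rightarrow> nat \<Rightarrow> 'r set" where
  "ideal_power R \<aa> 0 = carrier R"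
| "ideal_power R \<aa> (Suc n) = ideal_prod R (ideal_power R \<aa> n) \<aa>"

section \<open>Modules\<close>

definition zero_module :: "('r, 'm, 'l) module_scheme \<Rightarrow> bool" where
  "zero_module M \<longleftrightarrow> carrier M = {\<zero>\<^bsub>M\<^esub>}"

definition self_module :: "('r, 'k) ring_scheme \<Rightarrow> ('r, 'r) module" where
  "self_module R =
     \<lparr>carrier = carrier R, monoid.mult = undefined, one = undefined,
      zero = \<zero>\<^bsub>R\<^esub>, add = add R, smult = monoid.mult R\<rparr>"

definition module_span ::
  "('r, 'k) ring_scheme \<Rightarrow> ('r, 'm, 'l) module_scheme \<Rightarrow> 'm set \<Rightarrow> 'm set" where
  "module_span R M S = \<Inter>{N. submodule N R M \<and> S \<subseteq> N}"

definition fin_gen_module ::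
  "('r, 'k) ring_scheme \<Rightarrow> ('r, 'm, 'l) module_scheme \<Rightarrow> bool" where
  "fin_gen_module R M \<longleftrightarrow>
     module R M \<and> (\<exists>S. finite S \<and> S \<subseteq> carrier M \<and> module_span R M S = carrier M)"

text \<open>\<open>M / N\<close> for a submodule \<open>N\<close>, with cosets as elements; compare \<open>FactRing\<close>.\<close>

definition mod_quot :: "('r, 'm, 'l) module_scheme \<Rightarrow> 'm set \<Rightarrow> ('r, 'm set) module" where
  "mod_quot M N =
     \<lparr>carrier = a_rcosets\<^bsub>M\<^esub> N, monoid.mult = undefined, one = undefined,
      zero = N, add = set_add M,
      smult = (\<lambda>r A. \<Union>a\<in>A. N +>\<^bsub>M\<^esub> (r \<odot>\<^bsub>M\<^esub> a))\<rparr>"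

text \<open>\<open>M / SM\<close>, where \<open>SM\<close> is the submodule generated by all \<open>s \<cdot> m\<close> with \<open>s \<in> S\<close>.\<close>

definition mod_quot_mult ::
  "('r, 'k) ring_scheme \<Rightarrow> ('r, 'm, 'l) module_scheme \<Rightarrow> 'r set \<Rightarrow> ('r, 'm set) module" where
  "mod_quot_mult R M S =
     mod_quot M (module_span R M {s \<odot>\<^bsub>M\<^esub> m | s m. s \<in> S \<and> m \<in> carrier M})"

definition mod_hom ::
  "('r, 'k) ring_scheme \<Rightarrow> ('r, 'm, 'l) module_scheme \<Rightarrow> ('r, 'n, 'j) module_scheme
     \<Rightarrow> ('m \<Rightarrow> 'n) set" where
  "mod_hom R M N =
     {f \<in> carrier M \<rightarrow> carrier N.
        (\<forall>x\<in>carrier M. \<forall>y\<in>carrier M. f (x \<oplus>\<^bsub>M\<^esub> y) = f x \<oplus>\<^bsub>N\<^esub> f y) \<and>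
        (\<forall>r\<in>carrier R. \<forall>x\<in>carrier M. f (r \<odot>\<^bsub>M\<^esub> x) = r \<odot>\<^bsub>N\<^esub> f x)}"

definition mod_ker ::
  "('r, 'm, 'l) module_scheme \<Rightarrow> ('r, 'n, 'j) module_scheme \<Rightarrow> ('m \<Rightarrow> 'n) \<Rightarrow> 'm set" where
  "mod_ker M N f = {x \<in> carrier M. f x = \<zero>\<^bsub>N\<^esub>}"

definition Hom_module ::
  "('r, 'k) ring_scheme \<Rightarrow> ('r, 'm, 'l) module_scheme \<Rightarrow> ('r, 'n, 'j) module_scheme
     \<Rightarrow> ('r, 'm \<Rightarrow> 'n) module" where
  "Hom_module R M N =
     \<lparr>carrier = mod_hom R M N \<inter> extensional (carrier M),
      monoid.mult = undefined, one = undefined,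
      zero = (\<lambda>x\<in>carrier M. \<zero>\<^bsub>N\<^esub>),
      add = (\<lambda>f g. \<lambda>x\<in>carrier M. f x \<oplus>\<^bsub>N\<^esub> g x),
      smult = (\<lambda>r f. \<lambda>x\<in>carrier M. r \<odot>\<^bsub>N\<^esub> f x)\<rparr>"

section \<open>Regular elements and regular sequences\<close>

definition nonzerodivisor_on ::
  "('r, 'm, 'l) module_scheme \<Rightarrow> 'r \<Rightarrow> bool" where
  "nonzerodivisor_on M x \<longleftrightarrow>
     (\<forall>m\<in>carrier M. x \<odot>\<^bsub>M\<^esub> m = \<zero>\<^bsub>M\<^esub> \<longrightarrow> m = \<zero>\<^bsub>M\<^esub>)"

definition regular_element ::
  "('r, 'k) ring_scheme \<Rightarrow> ('r, 'm, 'l) module_scheme \<Rightarrow> 'r \<Rightarrow> bool" where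
  "regular_element R M x \<longleftrightarrow>
     x \<in> carrier R \<and> nonzerodivisor_on M x \<and> \<not> zero_module (mod_quot_mult R M {x})"

definition regular_sequence ::
  "('r, 'k) ring_scheme \<Rightarrow> ('r, 'm, 'l) module_scheme \<Rightarrow> 'r list \<Rightarrow> bool" where
  "regular_sequence R M xs \<longleftrightarrow>
     set xs \<subseteq> carrier R \<and>
     (\<forall>i<length xs. nonzerodivisor_on (mod_quot_mult R M (set (take i xs))) (xs ! i)) \<and>
     \<not> zero_module (mod_quot_mult R M (set xs))"

section \<open>Injective modules, resolutions and hulls\<close>

text \<open>Injectivity is the extension property for homomorphisms from submodules. A definition
  cannot quantify over all carrier types of the ambient module \<open>B\<close>; the type \<open>'r + 'i\<close>
  contains a copy of \<open>R\<close>, so by Baer's criterion modules \<open>B\<close> over this type detect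
  injectivity with respect to modules over every type.\<close>

definition injective_module ::
  "('r, 'k) ring_scheme \<Rightarrow> ('r, 'i, 'l) module_scheme \<Rightarrow> bool" where
  "injective_module R I \<longleftrightarrow>
     module R I \<and>
     (\<forall>(B :: ('r, 'r + 'i) module) A f.
        module R B \<longrightarrow> submodule A R B \<longrightarrow> f \<in> mod_hom R (B\<lparr>carrier := A\<rparr>) I \<longrightarrow>
        (\<exists>g \<in> mod_hom R B I. \<forall>x\<in>A. g x = f x))"

definition injective_resolution ::
  "('r, 'k) ring_scheme \<Rightarrow> ('r, 'm, 'l) module_scheme \<Rightarrow>
     (nat \<Rightarrow> ('r, 'i) module) \<Rightarrow> (nat \<Rightarrow> 'i \<Rightarrow> 'i) \<Rightarrow> bool" where
  "injective_resolution R M I d \<longleftrightarrow>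
     (\<forall>i. injective_module R (I i)) \<and>
     (\<forall>i. d i \<in> mod_hom R (I i) (I (Suc i))) \<and>
     (\<forall>i. d i ` carrier (I i) = mod_ker (I (Suc i)) (I (Suc (Suc i))) (d (Suc i))) \<and>
     (\<exists>\<epsilon> \<in> mod_hom R M (I 0).
        inj_on \<epsilon> (carrier M) \<and> \<epsilon> ` carrier M = mod_ker (I 0) (I 1) (d 0))"

definition injective_hull ::
  "('r, 'k) ring_scheme \<Rightarrow> ('r, 'm, 'l) module_scheme \<Rightarrow> ('r, 'e, 'j) module_scheme \<Rightarrow> bool" where
  "injective_hull R M E \<longleftrightarrow>
     injective_module R E \<and>
     (\<exists>\<epsilon> \<in> mod_hom R M E. inj_on \<epsilon> (carrier M) \<and>
        (\<forall>N. submodule N R E \<longrightarrow> N \<inter> \<epsilon> ` carrier M = {\<zero>\<^bsub>E\<^esub>} \<longrightarrow> N = {\<zero>\<^bsub>E\<^esub>}))"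

section \<open>Local cohomology\<close>

definition torsion_part ::
  "('r, 'k) ring_scheme \<Rightarrow> 'r set \<Rightarrow> ('r, 'm, 'l) module_scheme \<Rightarrow> ('r, 'm, 'l) module_scheme" where
  "torsion_part R \<aa> M =
     M\<lparr>carrier := {m \<in> carrier M. \<exists>n. \<forall>r\<in>ideal_power R \<aa> n. r \<odot>\<^bsub>M\<^esub> m = \<zero>\<^bsub>M\<^esub>}\<rparr>"

definition cohomology ::
  "(nat \<Rightarrow> ('r, 'i) module) \<Rightarrow> (nat \<Rightarrow> 'i \<Rightarrow> 'i) \<Rightarrow> nat \<Rightarrow> ('r, 'i set) module" where
  "cohomology C d i =
     mod_quot ((C i)\<lparr>carrier := mod_ker (C i) (C (Suc i)) (d i)\<rparr>)
       (case i of 0 \<Rightarrow> {\<zero>\<^bsub>C 0\<^esub>} | Suc j \<Rightarrow> d j ` carrier (C j))"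

text \<open>The right derived functors of the torsion functor, computed from a chosen injective
  resolution. The carrier type \<open>'u = 'r \<times> nat \<Rightarrow> 'm \<times> nat\<close> is large enough for such a
  resolution to exist: every module \<open>N\<close> embeds into a divisible group \<open>D\<close> with
  \<open>|D| \<le> max |N| \<aleph>\<^sub>0\<close> and hence into the injective module of additive maps from \<open>R\<close> to \<open>D\<close>,
  and \<open>'m\<close>, \<open>nat\<close> and \<open>'r \<Rightarrow> 'u\<close> all inject into \<open>'u\<close>. So injective modules, their
  quotients and all further steps of the resolution can be taken inside \<open>'u\<close>.\<close>

definition local_cohomology ::
  "('r, 'k) ring_scheme \<Rightarrow> 'r set \<Rightarrow> ('r, 'm, 'l) module_scheme \<Rightarrow> nat
     \<Rightarrow> ('r, ('r \<times> nat \<Rightarrow> 'm \<times> nat) set) module" where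
  "local_cohomology R \<aa> M i =
     (let (I, d) = (SOME (I, d). injective_resolution R M I d)
      in cohomology (\<lambda>j. torsion_part R \<aa> (I j)) d i)"

text \<open>With values in \<open>ereal\<close>, the supremum of the empty set is \<open>-\<infinity>\<close>. Local cohomology
  vanishes in negative degrees, so natural number indices suffice.\<close>

definition cd ::
  "('r, 'k) ring_scheme \<Rightarrow> 'r set \<Rightarrow> ('r, 'm, 'l) module_scheme \<Rightarrow> ereal" where
  "cd R \<aa> M = (SUP i \<in> {i. \<not> zero_module (local_cohomology R \<aa> M i)}. ereal (real i))"

definition relative_CM ::
  "('r, 'k) ring_scheme \<Rightarrow> 'r set \<Rightarrow> ('r, 'm, 'l) module_scheme \<Rightarrow> bool" where
  "relative_CM R \<aa> M \<longleftrightarrow>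
     fin_gen_module R M \<and> (\<exists>!i. \<not> zero_module (local_cohomology R \<aa> M i))"

text \<open>The Matlis dual, where \<open>E\<close> is to be an injective hull of the residue field; the hull is
  unique up to isomorphism only.\<close>

definition matlis_dual ::
  "('r, 'k) ring_scheme \<Rightarrow> ('r, 'e, 'j) module_scheme \<Rightarrow> ('r, 'm, 'l) module_scheme
     \<Rightarrow> ('r, 'm \<Rightarrow> 'e) module" where
  "matlis_dual R E M = Hom_module R M E"

end

theory Submission
  imports Defs "HOL-Algebra.Free_Abelian_Groups" "HOL-Algebra.IntRing"
begin

text \<open>If \<open>x \<in> \<aa>\<close> is regular on \<open>M\<close>, the long exact sequence of \<open>0 \<rightarrow> M \<rightarrow> M \<rightarrow> M/xM \<rightarrow> 0\<close> shows that
  \<open>H\<^sup>i(M/xM) = 0\<close> makes \<open>x\<close> injective on \<open>H\<^sup>i\<^sup>+\<^sup>1(M)\<close>, which is then zero because it is \<open>\<aa>\<close>-torsion;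
  \<open>H\<^sup>0(M)\<close> is zero anyway. So if only \<open>H\<^sup>k(M/(x\<^sub>1,\<dots>,x\<^sub>n)M)\<close> survives, only \<open>H\<^sup>k\<^sup>+\<^sup>n(M)\<close> does.
  Conversely let only \<open>H = H\<^sup>c(M)\<close> be nonzero. Because \<open>E\<close> is an injective cogenerator, regularity of
  \<open>x\<^sub>1,\<dots>,x\<^sub>n\<close> on the dual of \<open>H\<close> says that \<open>x\<^sub>i\<^sub>+\<^sub>1\<close> is surjective on \<open>0 :\<^sub>H (x\<^sub>1,\<dots>,x\<^sub>i)\<close>, and
  the long exact sequence identifies this module with the only nonzero cohomology, in degree
  \<open>c - i\<close>, of \<open>M/(x\<^sub>1,\<dots>,x\<^sub>i)M\<close>.

  The long exact sequence is extracted from arbitrary injective resolutions \<open>I\<close> of \<open>M\<close> and \<open>J\<close> of \<open>M/xM\<close>: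
  the iterated mapping cone of \<open>I \<rightarrow> I \<rightarrow> J\<close> is an exact complex of injective modules bounded below, so it is
  contractible and its torsion subcomplex is exact too.\<close>

section \<open>Modules and homomorphisms\<close>

text \<open>\<open>local_cohomology\<close> picks a resolution by \<open>SOME\<close>, over a type
  built from the carrier type of the module. Nothing is known about the pick until some resolution
  has been built inside that very type; this is the purpose of the injections between types. The
  picks for \<open>M\<close> and for its quotients are unrelated, so complexes are compared through
  lifts and homotopies only, and \<open>M\<close> is resolved a second time as \<open>M/0\<close>,
  which shares its carrier type with the other quotients. Isomorphisms of cohomology modules are
  replaced by relations between cocycles and elements of the one fixed module \<open>H\<close>. The
  link to the dual \<open>D\<close> of \<open>H\<close> is that \<open>D/(x1,...,xi)D\<close> is the
  dual of the part of \<open>H\<close> killed by \<open>x1,...,xi\<close>, by exactness of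
  \<open>Hom(-, E)\<close>. From the quotient to \<open>M\<close> no nonvanishing is transported:
  the exact sequence shows that at most one degree survives, and the finite value of
  \<open>cd\<close> says that one does.\<close>

lemma (in abelian_group) minus_eq_zero_iff [simp]:
  assumes "a \<in> carrier G" "b \<in> carrier G"
  shows "a \<ominus> b = \<zero> \<longleftrightarrow> a = b"
  using assms by (metis a_minus_def add.inv_closed minus_equality r_neg minus_minus)

lemma (in abelian_group) minus_self [simp]: "a \<in> carrier G \<Longrightarrow> a \<ominus> a = \<zero>"
  by simp

lemma (in abelian_group) minus_zero_right [simp]:
  "a \<in> carrier G \<Longrightarrow> a \<ominus> \<zero> = a"
  by (simp add: a_minus_def)

lemma (in abelian_group) minus_add_cancel_right [simp]:
  "a \<in> carrier G \<Longrightarrow> b \<in> carrier G \<Longrightarrow> (a \<ominus> b) \<oplus> b = a"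
  by (simp add: a_minus_def a_assoc l_neg)

text \<open>This is the shape that the last component of the squared differential of the iterated
  cone takes after the homotopy identity has been inserted.\<close>

lemma (in abelian_group) sum_minus_minus_cancel:
  assumes "u \<in> carrier G" "v \<in> carrier G" "w \<in> carrier G"
  shows "(u \<oplus> v \<ominus> w \<ominus> u) \<oplus> (w \<ominus> v) = \<zero>"
proof -
  have "(u \<oplus> v \<ominus> w \<ominus> u) \<oplus> (w \<ominus> v) = (u \<oplus> v \<oplus> w) \<oplus> \<ominus> (u \<oplus> v \<oplus> w)"
    using assms by (simp add: a_minus_def minus_add a_ac)
  thus ?thesis using assms by (simp add: r_neg)
qed

lemma (in abelian_group) add_minus_cancel_left:
  "a \<in> carrier G \<Longrightarrow> b \<in> carrier G \<Longrightarrow> (a \<oplus> b) \<ominus> a = b"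
  by (simp add: a_minus_def a_comm[of a b] a_assoc r_neg)

lemma (in abelian_group) minus_add_minus_cancel:
  "a \<in> carrier G \<Longrightarrow> b \<in> carrier G \<Longrightarrow> c \<in> carrier G \<Longrightarrow> (a \<ominus> b) \<oplus> (b \<ominus> c) = a \<ominus> c"
  by (metis a_minus_def a_assoc a_inv_closed minus_add_cancel_right minus_closed)

lemma mod_homI:
  assumes "\<And>x. x \<in> carrier M \<Longrightarrow> f x \<in> carrier N"
    and "\<And>x y. x \<in> carrier M \<Longrightarrow> y \<in> carrier M \<Longrightarrow> f (x \<oplus>\<^bsub>M\<^esub> y) = f x \<oplus>\<^bsub>N\<^esub> f y"
    and "\<And>r x. r \<in> carrier R \<Longrightarrow> x \<in> carrier M \<Longrightarrow> f (r \<odot>\<^bsub>M\<^esub> x) = r \<odot>\<^bsub>N\<^esub> f x"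
  shows "f \<in> mod_hom R M N"
  using assms by (auto simp: mod_hom_def)

lemma mod_hom_closed: "f \<in> mod_hom R M N \<Longrightarrow> x \<in> carrier M \<Longrightarrow> f x \<in> carrier N"
  and mod_hom_add:
    "f \<in> mod_hom R M N \<Longrightarrow> x \<in> carrier M \<Longrightarrow> y \<in> carrier M \<Longrightarrow> f (x \<oplus>\<^bsub>M\<^esub> y) = f x \<oplus>\<^bsub>N\<^esub> f y"
  and mod_hom_smult:
    "f \<in> mod_hom R M N \<Longrightarrow> r \<in> carrier R \<Longrightarrow> x \<in> carrier M \<Longrightarrow> f (r \<odot>\<^bsub>M\<^esub> x) = r \<odot>\<^bsub>N\<^esub> f x"
  by (auto simp: mod_hom_def)

text \<open>Negation is a scalar multiplication, so preservation of inverses and closure under them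
  follow from the conditions on scalars.\<close>

lemma module_a_inv_eq_smult:
  assumes "module R M" "x \<in> carrier M"
  shows "\<ominus>\<^bsub>M\<^esub> x = (\<ominus>\<^bsub>R\<^esub> \<one>\<^bsub>R\<^esub>) \<odot>\<^bsub>M\<^esub> x"
proof -
  interpret module R M by fact
  show ?thesis using assms(2) by (simp add: smult_l_minus)
qed

lemma mod_hom_zero:
  assumes "module R M" "module R N" "f \<in> mod_hom R M N"
  shows "f \<zero>\<^bsub>M\<^esub> = \<zero>\<^bsub>N\<^esub>"
proof -
  interpret M: module R M by fact
  interpret N: module R N by fact
  have "f (\<zero>\<^bsub>R\<^esub> \<odot>\<^bsub>M\<^esub> \<zero>\<^bsub>M\<^esub>) = \<zero>\<^bsub>R\<^esub> \<odot>\<^bsub>N\<^esub> f \<zero>\<^bsub>M\<^esub>"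
    using assms(3) by (intro mod_hom_smult) auto
  thus ?thesis using mod_hom_closed[OF assms(3)] by simp
qed

lemma mod_hom_a_inv:
  assumes "module R M" "module R N" "f \<in> mod_hom R M N" "x \<in> carrier M"
  shows "f (\<ominus>\<^bsub>M\<^esub> x) = \<ominus>\<^bsub>N\<^esub> f x"
proof -
  interpret M: module R M by fact
  show ?thesis
    using assms mod_hom_closed[OF assms(3,4)]
    by (simp add: module_a_inv_eq_smult mod_hom_smult[OF assms(3)])
qed

lemma mod_hom_minus:
  assumes "module R M" "module R N" "f \<in> mod_hom R M N" "x \<in> carrier M" "y \<in> carrier M"
  shows "f (x \<ominus>\<^bsub>M\<^esub> y) = f x \<ominus>\<^bsub>N\<^esub> f y"
proof -
  interpret M: module R M by fact
  show ?thesis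
    using assms by (simp add: a_minus_def mod_hom_add[OF assms(3)] mod_hom_a_inv[OF assms(1-3)])
qed

lemma module_smult_minus:
  assumes "module R M" "r \<in> carrier R" "x \<in> carrier M" "y \<in> carrier M"
  shows "r \<odot>\<^bsub>M\<^esub> (x \<ominus>\<^bsub>M\<^esub> y) = r \<odot>\<^bsub>M\<^esub> x \<ominus>\<^bsub>M\<^esub> r \<odot>\<^bsub>M\<^esub> y"
proof -
  interpret module R M by fact
  show ?thesis using assms by (simp add: a_minus_def smult_r_distr smult_r_minus)
qed

lemma module_smult_commute:
  assumes "module R M" "r \<in> carrier R" "s \<in> carrier R" "x \<in> carrier M"
  shows "r \<odot>\<^bsub>M\<^esub> (s \<odot>\<^bsub>M\<^esub> x) = s \<odot>\<^bsub>M\<^esub> (r \<odot>\<^bsub>M\<^esub> x)"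
proof -
  interpret module R M by fact
  show ?thesis using assms by (simp add: R.m_comm flip: smult_assoc1)
qed

lemma mod_hom_const_zero:
  assumes "module R N"
  shows "(\<lambda>_. \<zero>\<^bsub>N\<^esub>) \<in> mod_hom R M N"
proof -
  interpret N: module R N by fact
  show ?thesis by (auto intro!: mod_homI)
qed

lemma mod_hom_smult_const:
  assumes "module R M" "x \<in> carrier R"
  shows "(\<lambda>a. x \<odot>\<^bsub>M\<^esub> a) \<in> mod_hom R M M"
proof -
  interpret M: module R M by fact
  show ?thesis
    using assms(2) by (intro mod_homI) (auto simp: M.smult_r_distr M.m_comm simp flip: M.smult_assoc1)
qed

lemma mod_hom_compose:
  assumes "f \<in> mod_hom R A B" "g \<in> mod_hom R B C"
  shows "(\<lambda>x. g (f x)) \<in> mod_hom R A C"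
  using assms by (auto simp: mod_hom_def Pi_iff)

lemma mod_hom_restrict_carrier:
  "f \<in> mod_hom R M N \<Longrightarrow> A \<subseteq> carrier M \<Longrightarrow> f \<in> mod_hom R (M\<lparr>carrier := A\<rparr>) N"
  by (auto simp: mod_hom_def subset_iff)

lemma mod_hom_into_carrier:
  "f \<in> mod_hom R M N \<Longrightarrow> f ` carrier M \<subseteq> A \<Longrightarrow> f \<in> mod_hom R M (N\<lparr>carrier := A\<rparr>)"
  by (auto simp: mod_hom_def subset_iff)

lemma mod_hom_diff:
  assumes "module R N" "f \<in> mod_hom R M N" "g \<in> mod_hom R M N"
  shows "(\<lambda>x. f x \<ominus>\<^bsub>N\<^esub> g x) \<in> mod_hom R M N"
proof -
  interpret N: module R N by fact
  note c = mod_hom_closed[OF assms(2)] mod_hom_closed[OF assms(3)]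
  show ?thesis
  proof (rule mod_homI)
    fix x y assume "x \<in> carrier M" "y \<in> carrier M"
    thus "f (x \<oplus>\<^bsub>M\<^esub> y) \<ominus>\<^bsub>N\<^esub> g (x \<oplus>\<^bsub>M\<^esub> y) = (f x \<ominus>\<^bsub>N\<^esub> g x) \<oplus>\<^bsub>N\<^esub> (f y \<ominus>\<^bsub>N\<^esub> g y)"
      using c by (simp add: mod_hom_add[OF assms(2)] mod_hom_add[OF assms(3)] a_minus_def
          N.minus_add N.a_ac)
  next
    fix r x assume "r \<in> carrier R" "x \<in> carrier M"
    thus "f (r \<odot>\<^bsub>M\<^esub> x) \<ominus>\<^bsub>N\<^esub> g (r \<odot>\<^bsub>M\<^esub> x) = r \<odot>\<^bsub>N\<^esub> (f x \<ominus>\<^bsub>N\<^esub> g x)"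
      using c by (simp add: mod_hom_smult[OF assms(2)] mod_hom_smult[OF assms(3)]
          module_smult_minus[OF assms(1)])
  qed (use c in auto)
qed

section \<open>Submodules and their images\<close>

lemma submodule_if_closed:
  assumes "module R M" "H \<subseteq> carrier M" "\<zero>\<^bsub>M\<^esub> \<in> H"
    and "\<And>a b. a \<in> H \<Longrightarrow> b \<in> H \<Longrightarrow> a \<oplus>\<^bsub>M\<^esub> b \<in> H"
    and "\<And>r a. r \<in> carrier R \<Longrightarrow> a \<in> H \<Longrightarrow> r \<odot>\<^bsub>M\<^esub> a \<in> H"
  shows "submodule H R M"
proof -
  interpret module R M by fact
  show ?thesis
    using assms by (intro submoduleI) (auto simp: module_a_inv_eq_smult[OF assms(1)] subset_iff)
qed

lemma submodule_subset: "submodule H R M \<Longrightarrow> H \<subseteq> carrier M"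
  using submodule.axioms(1) subgroup.subset by fastforce

lemma submodule_zero: "submodule H R M \<Longrightarrow> \<zero>\<^bsub>M\<^esub> \<in> H"
  using submodule.axioms(1) subgroup.one_closed by fastforce

lemma submodule_add: "submodule H R M \<Longrightarrow> a \<in> H \<Longrightarrow> b \<in> H \<Longrightarrow> a \<oplus>\<^bsub>M\<^esub> b \<in> H"
  using submodule.axioms(1)[of H R M] subgroup.m_closed[of H "add_monoid M"] by simp

lemma submodule_smult: "submodule H R M \<Longrightarrow> r \<in> carrier R \<Longrightarrow> a \<in> H \<Longrightarrow> r \<odot>\<^bsub>M\<^esub> a \<in> H"
  using submodule.smult_closed .

lemma submodule_minus:
  assumes "module R M" "submodule H R M" "a \<in> H" "b \<in> H"
  shows "a \<ominus>\<^bsub>M\<^esub> b \<in> H"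
proof -
  interpret module R M by fact
  show ?thesis unfolding a_minus_def
    using assms submoduleE(3,5)[OF assms(2)] by blast
qed

lemma module_restrict_carrier:
  "module R M \<Longrightarrow> submodule H R M \<Longrightarrow> module R (M\<lparr>carrier := H\<rparr>)"
  using submodule.submodule_is_module by blast

lemma submodule_mod_hom_image:
  assumes "module R M" "module R N" "f \<in> mod_hom R M N" "submodule A R M"
  shows "submodule (f ` A) R N"
proof (rule submodule_if_closed[OF assms(2)])
  have sub: "A \<subseteq> carrier M" using submodule_subset[OF assms(4)] .
  show "f ` A \<subseteq> carrier N" using mod_hom_closed[OF assms(3)] sub by blast
  show "\<zero>\<^bsub>N\<^esub> \<in> f ` A"
    using mod_hom_zero[OF assms(1-3)] submodule_zero[OF assms(4)] by (metis imageI)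
  fix a b assume "a \<in> f ` A" "b \<in> f ` A"
  thus "a \<oplus>\<^bsub>N\<^esub> b \<in> f ` A"
    using mod_hom_add[OF assms(3)] sub submodule_add[OF assms(4)]
    by (smt (verit, best) image_iff subset_iff)
next
  have sub: "A \<subseteq> carrier M" using submodule_subset[OF assms(4)] .
  fix r a assume "r \<in> carrier R" "a \<in> f ` A"
  thus "r \<odot>\<^bsub>N\<^esub> a \<in> f ` A"
    using mod_hom_smult[OF assms(3)] sub submodule_smult[OF assms(4)]
    by (smt (verit, best) image_iff subset_iff)
qed

section \<open>The ring as a module over itself, and colon ideals\<close>

lemma module_self_module:
  assumes "cring R"
  shows "module R (self_module R)"
proof -
  interpret cring R by fact
  show ?thesis
  proof (intro moduleI abelian_groupI)
    fix p assume p: "p \<in> carrier (self_module R)"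
    show "\<exists>q\<in>carrier (self_module R). q \<oplus>\<^bsub>self_module R\<^esub> p = \<zero>\<^bsub>self_module R\<^esub>"
      using p by (intro bexI[of _ "\<ominus>\<^bsub>R\<^esub> p"]) (auto simp: self_module_def l_neg)
  qed (auto simp: self_module_def a_ac l_distr r_distr m_assoc is_cring)
qed

text \<open>The colon ideal \<open>B : y\<close> turns a question about one element into one about
  ideals, both in Baer's criterion and in the cogenerator property of \<open>E\<close>.\<close>

lemma ideal_colon:
  assumes "module R H" "submodule B R H" "y \<in> carrier H"
  shows "ideal {r \<in> carrier R. r \<odot>\<^bsub>H\<^esub> y \<in> B} R" (is "ideal ?J R")
proof (rule idealI)
  interpret H: module R H by fact
  show "ring R" by (rule H.R.ring_axioms)
  show "subgroup ?J (add_monoid R)"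
  proof (rule group.subgroupI)
    show "group (add_monoid R)" by (rule H.R.a_group)
    show "?J \<subseteq> carrier (add_monoid R)" by auto
    show "?J \<noteq> {}" using submodule_zero[OF assms(2)] assms(3) by (auto intro!: exI[of _ "\<zero>\<^bsub>R\<^esub>"])
  next
    fix r assume "r \<in> ?J"
    thus "inv\<^bsub>add_monoid R\<^esub> r \<in> ?J"
      using assms(3) H.submoduleE(3)[OF assms(2)] by (auto simp: a_inv_def[symmetric] H.smult_l_minus)
  next
    fix r s assume "r \<in> ?J" "s \<in> ?J"
    thus "r \<otimes>\<^bsub>add_monoid R\<^esub> s \<in> ?J"
      using assms(3) submodule_add[OF assms(2)] by (auto simp: H.smult_l_distr)
  qed
  fix r x assume r: "r \<in> ?J" and x: "x \<in> carrier R"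
  thus "x \<otimes>\<^bsub>R\<^esub> r \<in> ?J" using assms(3) submodule_smult[OF assms(2)] by (auto simp: H.smult_assoc1)
  thus "r \<otimes>\<^bsub>R\<^esub> x \<in> ?J" using r x H.R.m_comm by auto
qed

lemma submodule_ideal:
  assumes "cring R" "ideal J R"
  shows "submodule J R (self_module R)"
proof -
  interpret cring R by fact
  have "J \<subseteq> carrier R" using assms(2) by (simp add: additive_subgroup.a_subset ideal.axioms(1))
  thus ?thesis
    using assms by (intro submodule_if_closed[OF module_self_module])
      (auto simp: self_module_def additive_subgroup.zero_closed ideal.axioms(1)
        additive_subgroup.a_closed ideal.I_l_closed)
qed

section \<open>Direct sums and transport of structure\<close>

definition prod_module ::
  "('r, 'a, 'k) module_scheme \<Rightarrow> ('r, 'b, 'l) module_scheme \<Rightarrow> ('r, 'a \<times> 'b) module" where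
  "prod_module A B =
     \<lparr>carrier = carrier A \<times> carrier B, monoid.mult = undefined, one = undefined,
      ring.zero = (\<zero>\<^bsub>A\<^esub>, \<zero>\<^bsub>B\<^esub>), ring.add = (\<lambda>p q. (fst p \<oplus>\<^bsub>A\<^esub> fst q, snd p \<oplus>\<^bsub>B\<^esub> snd q)),
      module.smult = (\<lambda>r p. (r \<odot>\<^bsub>A\<^esub> fst p, r \<odot>\<^bsub>B\<^esub> snd p))\<rparr>"

lemma prod_module_simps [simp]:
  "carrier (prod_module A B) = carrier A \<times> carrier B"
  "\<zero>\<^bsub>prod_module A B\<^esub> = (\<zero>\<^bsub>A\<^esub>, \<zero>\<^bsub>B\<^esub>)"
  "(a, b) \<oplus>\<^bsub>prod_module A B\<^esub> (a', b') = (a \<oplus>\<^bsub>A\<^esub> a', b \<oplus>\<^bsub>B\<^esub> b')"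
  "r \<odot>\<^bsub>prod_module A B\<^esub> (a, b) = (r \<odot>\<^bsub>A\<^esub> a, r \<odot>\<^bsub>B\<^esub> b)"
  by (simp_all add: prod_module_def)

lemma module_prod_module:
  assumes "module R A" "module R B"
  shows "module R (prod_module A B)"
proof -
  interpret A: module R A by fact
  interpret B: module R B by fact
  show ?thesis
  proof (intro moduleI abelian_groupI)
    show "cring R" by (rule A.is_cring)
    fix p assume p: "p \<in> carrier (prod_module A B)"
    show "\<exists>q\<in>carrier (prod_module A B). q \<oplus>\<^bsub>prod_module A B\<^esub> p = \<zero>\<^bsub>prod_module A B\<^esub>"
      using p by (intro bexI[of _ "(\<ominus>\<^bsub>A\<^esub> fst p, \<ominus>\<^bsub>B\<^esub> snd p)"]) (auto simp: A.M.l_neg B.M.l_neg)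
  qed (auto simp: A.M.a_ac B.M.a_ac A.smult_l_distr B.smult_l_distr A.smult_r_distr B.smult_r_distr
      A.smult_assoc1 B.smult_assoc1)
qed

lemma prod_module_a_inv:
  assumes "module R A" "module R B" "a \<in> carrier A" "b \<in> carrier B"
  shows "\<ominus>\<^bsub>prod_module A B\<^esub> (a, b) = (\<ominus>\<^bsub>A\<^esub> a, \<ominus>\<^bsub>B\<^esub> b)"
  using assms by (simp add: module_a_inv_eq_smult[OF module_prod_module[OF assms(1,2)]]
      module_a_inv_eq_smult[OF assms(1)] module_a_inv_eq_smult[OF assms(2)])

lemma prod_module_minus:
  assumes "module R A" "module R B" "a \<in> carrier A" "b \<in> carrier B" "a' \<in> carrier A" "b' \<in> carrier B"
  shows "(a, b) \<ominus>\<^bsub>prod_module A B\<^esub> (a', b') = (a \<ominus>\<^bsub>A\<^esub> a', b \<ominus>\<^bsub>B\<^esub> b')"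
  using assms by (simp add: a_minus_def prod_module_a_inv)

text \<open>Transport of structure along an injection \<open>j\<close>; this moves a module into a
  prescribed carrier type.\<close>

definition map_module :: "('m \<Rightarrow> 'n) \<Rightarrow> ('r, 'm, 'l) module_scheme \<Rightarrow> ('r, 'n) module" where
  "map_module j M =
     (let k = inv_into (carrier M) j in
     \<lparr>carrier = j ` carrier M, monoid.mult = undefined, one = undefined,
      ring.zero = j \<zero>\<^bsub>M\<^esub>, ring.add = (\<lambda>u v. j (k u \<oplus>\<^bsub>M\<^esub> k v)), module.smult = (\<lambda>r u. j (r \<odot>\<^bsub>M\<^esub> k u))\<rparr>)"

lemma map_module_simps:
  assumes "inj_on j (carrier M)"
  shows "carrier (map_module j M) = j ` carrier M" "\<zero>\<^bsub>map_module j M\<^esub> = j \<zero>\<^bsub>M\<^esub>"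
    and "x \<in> carrier M \<Longrightarrow> y \<in> carrier M \<Longrightarrow> j x \<oplus>\<^bsub>map_module j M\<^esub> j y = j (x \<oplus>\<^bsub>M\<^esub> y)"
    and "x \<in> carrier M \<Longrightarrow> r \<odot>\<^bsub>map_module j M\<^esub> j x = j (r \<odot>\<^bsub>M\<^esub> x)"
  using assms by (simp_all add: map_module_def Let_def)

lemma module_map_module:
  assumes "module R M" "inj_on j (carrier M)"
  shows "module R (map_module j M)"
proof -
  interpret M: module R M by fact
  note [simp] = map_module_simps[OF assms(2)]
  show ?thesis
  proof (intro moduleI abelian_groupI)
    show "cring R" by (rule M.is_cring)
    fix p assume p: "p \<in> carrier (map_module j M)"
    then obtain x where x: "x \<in> carrier M" "p = j x" by auto
    show "\<exists>q\<in>carrier (map_module j M). q \<oplus>\<^bsub>map_module j M\<^esub> p = \<zero>\<^bsub>map_module j M\<^esub>"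
      using x by (intro bexI[of _ "j (\<ominus>\<^bsub>M\<^esub> x)"]) (auto simp: M.M.l_neg)
  qed (auto simp: M.M.a_ac M.smult_l_distr M.smult_r_distr M.smult_assoc1)
qed

lemma map_module_hom:
  assumes "module R M" "inj_on j (carrier M)"
  shows "j \<in> mod_hom R M (map_module j M)"
    and "inv_into (carrier M) j \<in> mod_hom R (map_module j M) M"
proof -
  interpret M: module R M by fact
  show "j \<in> mod_hom R M (map_module j M)"
    by (rule mod_homI) (simp_all add: map_module_simps[OF assms(2)])
  show "inv_into (carrier M) j \<in> mod_hom R (map_module j M) M"
    by (rule mod_homI) (auto simp: map_module_simps[OF assms(2)] inv_into_f_f[OF assms(2)])
qed

section \<open>Baer's criterion\<close>

text \<open>Baer's ideal test mentions no ambient carrier type, so it can serve to extend maps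
  between modules over arbitrary types. Both directions of its equivalence with
  \<open>injective_module\<close> are shown below.\<close>

definition baer_injective :: "('r, 'k) ring_scheme \<Rightarrow> ('r, 'i, 'l) module_scheme \<Rightarrow> bool" where
  "baer_injective R I \<longleftrightarrow> module R I \<and>
     (\<forall>J f. ideal J R \<longrightarrow> f \<in> mod_hom R ((self_module R)\<lparr>carrier := J\<rparr>) I \<longrightarrow>
        (\<exists>e\<in>carrier I. \<forall>r\<in>J. f r = r \<odot>\<^bsub>I\<^esub> e))"

lemma baer_injective_module: "baer_injective R I \<Longrightarrow> module R I"
  by (simp add: baer_injective_def)

text \<open>Partial homomorphisms are handled as their graphs, that is, as single-valued submodules
  of the product.\<close>

lemma baer_injective_maximal_graph:
  assumes I: "baer_injective R I" and B: "module R B"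
    and G: "submodule G R (prod_module B I)"
    and sv: "\<And>y. (\<zero>\<^bsub>B\<^esub>, y) \<in> G \<Longrightarrow> y = \<zero>\<^bsub>I\<^esub>"
    and b: "b \<in> carrier B"
  shows "\<exists>G' e. submodule G' R (prod_module B I) \<and> (\<forall>y. (\<zero>\<^bsub>B\<^esub>, y) \<in> G' \<longrightarrow> y = \<zero>\<^bsub>I\<^esub>) \<and>
     G \<subseteq> G' \<and> (b, e) \<in> G'"
proof -
  interpret B: module R B by fact
  interpret I: module R I using I by (rule baer_injective_module)
  have modP: "module R (prod_module B I)"
    by (rule module_prod_module) (fact B, rule I.module_axioms)
  have Gsub: "u \<in> carrier B" "v \<in> carrier I" if "(u, v) \<in> G" for u v
    using submodule_subset[OF G] that by auto
  have Gadd: "(u \<oplus>\<^bsub>B\<^esub> u', v \<oplus>\<^bsub>I\<^esub> v') \<in> G" if "(u, v) \<in> G" "(u', v') \<in> G" for u v u' v'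
    using submodule_add[OF G that] by simp
  have Gsm: "(r \<odot>\<^bsub>B\<^esub> u, r \<odot>\<^bsub>I\<^esub> v) \<in> G" if "(u, v) \<in> G" "r \<in> carrier R" for u v r
    using submodule_smult[OF G that(2,1)] by simp
  have Gneg: "(\<ominus>\<^bsub>B\<^esub> u, \<ominus>\<^bsub>I\<^esub> v) \<in> G" if "(u, v) \<in> G" for u v
    using Gsm[OF that, of "\<ominus>\<^bsub>R\<^esub> \<one>\<^bsub>R\<^esub>"] Gsub[OF that]
    by (simp add: module_a_inv_eq_smult[OF B] module_a_inv_eq_smult[OF I.module_axioms])
  have G0: "(\<zero>\<^bsub>B\<^esub>, \<zero>\<^bsub>I\<^esub>) \<in> G" using submodule_zero[OF G] by simp
  have uniq: "v = v'" if "(u, v) \<in> G" "(u, v') \<in> G" for u v v'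
  proof -
    have "v \<ominus>\<^bsub>I\<^esub> v' = \<zero>\<^bsub>I\<^esub>"
      using Gadd[OF that(1) Gneg[OF that(2)]] Gsub[OF that(1)]
      by (intro sv) (simp add: B.M.r_neg a_minus_def)
    thus ?thesis using Gsub[OF that(1)] Gsub[OF that(2)] by simp
  qed
  \<comment> \<open>The scalars \<open>r\<close> for which \<open>r b\<close> already lies in the
    domain of \<open>G\<close>. A value \<open>e\<close> for \<open>b\<close> must satisfy
    \<open>r e = f r\<close> on this ideal, and Baer's test provides one.\<close>
  define J where "J = {r \<in> carrier R. r \<odot>\<^bsub>B\<^esub> b \<in> fst ` G}"
  have JD: "\<exists>v. (r \<odot>\<^bsub>B\<^esub> b, v) \<in> G" if "r \<in> J" for r using that by (force simp: J_def)
  have JI: "r \<in> J" if "r \<in> carrier R" "(r \<odot>\<^bsub>B\<^esub> b, v) \<in> G" for r v using that by (force simp: J_def)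
  have "fst \<in> mod_hom R (prod_module B I) B" by (auto intro!: mod_homI)
  hence idealJ: "ideal J R"
    unfolding J_def using submodule_mod_hom_image[OF modP B _ G] b by (intro ideal_colon[OF B]) auto
  define f where "f r = (THE v. (r \<odot>\<^bsub>B\<^esub> b, v) \<in> G)" for r
  have f: "(r \<odot>\<^bsub>B\<^esub> b, f r) \<in> G" if "r \<in> J" for r
    unfolding f_def by (rule theI') (use JD[OF that] uniq in blast)
  have feq: "f r = v" if "(r \<odot>\<^bsub>B\<^esub> b, v) \<in> G" for r v
    unfolding f_def using that uniq by blast
  have "f \<in> mod_hom R ((self_module R)\<lparr>carrier := J\<rparr>) I"
  proof (rule mod_homI)
    fix r assume "r \<in> carrier ((self_module R)\<lparr>carrier := J\<rparr>)"
    thus "f r \<in> carrier I" using Gsub(2)[OF f] by simp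
  next
    fix r s assume "r \<in> carrier ((self_module R)\<lparr>carrier := J\<rparr>)" "s \<in> carrier ((self_module R)\<lparr>carrier := J\<rparr>)"
    hence "r \<in> J" "s \<in> J" by auto
    hence "((r \<oplus>\<^bsub>R\<^esub> s) \<odot>\<^bsub>B\<^esub> b, f r \<oplus>\<^bsub>I\<^esub> f s) \<in> G"
      using Gadd[OF f f] b by (auto simp: J_def B.smult_l_distr)
    thus "f (r \<oplus>\<^bsub>(self_module R)\<lparr>carrier := J\<rparr>\<^esub> s) = f r \<oplus>\<^bsub>I\<^esub> f s"
      by (simp add: self_module_def feq)
  next
    fix r s assume r: "r \<in> carrier R" and "s \<in> carrier ((self_module R)\<lparr>carrier := J\<rparr>)"
    hence "s \<in> J" by auto
    hence "((r \<otimes>\<^bsub>R\<^esub> s) \<odot>\<^bsub>B\<^esub> b, r \<odot>\<^bsub>I\<^esub> f s) \<in> G"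
      using Gsm[OF f r] b r by (auto simp: J_def B.smult_assoc1)
    thus "f (r \<odot>\<^bsub>(self_module R)\<lparr>carrier := J\<rparr>\<^esub> s) = r \<odot>\<^bsub>I\<^esub> f s"
      by (simp add: self_module_def feq)
  qed
  then obtain e where e: "e \<in> carrier I" "\<And>r. r \<in> J \<Longrightarrow> f r = r \<odot>\<^bsub>I\<^esub> e"
    using I idealJ unfolding baer_injective_def by blast
  \<comment> \<open>The submodule generated by \<open>G\<close> and the pair
    \<open>(b, e)\<close>.\<close>
  define G' where "G' = {(u \<oplus>\<^bsub>B\<^esub> r \<odot>\<^bsub>B\<^esub> b, v \<oplus>\<^bsub>I\<^esub> r \<odot>\<^bsub>I\<^esub> e) | u v r. (u, v) \<in> G \<and> r \<in> carrier R}"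
  have G'I: "(u \<oplus>\<^bsub>B\<^esub> r \<odot>\<^bsub>B\<^esub> b, v \<oplus>\<^bsub>I\<^esub> r \<odot>\<^bsub>I\<^esub> e) \<in> G'" if "(u, v) \<in> G" "r \<in> carrier R" for u v r
    using that by (auto simp: G'_def)
  have "submodule G' R (prod_module B I)"
  proof (rule submodule_if_closed[OF modP])
    show "G' \<subseteq> carrier (prod_module B I)" using b e Gsub by (auto simp: G'_def)
    show "\<zero>\<^bsub>prod_module B I\<^esub> \<in> G'" using G'I[OF G0, of "\<zero>\<^bsub>R\<^esub>"] b e by simp
  next
    fix p q assume "p \<in> G'" "q \<in> G'"
    then obtain u v r u' v' r' where *: "(u, v) \<in> G" "r \<in> carrier R" "(u', v') \<in> G" "r' \<in> carrier R"
      "p = (u \<oplus>\<^bsub>B\<^esub> r \<odot>\<^bsub>B\<^esub> b, v \<oplus>\<^bsub>I\<^esub> r \<odot>\<^bsub>I\<^esub> e)" "q = (u' \<oplus>\<^bsub>B\<^esub> r' \<odot>\<^bsub>B\<^esub> b, v' \<oplus>\<^bsub>I\<^esub> r' \<odot>\<^bsub>I\<^esub> e)"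
      unfolding G'_def by blast
    have "p \<oplus>\<^bsub>prod_module B I\<^esub> q =
      ((u \<oplus>\<^bsub>B\<^esub> u') \<oplus>\<^bsub>B\<^esub> (r \<oplus>\<^bsub>R\<^esub> r') \<odot>\<^bsub>B\<^esub> b, (v \<oplus>\<^bsub>I\<^esub> v') \<oplus>\<^bsub>I\<^esub> (r \<oplus>\<^bsub>R\<^esub> r') \<odot>\<^bsub>I\<^esub> e)"
      using * b e Gsub by (simp add: B.smult_l_distr I.smult_l_distr B.M.a_ac I.M.a_ac)
    thus "p \<oplus>\<^bsub>prod_module B I\<^esub> q \<in> G'" using G'I[OF Gadd[OF *(1,3)]] * by simp
  next
    fix s p assume s: "s \<in> carrier R" and "p \<in> G'"
    then obtain u v r where *: "(u, v) \<in> G" "r \<in> carrier R"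
      "p = (u \<oplus>\<^bsub>B\<^esub> r \<odot>\<^bsub>B\<^esub> b, v \<oplus>\<^bsub>I\<^esub> r \<odot>\<^bsub>I\<^esub> e)"
      unfolding G'_def by blast
    have "s \<odot>\<^bsub>prod_module B I\<^esub> p =
      (s \<odot>\<^bsub>B\<^esub> u \<oplus>\<^bsub>B\<^esub> (s \<otimes>\<^bsub>R\<^esub> r) \<odot>\<^bsub>B\<^esub> b, s \<odot>\<^bsub>I\<^esub> v \<oplus>\<^bsub>I\<^esub> (s \<otimes>\<^bsub>R\<^esub> r) \<odot>\<^bsub>I\<^esub> e)"
      using * b e s Gsub by (simp add: B.smult_r_distr I.smult_r_distr B.smult_assoc1 I.smult_assoc1)
    thus "s \<odot>\<^bsub>prod_module B I\<^esub> p \<in> G'" using G'I[OF Gsm[OF *(1) s], of "s \<otimes>\<^bsub>R\<^esub> r"] s * by simp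
  qed
  \<comment> \<open>If \<open>u + r b = 0\<close>, then \<open>r\<close> lies in \<open>J\<close>,
    and the choice of \<open>e\<close> forces \<open>r e = - v\<close>.\<close>
  moreover have "y = \<zero>\<^bsub>I\<^esub>" if "(\<zero>\<^bsub>B\<^esub>, y) \<in> G'" for y
  proof -
    obtain u v r where *: "(u, v) \<in> G" "r \<in> carrier R"
      "u \<oplus>\<^bsub>B\<^esub> r \<odot>\<^bsub>B\<^esub> b = \<zero>\<^bsub>B\<^esub>" "y = v \<oplus>\<^bsub>I\<^esub> r \<odot>\<^bsub>I\<^esub> e"
      using \<open>(\<zero>\<^bsub>B\<^esub>, y) \<in> G'\<close> unfolding G'_def by auto
    have "r \<odot>\<^bsub>B\<^esub> b = \<ominus>\<^bsub>B\<^esub> u"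
      using *(1-3) b Gsub by (metis B.M.a_comm B.M.minus_equality B.smult_closed)
    hence "(r \<odot>\<^bsub>B\<^esub> b, \<ominus>\<^bsub>I\<^esub> v) \<in> G" using Gneg[OF *(1)] by simp
    moreover from this have "r \<in> J" using JI *(2) by blast
    ultimately have "r \<odot>\<^bsub>I\<^esub> e = \<ominus>\<^bsub>I\<^esub> v" using e feq by metis
    thus ?thesis using *(4) Gsub[OF *(1)] by (simp add: I.M.r_neg)
  qed
  moreover have "G \<subseteq> G'"
  proof
    fix p assume "p \<in> G"
    thus "p \<in> G'" using G'I[of "fst p" "snd p" "\<zero>\<^bsub>R\<^esub>"] b e Gsub[of "fst p" "snd p"] by simp
  qed
  moreover have "(b, e) \<in> G'" using G'I[OF G0, of "\<one>\<^bsub>R\<^esub>"] b e by simp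
  ultimately show ?thesis by blast
qed

text \<open>By Zorn's lemma there is a maximal single-valued submodule of the product containing the
  graph of \<open>f\<close>. It is total, because any element of \<open>B\<close> could be adjoined
  to its domain.\<close>

theorem baer_injective_extend:
  assumes I: "baer_injective R I" and B: "module R B" and A: "submodule A R B"
    and f: "f \<in> mod_hom R (B\<lparr>carrier := A\<rparr>) I"
  shows "\<exists>g\<in>mod_hom R B I. \<forall>x\<in>A. g x = f x"
proof -
  interpret B: module R B by fact
  interpret I: module R I using I by (rule baer_injective_module)
  have modP: "module R (prod_module B I)"
    by (rule module_prod_module) (fact B, rule I.module_axioms)
  have modA: "module R (B\<lparr>carrier := A\<rparr>)" using module_restrict_carrier[OF B A] .
  have Asub: "x \<in> carrier B" if "x \<in> A" for x using submodule_subset[OF A] that by blast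
  define Gf where "Gf = (\<lambda>a. (a, f a)) ` A"
  define S where "S = {G. submodule G R (prod_module B I) \<and> (\<forall>y. (\<zero>\<^bsub>B\<^esub>, y) \<in> G \<longrightarrow> y = \<zero>\<^bsub>I\<^esub>) \<and> Gf \<subseteq> G}"
  have f0: "f \<zero>\<^bsub>B\<^esub> = \<zero>\<^bsub>I\<^esub>" using mod_hom_zero[OF modA I.module_axioms f] by simp
  have "submodule Gf R (prod_module B I)"
    by (rule submodule_if_closed[OF modP])
      (use Asub mod_hom_closed[OF f] mod_hom_add[OF f] mod_hom_smult[OF f] f0 submodule_zero[OF A]
        submodule_add[OF A] submodule_smult[OF A] in \<open>auto simp: Gf_def image_iff\<close>)
  hence "Gf \<in> S" using f0 by (auto simp: S_def Gf_def)
  hence ne: "S \<noteq> {}" by blast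
  have "\<exists>G\<in>S. \<forall>X\<in>S. G \<subseteq> X \<longrightarrow> X = G"
  proof (rule subset_Zorn_nonempty[OF ne])
    fix C assume C: "C \<noteq> {}" "subset.chain S C"
    have CS: "C \<subseteq> S" using C(2) by (simp add: subset_chain_def)
    have sub: "submodule X R (prod_module B I)" if "X \<in> C" for X using that CS by (auto simp: S_def)
    have "submodule (\<Union>C) R (prod_module B I)"
    proof (rule submodule_if_closed[OF modP])
      show "\<Union>C \<subseteq> carrier (prod_module B I)" using submodule_subset[OF sub] by blast
      show "\<zero>\<^bsub>prod_module B I\<^esub> \<in> \<Union>C" using submodule_zero[OF sub] C(1) by blast
    next
      fix p q assume "p \<in> \<Union>C" "q \<in> \<Union>C"
      then obtain X Y where XY: "X \<in> C" "Y \<in> C" "p \<in> X" "q \<in> Y" by blast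
      have "X \<subseteq> Y \<or> Y \<subseteq> X" using C(2) XY by (auto simp: subset_chain_def)
      thus "p \<oplus>\<^bsub>prod_module B I\<^esub> q \<in> \<Union>C"
        using XY submodule_add[OF sub] by blast
    next
      fix r p assume "r \<in> carrier R" "p \<in> \<Union>C"
      thus "r \<odot>\<^bsub>prod_module B I\<^esub> p \<in> \<Union>C" using submodule_smult[OF sub] by blast
    qed
    moreover have "y = \<zero>\<^bsub>I\<^esub>" if "(\<zero>\<^bsub>B\<^esub>, y) \<in> \<Union>C" for y using that CS by (auto simp: S_def)
    moreover have "Gf \<subseteq> \<Union>C" using C(1) CS by (auto simp: S_def)
    ultimately show "\<Union>C \<in> S" by (simp add: S_def)
  qed
  then obtain G where GS: "G \<in> S" and max: "\<And>X. X \<in> S \<Longrightarrow> G \<subseteq> X \<Longrightarrow> X = G"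
    by blast
  have G: "submodule G R (prod_module B I)" "\<And>y. (\<zero>\<^bsub>B\<^esub>, y) \<in> G \<Longrightarrow> y = \<zero>\<^bsub>I\<^esub>" "Gf \<subseteq> G"
    using GS by (simp_all add: S_def)
  have tot: "\<exists>y. (b, y) \<in> G" if b: "b \<in> carrier B" for b
  proof -
    obtain G' e where "submodule G' R (prod_module B I)" "\<forall>y. (\<zero>\<^bsub>B\<^esub>, y) \<in> G' \<longrightarrow> y = \<zero>\<^bsub>I\<^esub>"
     "G \<subseteq> G'" "(b, e) \<in> G'"
      using baer_injective_maximal_graph[OF I B G(1,2) b] by blast
    moreover from this have "G' = G" using G(3) by (intro max) (auto simp: S_def)
    ultimately show ?thesis by blast
  qed
  have Gsub: "u \<in> carrier B" "v \<in> carrier I" if "(u, v) \<in> G" for u v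
    using submodule_subset[OF G(1)] that by auto
  have uniq: "v = v'" if "(u, v) \<in> G" "(u, v') \<in> G" for u v v'
  proof -
    have "(u, v) \<ominus>\<^bsub>prod_module B I\<^esub> (u, v') \<in> G"
      using submodule_minus[OF modP G(1) that] .
    hence "(\<zero>\<^bsub>B\<^esub>, v \<ominus>\<^bsub>I\<^esub> v') \<in> G"
      using Gsub[OF that(1)] Gsub[OF that(2)]
      by (simp add: prod_module_minus[OF B I.module_axioms])
    hence "v \<ominus>\<^bsub>I\<^esub> v' = \<zero>\<^bsub>I\<^esub>" by (rule G(2))
    thus ?thesis using Gsub[OF that(1)] Gsub[OF that(2)] by simp
  qed
  define g where "g b = (THE y. (b, y) \<in> G)" for b
  have g: "(b, g b) \<in> G" if "b \<in> carrier B" for b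
    unfolding g_def by (rule theI') (use tot[OF that] uniq in blast)
  have geq: "g b = y" if "(b, y) \<in> G" for b y
    using g uniq that Gsub by blast
  have "g \<in> mod_hom R B I"
  proof (rule mod_homI)
    fix x assume "x \<in> carrier B" thus "g x \<in> carrier I" using g Gsub by blast
  next
    fix x y assume "x \<in> carrier B" "y \<in> carrier B"
    thus "g (x \<oplus>\<^bsub>B\<^esub> y) = g x \<oplus>\<^bsub>I\<^esub> g y" using submodule_add[OF G(1) g g, of x y] by (intro geq) simp
  next
    fix r x assume "r \<in> carrier R" "x \<in> carrier B"
    thus "g (r \<odot>\<^bsub>B\<^esub> x) = r \<odot>\<^bsub>I\<^esub> g x" using submodule_smult[OF G(1) _ g, of r x] by (intro geq) simp
  qed
  moreover have "g x = f x" if "x \<in> A" for x using G(3) that by (intro geq) (auto simp: Gf_def)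
  ultimately show ?thesis by blast
qed

lemma baer_injective_imp_injective_module: "baer_injective R I \<Longrightarrow> injective_module R I"
  unfolding injective_module_def using baer_injective_extend baer_injective_module by blast

text \<open>The test module is the copy of \<open>R\<close> that \<open>Inl\<close> places in
  \<open>'r + 'i\<close>. A map on the whole of this copy is multiplication by its value at
  one.\<close>

lemma injective_module_imp_baer_injective:
  fixes R :: "('r, 'k) ring_scheme" and I :: "('r, 'i, 'l) module_scheme"
  assumes "injective_module R I"
  shows "baer_injective R I"
  unfolding baer_injective_def
proof (intro conjI allI impI)
  show modI: "module R I" using assms by (simp add: injective_module_def)
  then interpret I: module R I .
  fix J f assume J: "ideal J R" and f: "f \<in> mod_hom R ((self_module R)\<lparr>carrier := J\<rparr>) I"
  have Jsub: "J \<subseteq> carrier R" using J by (simp add: additive_subgroup.a_subset ideal.axioms(1))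
  let ?S = "self_module R"
  define B :: "('r, 'r + 'i) module" where "B = map_module Inl ?S"
  have modS: "module R ?S" using module_self_module[OF I.is_cring] .
  have carS: "carrier ?S = carrier R" by (simp add: self_module_def)
  have inj: "inj_on (Inl :: 'r \<Rightarrow> 'r + 'i) (carrier ?S)" by simp
  have modB: "module R B" unfolding B_def using module_map_module[OF modS inj] .
  have subJ: "submodule J R ?S" using submodule_ideal[OF I.is_cring J] .
  have subB: "submodule (Inl ` J) R B"
    unfolding B_def using submodule_mod_hom_image[OF modS module_map_module[OF modS inj]
        map_module_hom(1)[OF modS inj] subJ] .
  have "(\<lambda>y. f (projl y)) \<in> mod_hom R (B\<lparr>carrier := Inl ` J\<rparr>) I"
  proof (rule mod_homI)
    fix x assume "x \<in> carrier (B\<lparr>carrier := Inl ` J\<rparr>)"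
    thus "f (projl x) \<in> carrier I" using mod_hom_closed[OF f] by auto
  next
    fix x y assume "x \<in> carrier (B\<lparr>carrier := Inl ` J\<rparr>)" "y \<in> carrier (B\<lparr>carrier := Inl ` J\<rparr>)"
    then obtain r s where "r \<in> J" "s \<in> J" "x = Inl r" "y = Inl s" by auto
    thus "f (projl (x \<oplus>\<^bsub>B\<lparr>carrier := Inl ` J\<rparr>\<^esub> y)) = f (projl x) \<oplus>\<^bsub>I\<^esub> f (projl y)"
      using Jsub mod_hom_add[OF f, of r s] map_module_simps(3)[OF inj, of r s]
      by (auto simp: B_def carS subset_iff)
  next
    fix r x assume "r \<in> carrier R" "x \<in> carrier (B\<lparr>carrier := Inl ` J\<rparr>)"
    then obtain s where "s \<in> J" "x = Inl s" by auto
    thus "f (projl (r \<odot>\<^bsub>B\<lparr>carrier := Inl ` J\<rparr>\<^esub> x)) = r \<odot>\<^bsub>I\<^esub> f (projl x)"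
      using Jsub mod_hom_smult[OF f, of r s] map_module_simps(4)[OF inj, of s r] \<open>r \<in> carrier R\<close>
      by (auto simp: B_def carS subset_iff)
  qed
  then obtain g where g: "g \<in> mod_hom R B I" "\<And>x. x \<in> Inl ` J \<Longrightarrow> g x = f (projl x)"
    using assms modB subB unfolding injective_module_def by blast
  have one: "Inl \<one>\<^bsub>R\<^esub> \<in> carrier B" by (auto simp: B_def map_module_simps[OF inj] carS)
  show "\<exists>e\<in>carrier I. \<forall>r\<in>J. f r = r \<odot>\<^bsub>I\<^esub> e"
  proof (intro bexI[of _ "g (Inl \<one>\<^bsub>R\<^esub>)"] ballI)
    fix r assume "r \<in> J"
    hence r: "r \<in> carrier R" using Jsub by blast
    have "r \<odot>\<^bsub>I\<^esub> g (Inl \<one>\<^bsub>R\<^esub>) = g (r \<odot>\<^bsub>B\<^esub> Inl \<one>\<^bsub>R\<^esub>)"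
      using mod_hom_smult[OF g(1) r one] by simp
    also have "r \<odot>\<^bsub>B\<^esub> Inl \<one>\<^bsub>R\<^esub> = Inl r"
      unfolding B_def using r map_module_simps(4)[OF inj, of "\<one>\<^bsub>R\<^esub>" r]
      by (simp add: carS) (simp add: self_module_def)
    finally show "f r = r \<odot>\<^bsub>I\<^esub> g (Inl \<one>\<^bsub>R\<^esub>)" using g(2) \<open>r \<in> J\<close> by simp
  qed (use mod_hom_closed[OF g(1) one] in simp)
qed

lemma baer_injective_prod_module:
  assumes "baer_injective R A" "baer_injective R B"
  shows "baer_injective R (prod_module A B)"
  unfolding baer_injective_def
proof (intro conjI allI impI)
  show "module R (prod_module A B)" using assms by (simp add: module_prod_module baer_injective_module)
  fix J f assume J: "ideal J R" and f: "f \<in> mod_hom R ((self_module R)\<lparr>carrier := J\<rparr>) (prod_module A B)"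
  have "(\<lambda>x. fst (f x)) \<in> mod_hom R ((self_module R)\<lparr>carrier := J\<rparr>) A"
    using f by (intro mod_homI) (auto simp: mod_hom_def prod_module_def Pi_iff mem_Times_iff)
  then obtain e where e: "e \<in> carrier A" "\<And>r. r \<in> J \<Longrightarrow> fst (f r) = r \<odot>\<^bsub>A\<^esub> e"
    using assms(1) J unfolding baer_injective_def by blast
  have "(\<lambda>x. snd (f x)) \<in> mod_hom R ((self_module R)\<lparr>carrier := J\<rparr>) B"
    using f by (intro mod_homI) (auto simp: mod_hom_def prod_module_def Pi_iff mem_Times_iff)
  then obtain e' where e': "e' \<in> carrier B" "\<And>r. r \<in> J \<Longrightarrow> snd (f r) = r \<odot>\<^bsub>B\<^esub> e'"
    using assms(2) J unfolding baer_injective_def by blast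
  show "\<exists>e\<in>carrier (prod_module A B). \<forall>r\<in>J. f r = r \<odot>\<^bsub>prod_module A B\<^esub> e"
    using e e' by (intro bexI[of _ "(e, e')"]) (auto intro: prod_eqI)
qed

text \<open>The form in which injectivity is used for complexes: \<open>\<alpha>\<close> need not be
  injective. As \<open>u\<close> kills the kernel of \<open>\<alpha>\<close>, it descends to the
  image of \<open>\<alpha>\<close> and extends from there.\<close>

lemma baer_injective_factor:
  assumes I: "baer_injective R I" and A: "module R A" and B: "module R B"
    and \<alpha>: "\<alpha> \<in> mod_hom R A B" and u: "u \<in> mod_hom R A I"
    and ker: "\<And>a. a \<in> carrier A \<Longrightarrow> \<alpha> a = \<zero>\<^bsub>B\<^esub> \<Longrightarrow> u a = \<zero>\<^bsub>I\<^esub>"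
  shows "\<exists>v\<in>mod_hom R B I. \<forall>a\<in>carrier A. v (\<alpha> a) = u a"
proof -
  interpret A: module R A by fact
  interpret B: module R B by fact
  interpret I: module R I using I by (rule baer_injective_module)
  have sub: "submodule (\<alpha> ` carrier A) R B"
    using submodule_mod_hom_image[OF A B \<alpha> A.carrier_is_submodule] .
  define f where "f b = u (inv_into (carrier A) \<alpha> b)" for b
  have f: "f (\<alpha> a) = u a" if "a \<in> carrier A" for a
  proof -
    define a' where "a' = inv_into (carrier A) \<alpha> (\<alpha> a)"
    have a': "a' \<in> carrier A" "\<alpha> a' = \<alpha> a"
      using that by (auto simp: a'_def inv_into_into f_inv_into_f)
    have "\<alpha> (a' \<ominus>\<^bsub>A\<^esub> a) = \<zero>\<^bsub>B\<^esub>"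
      using a' that mod_hom_closed[OF \<alpha>] by (simp add: mod_hom_minus[OF A B \<alpha>])
    hence "u (a' \<ominus>\<^bsub>A\<^esub> a) = \<zero>\<^bsub>I\<^esub>" using a' that by (intro ker) auto
    hence "u a' = u a" using a' that mod_hom_closed[OF u]
      by (simp add: mod_hom_minus[OF A I.module_axioms u])
    thus ?thesis by (simp add: f_def a'_def)
  qed
  have "f \<in> mod_hom R (B\<lparr>carrier := \<alpha> ` carrier A\<rparr>) I"
  proof (rule mod_homI)
    fix x assume "x \<in> carrier (B\<lparr>carrier := \<alpha> ` carrier A\<rparr>)"
    thus "f x \<in> carrier I" using f mod_hom_closed[OF u] by auto
  next
    fix x y assume "x \<in> carrier (B\<lparr>carrier := \<alpha> ` carrier A\<rparr>)" "y \<in> carrier (B\<lparr>carrier := \<alpha> ` carrier A\<rparr>)"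
    then obtain a a' where a: "a \<in> carrier A" "a' \<in> carrier A" "x = \<alpha> a" "y = \<alpha> a'" by auto
    hence "x \<oplus>\<^bsub>B\<^esub> y = \<alpha> (a \<oplus>\<^bsub>A\<^esub> a')" using mod_hom_add[OF \<alpha>] by simp
    thus "f (x \<oplus>\<^bsub>B\<lparr>carrier := \<alpha> ` carrier A\<rparr>\<^esub> y) = f x \<oplus>\<^bsub>I\<^esub> f y"
      using a f mod_hom_add[OF u] by simp
  next
    fix r x assume r: "r \<in> carrier R" and "x \<in> carrier (B\<lparr>carrier := \<alpha> ` carrier A\<rparr>)"
    then obtain a where a: "a \<in> carrier A" "x = \<alpha> a" by auto
    hence "r \<odot>\<^bsub>B\<^esub> x = \<alpha> (r \<odot>\<^bsub>A\<^esub> a)" using mod_hom_smult[OF \<alpha>] r by simp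
    thus "f (r \<odot>\<^bsub>B\<lparr>carrier := \<alpha> ` carrier A\<rparr>\<^esub> x) = r \<odot>\<^bsub>I\<^esub> f x"
      using a f mod_hom_smult[OF u] r by simp
  qed
  from baer_injective_extend[OF I B sub this] show ?thesis using f by fastforce
qed

section \<open>Complexes of injective modules\<close>

text \<open>Exactness is asked in positive degrees only. The kernel of \<open>d 0\<close> is the
  module being resolved; when it is zero the complex is contractible.\<close>

locale injective_complex =
  fixes R :: "('r, 'k) ring_scheme" and I :: "nat \<Rightarrow> ('r, 'i, 'l) module_scheme"
    and d :: "nat \<Rightarrow> 'i \<Rightarrow> 'i"
  assumes inj: "baer_injective R (I n)"
    and hom: "d n \<in> mod_hom R (I n) (I (Suc n))"
    and dd: "a \<in> carrier (I n) \<Longrightarrow> d (Suc n) (d n a) = \<zero>\<^bsub>I (Suc (Suc n))\<^esub>"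
    and exact: "a \<in> carrier (I (Suc n)) \<Longrightarrow> d (Suc n) a = \<zero>\<^bsub>I (Suc (Suc n))\<^esub> \<Longrightarrow>
      \<exists>b\<in>carrier (I n). d n b = a"
begin

lemma mod: "module R (I n)"
  using inj by (rule baer_injective_module)

lemmas closed = mod_hom_closed[OF hom]
lemmas add = mod_hom_add[OF hom]
lemmas smult = mod_hom_smult[OF hom]
lemmas minus = mod_hom_minus[OF mod mod hom]
lemmas zero = mod_hom_zero[OF mod mod hom]

end

text \<open>An augmentation need not be injective: it exhibits \<open>I\<close> as a resolution of
  \<open>M\<close> modulo its kernel, which lets one module serve for all quotients of it.\<close>

definition augmentation ::
  "('r, 'k) ring_scheme \<Rightarrow> ('r, 'm, 'j) module_scheme \<Rightarrow> (nat \<Rightarrow> ('r, 'i, 'l) module_scheme) \<Rightarrow>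
     (nat \<Rightarrow> 'i \<Rightarrow> 'i) \<Rightarrow> ('m \<Rightarrow> 'i) \<Rightarrow> bool" where
  "augmentation R M I d \<epsilon> \<longleftrightarrow>
     module R M \<and> \<epsilon> \<in> mod_hom R M (I 0) \<and> \<epsilon> ` carrier M = mod_ker (I 0) (I 1) (d 0)"

text \<open>The comparison theorem: each component of the lift is obtained by extending along
  \<open>d n\<close>, degree by degree. The hypothesis \<open>ker\<close> lets \<open>g\<close>
  factor through the image of \<open>\<epsilon>\<close>, which need not be a copy of
  \<open>M\<close>.\<close>

lemma injective_complex_lift:
  assumes "injective_complex R I d" and "injective_complex R J e" and aug: "augmentation R M I d \<epsilon>"
    and g: "g \<in> mod_hom R M (J 0)"
    and g0: "\<And>m. m \<in> carrier M \<Longrightarrow> e 0 (g m) = \<zero>\<^bsub>J 1\<^esub>"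
    and ker: "\<And>m. m \<in> carrier M \<Longrightarrow> \<epsilon> m = \<zero>\<^bsub>I 0\<^esub> \<Longrightarrow> g m = \<zero>\<^bsub>J 0\<^esub>"
  shows "\<exists>G. (\<forall>n. G n \<in> mod_hom R (I n) (J n)) \<and>
     (\<forall>n. \<forall>a\<in>carrier (I n). G (Suc n) (d n a) = e n (G n a)) \<and>
     (\<forall>m\<in>carrier M. G 0 (\<epsilon> m) = g m)"
proof -
  interpret X: injective_complex R I d by fact
  interpret Y: injective_complex R J e by fact
  have M: "module R M" and \<epsilon>: "\<epsilon> \<in> mod_hom R M (I 0)" and im: "\<epsilon> ` carrier M = mod_ker (I 0) (I 1) (d 0)"
    using aug by (auto simp: augmentation_def)
  \<comment> \<open>The second conjunct, that cocycles go to cocycles, is exactly the kernel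
    condition for extending one degree further.\<close>
  define P where "P n f \<longleftrightarrow> f \<in> mod_hom R (I n) (J n) \<and>
     (\<forall>a\<in>carrier (I n). d n a = \<zero>\<^bsub>I (Suc n)\<^esub> \<longrightarrow> e n (f a) = \<zero>\<^bsub>J (Suc n)\<^esub>) \<and>
     (n = 0 \<longrightarrow> (\<forall>m\<in>carrier M. f (\<epsilon> m) = g m))" for n f
  define Q where "Q n f f' \<longleftrightarrow> (\<forall>a\<in>carrier (I n). f' (d n a) = e n (f a))" for n f f'
  have "\<exists>f. P 0 f"
  proof -
    obtain f where f: "f \<in> mod_hom R (I 0) (J 0)" "\<And>m. m \<in> carrier M \<Longrightarrow> f (\<epsilon> m) = g m"
      using baer_injective_factor[OF Y.inj M X.mod \<epsilon> g ker] by blast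
    have "e 0 (f a) = \<zero>\<^bsub>J 1\<^esub>" if "a \<in> carrier (I 0)" "d 0 a = \<zero>\<^bsub>I 1\<^esub>" for a
    proof -
      have "a \<in> \<epsilon> ` carrier M" using that im by (simp add: mod_ker_def)
      thus ?thesis using f g0 by auto
    qed
    thus ?thesis using f by (auto simp: P_def)
  qed
  moreover have "\<exists>f'. P (Suc n) f' \<and> Q n f f'" if P: "P n f" for n f
  proof -
    have f: "f \<in> mod_hom R (I n) (J n)" using P by (simp add: P_def)
    obtain f' where f': "f' \<in> mod_hom R (I (Suc n)) (J (Suc n))"
      "\<And>a. a \<in> carrier (I n) \<Longrightarrow> f' (d n a) = e n (f a)"
      using baer_injective_factor[OF Y.inj X.mod X.mod X.hom mod_hom_compose[OF f Y.hom]] P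
      unfolding P_def by blast
    have "e (Suc n) (f' a) = \<zero>\<^bsub>J (Suc (Suc n))\<^esub>"
      if "a \<in> carrier (I (Suc n))" "d (Suc n) a = \<zero>\<^bsub>I (Suc (Suc n))\<^esub>" for a
      using X.exact[OF that] f'(2) Y.dd mod_hom_closed[OF f] by force
    thus ?thesis using f' by (auto simp: P_def Q_def)
  qed
  ultimately obtain G where G: "\<forall>n. P n (G n)" "\<forall>n. Q n (G n) (G (Suc n))"
    using dependent_nat_choice[of P Q] by blast
  show ?thesis using G by (intro exI[of _ G]) (simp add: P_def Q_def)
qed

text \<open>\<open>F0\<close> says that \<open>F\<close> lifts the zero map of the resolved modules.
  The next component of the homotopy extends \<open>F - e s\<close> along \<open>d\<close>; this
  difference kills cocycles because each of them is some \<open>d n b\<close>, where the second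
  conjunct of \<open>P\<close> applies.\<close>

lemma injective_complex_homotopy:
  assumes "injective_complex R I d" and "injective_complex R J e"
    and F: "\<And>n. F n \<in> mod_hom R (I n) (J n)"
    and Fd: "\<And>n a. a \<in> carrier (I n) \<Longrightarrow> F (Suc n) (d n a) = e n (F n a)"
    and F0: "\<And>a. a \<in> carrier (I 0) \<Longrightarrow> d 0 a = \<zero>\<^bsub>I 1\<^esub> \<Longrightarrow> F 0 a = \<zero>\<^bsub>J 0\<^esub>"
  shows "\<exists>s. (\<forall>n. s n \<in> mod_hom R (I (Suc n)) (J n)) \<and>
     (\<forall>a\<in>carrier (I 0). s 0 (d 0 a) = F 0 a) \<and>
     (\<forall>n. \<forall>a\<in>carrier (I (Suc n)). s (Suc n) (d (Suc n) a) \<oplus>\<^bsub>J (Suc n)\<^esub> e n (s n a) = F (Suc n) a)"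
proof -
  interpret X: injective_complex R I d by fact
  interpret Y: injective_complex R J e by fact
  define P where "P n f \<longleftrightarrow> f \<in> mod_hom R (I (Suc n)) (J n) \<and>
     (\<forall>a\<in>carrier (I n). e n (f (d n a)) = e n (F n a)) \<and>
     (n = 0 \<longrightarrow> (\<forall>a\<in>carrier (I 0). f (d 0 a) = F 0 a))" for n f
  define Q where "Q n f f' \<longleftrightarrow>
    (\<forall>a\<in>carrier (I (Suc n)). f' (d (Suc n) a) = F (Suc n) a \<ominus>\<^bsub>J (Suc n)\<^esub> e n (f a))" for n f f'
  have "\<exists>f. P 0 f"
    using baer_injective_factor[OF Y.inj X.mod X.mod X.hom F] F0 unfolding P_def by fastforce
  moreover have "\<exists>f'. P (Suc n) f' \<and> Q n f f'" if P: "P n f" for n f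
  proof -
    interpret J: module R "J (Suc n)" by (rule Y.mod)
    interpret J': module R "J (Suc (Suc n))" by (rule Y.mod)
    have f: "f \<in> mod_hom R (I (Suc n)) (J n)" using P by (simp add: P_def)
    define u where "u = (\<lambda>a. F (Suc n) a \<ominus>\<^bsub>J (Suc n)\<^esub> e n (f a))"
    have u: "u \<in> mod_hom R (I (Suc n)) (J (Suc n))"
      unfolding u_def using mod_hom_diff[OF Y.mod F mod_hom_compose[OF f Y.hom]] .
    have "u a = \<zero>\<^bsub>J (Suc n)\<^esub>"
      if a: "a \<in> carrier (I (Suc n))" "d (Suc n) a = \<zero>\<^bsub>I (Suc (Suc n))\<^esub>" for a
    proof -
      obtain b where b: "b \<in> carrier (I n)" "d n b = a" using X.exact[OF a] by blast
      have "F (Suc n) a = e n (f a)" using b Fd P by (auto simp: P_def)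
      thus ?thesis using Y.closed[OF mod_hom_closed[OF f a(1)]] by (simp add: u_def)
    qed
    then obtain f' where f': "f' \<in> mod_hom R (I (Suc (Suc n))) (J (Suc n))"
      "\<And>a. a \<in> carrier (I (Suc n)) \<Longrightarrow> f' (d (Suc n) a) = u a"
      using baer_injective_factor[OF Y.inj X.mod X.mod X.hom u] by blast
    have "e (Suc n) (f' (d (Suc n) a)) = e (Suc n) (F (Suc n) a)" if "a \<in> carrier (I (Suc n))" for a
    proof -
      have "f a \<in> carrier (J n)" using mod_hom_closed[OF f] that .
      thus ?thesis
        using that f' mod_hom_closed[OF F] Y.closed
        by (simp add: u_def Y.minus Y.dd)
    qed
    thus ?thesis using f' by (auto simp: P_def Q_def u_def)
  qed
  ultimately obtain s where s: "\<forall>n. P n (s n)" "\<forall>n. Q n (s n) (s (Suc n))"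
    using dependent_nat_choice[of P Q] by blast
  have "s (Suc n) (d (Suc n) a) \<oplus>\<^bsub>J (Suc n)\<^esub> e n (s n a) = F (Suc n) a" if a: "a \<in> carrier (I (Suc n))" for n a
  proof -
    interpret J: module R "J (Suc n)" by (rule Y.mod)
    have "s n \<in> mod_hom R (I (Suc n)) (J n)" using s(1) by (simp add: P_def)
    hence "s n a \<in> carrier (J n)" using a by (rule mod_hom_closed)
    thus ?thesis using s(2) a mod_hom_closed[OF F] Y.closed unfolding Q_def by simp
  qed
  moreover have "s n \<in> mod_hom R (I (Suc n)) (J n)" for n using s(1) by (simp add: P_def)
  moreover have "s 0 (d 0 a) = F 0 a" if "a \<in> carrier (I 0)" for a using s(1) that by (simp add: P_def)
  ultimately show ?thesis by (intro exI[of _ s]) simp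
qed

section \<open>Torsion\<close>

definition torsion_elements ::
  "('r, 'k) ring_scheme \<Rightarrow> 'r set \<Rightarrow> ('r, 'm, 'l) module_scheme \<Rightarrow> 'm set" where
  "torsion_elements R \<aa> M = carrier (torsion_part R \<aa> M)"

lemma torsion_elements_iff:
  "m \<in> torsion_elements R \<aa> M \<longleftrightarrow>
     m \<in> carrier M \<and> (\<exists>n. \<forall>r\<in>ideal_power R \<aa> n. r \<odot>\<^bsub>M\<^esub> m = \<zero>\<^bsub>M\<^esub>)"
  by (auto simp: torsion_elements_def torsion_part_def)

lemma torsion_elements_carrier: "m \<in> torsion_elements R \<aa> M \<Longrightarrow> m \<in> carrier M"
  by (simp add: torsion_elements_iff)

lemma ideal_ideal_power:
  assumes "ring R" "ideal \<aa> R"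
  shows "ideal (ideal_power R \<aa> n) R"
proof -
  interpret ring R by fact
  show ?thesis using assms by (induction n) (auto simp: oneideal ideal_prod_is_ideal)
qed

lemma ideal_power_antimono:
  assumes "ring R" "ideal \<aa> R" "m \<le> n"
  shows "ideal_power R \<aa> n \<subseteq> ideal_power R \<aa> m"
proof -
  interpret ring R by fact
  show ?thesis using assms(3)
  proof (induction n rule: dec_induct)
    case (step n)
    have "ideal_power R \<aa> (Suc n) \<subseteq> ideal_power R \<aa> n"
      using ideal_prod_inter[OF ideal_ideal_power[OF assms(1,2)] assms(2)] by simp
    thus ?case using step by blast
  qed simp
qed

lemma nat_pow_in_ideal_power:
  assumes "ring R" "x \<in> \<aa>"
  shows "x [^]\<^bsub>R\<^esub> (n::nat) \<in> ideal_power R \<aa> n"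
proof -
  interpret ring R by fact
  show ?thesis using assms(2) by (induction n) (auto intro: ideal_prod.prod)
qed

lemma submodule_torsion_elements:
  assumes "module R M" "ideal \<aa> R"
  shows "submodule (torsion_elements R \<aa> M) R M"
proof (rule submodule_if_closed[OF assms(1)])
  interpret M: module R M by fact
  have sub: "r \<in> carrier R" if "r \<in> ideal_power R \<aa> n" for r n
    using ideal_ideal_power[OF M.R.ring_axioms assms(2)] that
    by (meson additive_subgroup.a_subset ideal.axioms(1) subsetD)
  show "torsion_elements R \<aa> M \<subseteq> carrier M" by (auto simp: torsion_elements_iff)
  show "\<zero>\<^bsub>M\<^esub> \<in> torsion_elements R \<aa> M" using sub by (auto simp: torsion_elements_iff)
  fix a b assume "a \<in> torsion_elements R \<aa> M" "b \<in> torsion_elements R \<aa> M"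
  then obtain m n where *: "a \<in> carrier M" "b \<in> carrier M"
    "\<forall>r\<in>ideal_power R \<aa> m. r \<odot>\<^bsub>M\<^esub> a = \<zero>\<^bsub>M\<^esub>" "\<forall>r\<in>ideal_power R \<aa> n. r \<odot>\<^bsub>M\<^esub> b = \<zero>\<^bsub>M\<^esub>"
    by (auto simp: torsion_elements_iff)
  have "r \<odot>\<^bsub>M\<^esub> (a \<oplus>\<^bsub>M\<^esub> b) = \<zero>\<^bsub>M\<^esub>" if r: "r \<in> ideal_power R \<aa> (max m n)" for r
  proof -
    have "r \<in> ideal_power R \<aa> m" "r \<in> ideal_power R \<aa> n"
      using r ideal_power_antimono[OF M.R.ring_axioms assms(2)] by (meson max.cobounded1 max.cobounded2 subsetD)+
    thus ?thesis using * sub by (simp add: M.smult_r_distr)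
  qed
  thus "a \<oplus>\<^bsub>M\<^esub> b \<in> torsion_elements R \<aa> M" using * unfolding torsion_elements_iff by blast
next
  interpret M: module R M by fact
  have sub: "r \<in> carrier R" if "r \<in> ideal_power R \<aa> n" for r n
    using ideal_ideal_power[OF M.R.ring_axioms assms(2)] that
    by (meson additive_subgroup.a_subset ideal.axioms(1) subsetD)
  fix r a assume r: "r \<in> carrier R" and "a \<in> torsion_elements R \<aa> M"
  then obtain m where *: "a \<in> carrier M" "\<forall>r\<in>ideal_power R \<aa> m. r \<odot>\<^bsub>M\<^esub> a = \<zero>\<^bsub>M\<^esub>"
    by (auto simp: torsion_elements_iff)
  have "s \<odot>\<^bsub>M\<^esub> (r \<odot>\<^bsub>M\<^esub> a) = \<zero>\<^bsub>M\<^esub>" if s: "s \<in> ideal_power R \<aa> m" for s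
  proof -
    have "s \<odot>\<^bsub>M\<^esub> (r \<odot>\<^bsub>M\<^esub> a) = r \<odot>\<^bsub>M\<^esub> (s \<odot>\<^bsub>M\<^esub> a)"
      using * r sub[OF s] M.smult_assoc1 M.R.m_comm by metis
    thus ?thesis using * r s by simp
  qed
  thus "r \<odot>\<^bsub>M\<^esub> a \<in> torsion_elements R \<aa> M" using * r unfolding torsion_elements_iff by blast
qed

lemma mod_hom_torsion_elements:
  assumes "module R M" "module R N" "ideal \<aa> R" "f \<in> mod_hom R M N" "m \<in> torsion_elements R \<aa> M"
  shows "f m \<in> torsion_elements R \<aa> N"
proof -
  interpret M: module R M by fact
  have sub: "r \<in> carrier R" if "r \<in> ideal_power R \<aa> n" for r n
    using ideal_ideal_power[OF M.R.ring_axioms assms(3)] that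
    by (meson additive_subgroup.a_subset ideal.axioms(1) subsetD)
  obtain n where *: "m \<in> carrier M" "\<forall>r\<in>ideal_power R \<aa> n. r \<odot>\<^bsub>M\<^esub> m = \<zero>\<^bsub>M\<^esub>"
    using assms(5) by (auto simp: torsion_elements_iff)
  have "r \<odot>\<^bsub>N\<^esub> f m = \<zero>\<^bsub>N\<^esub>" if "r \<in> ideal_power R \<aa> n" for r
    using * that sub mod_hom_smult[OF assms(4)] mod_hom_zero[OF assms(1,2,4)] by metis
  thus ?thesis using * mod_hom_closed[OF assms(4)] unfolding torsion_elements_iff by blast
qed

text \<open>The projections and the inclusions are homomorphisms, and homomorphisms preserve
  torsion.\<close>

lemma torsion_elements_prod_module:
  assumes "module R A" "module R B" "ideal \<aa> R"
  shows "torsion_elements R \<aa> (prod_module A B) = torsion_elements R \<aa> A \<times> torsion_elements R \<aa> B"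
proof -
  interpret A: module R A by fact
  interpret B: module R B by fact
  have P: "module R (prod_module A B)" using assms by (simp add: module_prod_module)
  have 1: "fst \<in> mod_hom R (prod_module A B) A" "snd \<in> mod_hom R (prod_module A B) B"
    by (auto intro!: mod_homI)
  have 2: "(\<lambda>a. (a, \<zero>\<^bsub>B\<^esub>)) \<in> mod_hom R A (prod_module A B)"
    "(\<lambda>b. (\<zero>\<^bsub>A\<^esub>, b)) \<in> mod_hom R B (prod_module A B)"
    by (auto intro!: mod_homI)
  show ?thesis
  proof (intro equalityI subsetI)
    fix p assume "p \<in> torsion_elements R \<aa> (prod_module A B)"
    thus "p \<in> torsion_elements R \<aa> A \<times> torsion_elements R \<aa> B"
      using mod_hom_torsion_elements[OF P assms(1,3) 1(1)] mod_hom_torsion_elements[OF P assms(2,3) 1(2)]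
      by (simp add: mem_Times_iff)
  next
    fix p assume "p \<in> torsion_elements R \<aa> A \<times> torsion_elements R \<aa> B"
    then obtain a b where p: "p = (a, b)" "a \<in> torsion_elements R \<aa> A" "b \<in> torsion_elements R \<aa> B" by blast
    have "(a, \<zero>\<^bsub>B\<^esub>) \<oplus>\<^bsub>prod_module A B\<^esub> (\<zero>\<^bsub>A\<^esub>, b) \<in> torsion_elements R \<aa> (prod_module A B)"
      using mod_hom_torsion_elements[OF assms(1) P assms(3) 2(1) p(2)]
        mod_hom_torsion_elements[OF assms(2) P assms(3) 2(2) p(3)]
      by (rule submodule_add[OF submodule_torsion_elements[OF P assms(3)]])
    thus "p \<in> torsion_elements R \<aa> (prod_module A B)"
      using p(1) torsion_elements_carrier[OF p(2)] torsion_elements_carrier[OF p(3)] by simp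
  qed
qed

text \<open>An exact complex of injective modules that starts in degree 0 is contractible, so it stays
  exact when a functor such as torsion is applied.\<close>

lemma (in injective_complex) torsion_exact:
  assumes "ideal \<aa> R" and 0: "\<And>a. a \<in> carrier (I 0) \<Longrightarrow> d 0 a = \<zero>\<^bsub>I 1\<^esub> \<Longrightarrow> a = \<zero>\<^bsub>I 0\<^esub>"
    and a: "a \<in> torsion_elements R \<aa> (I (Suc n))" "d (Suc n) a = \<zero>\<^bsub>I (Suc (Suc n))\<^esub>"
  shows "\<exists>b\<in>torsion_elements R \<aa> (I n). d n b = a"
proof -
  have self: "injective_complex R I d" by (rule injective_complex_axioms)
  have id: "(\<lambda>a. a) \<in> mod_hom R (I m) (I m)" for m by (auto intro!: mod_homI)
  \<comment> \<open>By the hypothesis \<open>0\<close> the identity is a lift of the zero map, so it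
    is null-homotopic; \<open>s n a\<close> is then a preimage of \<open>a\<close>, and it is
    torsion because \<open>a\<close> is.\<close>
  obtain s where s: "\<And>n. s n \<in> mod_hom R (I (Suc n)) (I n)"
    "\<And>n a. a \<in> carrier (I (Suc n)) \<Longrightarrow> s (Suc n) (d (Suc n) a) \<oplus>\<^bsub>I (Suc n)\<^esub> d n (s n a) = a"
    using injective_complex_homotopy[OF self self, of "\<lambda>_ a. a", OF id refl 0] by blast
  interpret In: module R "I (Suc n)" by (rule mod)
  have ac: "a \<in> carrier (I (Suc n))" using torsion_elements_carrier[OF a(1)] .
  have "s n a \<in> torsion_elements R \<aa> (I n)"
    using mod_hom_torsion_elements[OF mod mod assms(1) s(1) a(1)] .
  moreover have "d n (s n a) = a"
    using s(2)[OF ac] closed[OF mod_hom_closed[OF s(1) ac]]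
    by (simp add: a(2) mod_hom_zero[OF mod mod s(1)])
  ultimately show ?thesis by blast
qed

section \<open>The iterated mapping cone\<close>

text \<open>The total complex of \<open>A \<rightarrow> B[1] \<rightarrow> C[2]\<close>, where the composite is null-homotopic via
  \<open>\<sigma>\<close>. The modules are indexed so that \<open>B\<close> starts in degree 1 and \<open>C\<close> in degree 2; the conditions
  \<open>A_exact0\<close>, \<open>B_exact1\<close> and \<open>C_exact2\<close> say that the modules resolved by the three complexes form
  a short exact sequence.\<close>

locale iterated_cone =
  fixes R :: "('r, 'k) ring_scheme"
    and A :: "nat \<Rightarrow> ('r, 'a) module" and B :: "nat \<Rightarrow> ('r, 'b) module" and C :: "nat \<Rightarrow> ('r, 'c) module"
    and dA :: "nat \<Rightarrow> 'a \<Rightarrow> 'a" and dB :: "nat \<Rightarrow> 'b \<Rightarrow> 'b" and dC :: "nat \<Rightarrow> 'c \<Rightarrow> 'c"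
    and \<alpha> :: "nat \<Rightarrow> 'a \<Rightarrow> 'b" and \<beta> :: "nat \<Rightarrow> 'b \<Rightarrow> 'c" and \<sigma> :: "nat \<Rightarrow> 'a \<Rightarrow> 'c"
  assumes A_inj: "baer_injective R (A n)" and B_inj: "baer_injective R (B n)"
    and C_inj: "baer_injective R (C n)"
    and dA: "dA n \<in> mod_hom R (A n) (A (Suc n))" and dB: "dB n \<in> mod_hom R (B n) (B (Suc n))"
    and dC: "dC n \<in> mod_hom R (C n) (C (Suc n))"
    and \<alpha>: "\<alpha> n \<in> mod_hom R (A n) (B (Suc n))" and \<beta>: "\<beta> n \<in> mod_hom R (B n) (C (Suc n))"
    and \<sigma>: "\<sigma> n \<in> mod_hom R (A n) (C (Suc n))"
    and ddA: "a \<in> carrier (A n) \<Longrightarrow> dA (Suc n) (dA n a) = \<zero>\<^bsub>A (Suc (Suc n))\<^esub>"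
    and ddB: "b \<in> carrier (B n) \<Longrightarrow> dB (Suc n) (dB n b) = \<zero>\<^bsub>B (Suc (Suc n))\<^esub>"
    and ddC: "c \<in> carrier (C n) \<Longrightarrow> dC (Suc n) (dC n c) = \<zero>\<^bsub>C (Suc (Suc n))\<^esub>"
    and \<alpha>d: "a \<in> carrier (A n) \<Longrightarrow> \<alpha> (Suc n) (dA n a) = dB (Suc n) (\<alpha> n a)"
    and \<beta>d: "b \<in> carrier (B n) \<Longrightarrow> \<beta> (Suc n) (dB n b) = dC (Suc n) (\<beta> n b)"
    and \<sigma>d: "a \<in> carrier (A n) \<Longrightarrow>
      \<sigma> (Suc n) (dA n a) \<oplus>\<^bsub>C (Suc (Suc n))\<^esub> dC (Suc n) (\<sigma> n a) = \<beta> (Suc n) (\<alpha> n a)"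
    and A_exact0: "a \<in> carrier (A 0) \<Longrightarrow> dA 0 a = \<zero>\<^bsub>A 1\<^esub> \<Longrightarrow> \<alpha> 0 a = \<zero>\<^bsub>B 1\<^esub> \<Longrightarrow> a = \<zero>\<^bsub>A 0\<^esub>"
    and A_exact: "a \<in> carrier (A (Suc n)) \<Longrightarrow> dA (Suc n) a = \<zero>\<^bsub>A (Suc (Suc n))\<^esub> \<Longrightarrow>
      \<exists>a'\<in>carrier (A n). dA n a' = a"
    and B_zero0: "carrier (B 0) = {\<zero>\<^bsub>B 0\<^esub>}"
    and B_exact1: "b \<in> carrier (B 1) \<Longrightarrow> dB 1 b = \<zero>\<^bsub>B 2\<^esub> \<Longrightarrow> \<beta> 1 b = \<zero>\<^bsub>C 2\<^esub> \<Longrightarrow>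
      \<exists>a\<in>carrier (A 0). dA 0 a = \<zero>\<^bsub>A 1\<^esub> \<and> \<alpha> 0 a = b"
    and B_exact: "b \<in> carrier (B (Suc (Suc n))) \<Longrightarrow> dB (Suc (Suc n)) b = \<zero>\<^bsub>B (Suc (Suc (Suc n)))\<^esub> \<Longrightarrow>
      \<exists>b'\<in>carrier (B (Suc n)). dB (Suc n) b' = b"
    and C_zero0: "carrier (C 0) = {\<zero>\<^bsub>C 0\<^esub>}" and C_zero1: "carrier (C 1) = {\<zero>\<^bsub>C 1\<^esub>}"
    and C_exact2: "c \<in> carrier (C 2) \<Longrightarrow> dC 2 c = \<zero>\<^bsub>C 3\<^esub> \<Longrightarrow>
      \<exists>b\<in>carrier (B 1). dB 1 b = \<zero>\<^bsub>B 2\<^esub> \<and> \<beta> 1 b = c"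
    and C_exact: "c \<in> carrier (C (Suc (Suc (Suc n)))) \<Longrightarrow>
      dC (Suc (Suc (Suc n))) c = \<zero>\<^bsub>C (Suc (Suc (Suc (Suc n))))\<^esub> \<Longrightarrow>
      \<exists>c'\<in>carrier (C (Suc (Suc n))). dC (Suc (Suc n)) c' = c"
begin

definition "Tot n = prod_module (A n) (prod_module (B n) (C n))"

text \<open>The minus signs at \<open>dB\<close> and \<open>\<sigma>\<close> make the square vanish:
  the two terms with \<open>\<alpha>\<close> cancel in \<open>B\<close>, and in \<open>C\<close> the
  terms with \<open>\<beta>\<close> and \<open>dB\<close> cancel while the remaining ones are the
  homotopy identity \<open>\<sigma>d\<close>.\<close>

definition "d_total n = (\<lambda>(a, b, c).
  (dA n a, \<alpha> n a \<ominus>\<^bsub>B (Suc n)\<^esub> dB n b, (\<beta> n b \<ominus>\<^bsub>C (Suc n)\<^esub> \<sigma> n a) \<oplus>\<^bsub>C (Suc n)\<^esub> dC n c))"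

lemma A_mod: "module R (A n)" and B_mod: "module R (B n)" and C_mod: "module R (C n)"
  using A_inj B_inj C_inj by (auto simp: baer_injective_def)

sublocale A: module R "A n" for n by (rule A_mod)
sublocale B: module R "B n" for n by (rule B_mod)
sublocale C: module R "C n" for n by (rule C_mod)

lemmas [simp] = mod_hom_closed[OF dA] mod_hom_closed[OF dB] mod_hom_closed[OF dC]
  mod_hom_closed[OF \<alpha>] mod_hom_closed[OF \<beta>] mod_hom_closed[OF \<sigma>]
  mod_hom_add[OF dA] mod_hom_add[OF dB] mod_hom_add[OF dC]
  mod_hom_add[OF \<alpha>] mod_hom_add[OF \<beta>] mod_hom_add[OF \<sigma>]
  mod_hom_smult[OF dA] mod_hom_smult[OF dB] mod_hom_smult[OF dC]
  mod_hom_smult[OF \<alpha>] mod_hom_smult[OF \<beta>] mod_hom_smult[OF \<sigma>]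
  mod_hom_zero[OF A_mod A_mod dA] mod_hom_zero[OF B_mod B_mod dB] mod_hom_zero[OF C_mod C_mod dC]
  mod_hom_zero[OF A_mod B_mod \<alpha>] mod_hom_zero[OF B_mod C_mod \<beta>] mod_hom_zero[OF A_mod C_mod \<sigma>]
  mod_hom_minus[OF A_mod A_mod dA] mod_hom_minus[OF B_mod B_mod dB] mod_hom_minus[OF C_mod C_mod dC]
  mod_hom_minus[OF A_mod B_mod \<alpha>] mod_hom_minus[OF B_mod C_mod \<beta>] mod_hom_minus[OF A_mod C_mod \<sigma>]

lemma total_inj: "baer_injective R (Tot n)"
  unfolding Tot_def by (intro baer_injective_prod_module A_inj B_inj C_inj)

lemma total_mod: "module R (Tot n)"
  using total_inj by (rule baer_injective_module)

lemma d_total_hom: "d_total n \<in> mod_hom R (Tot n) (Tot (Suc n))"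
proof (rule mod_homI)
  fix p assume "p \<in> carrier (Tot n)"
  thus "d_total n p \<in> carrier (Tot (Suc n))" by (auto simp: Tot_def d_total_def)
next
  fix p q assume "p \<in> carrier (Tot n)" "q \<in> carrier (Tot n)"
  then obtain a b c a' b' c' where "p = (a, b, c)" "q = (a', b', c')"
    "a \<in> carrier (A n)" "b \<in> carrier (B n)" "c \<in> carrier (C n)"
    "a' \<in> carrier (A n)" "b' \<in> carrier (B n)" "c' \<in> carrier (C n)"
    by (auto simp: Tot_def)
  thus "d_total n (p \<oplus>\<^bsub>Tot n\<^esub> q) = d_total n p \<oplus>\<^bsub>Tot (Suc n)\<^esub> d_total n q"
    by (simp add: Tot_def d_total_def a_minus_def B.M.minus_add C.M.minus_add B.M.a_ac C.M.a_ac)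
next
  fix r p assume "r \<in> carrier R" "p \<in> carrier (Tot n)"
  thus "d_total n (r \<odot>\<^bsub>Tot n\<^esub> p) = r \<odot>\<^bsub>Tot (Suc n)\<^esub> d_total n p"
    by (auto simp: Tot_def d_total_def module_smult_minus[OF B_mod] module_smult_minus[OF C_mod]
        C.smult_r_distr)
qed

lemma d_total_d_total:
  assumes "p \<in> carrier (Tot n)"
  shows "d_total (Suc n) (d_total n p) = \<zero>\<^bsub>Tot (Suc (Suc n))\<^esub>"
proof -
  obtain a b c where p: "p = (a, b, c)"
    "a \<in> carrier (A n)" "b \<in> carrier (B n)" "c \<in> carrier (C n)"
    using assms by (auto simp: Tot_def)
  have "(\<beta> (Suc n) (\<alpha> n a) \<ominus>\<^bsub>C (Suc (Suc n))\<^esub> \<beta> (Suc n) (dB n b) \<ominus>\<^bsub>C (Suc (Suc n))\<^esub> \<sigma> (Suc n) (dA n a))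
     \<oplus>\<^bsub>C (Suc (Suc n))\<^esub> (dC (Suc n) (\<beta> n b) \<ominus>\<^bsub>C (Suc (Suc n))\<^esub> dC (Suc n) (\<sigma> n a)) = \<zero>\<^bsub>C (Suc (Suc n))\<^esub>"
    using p by (simp add: \<sigma>d[symmetric] \<beta>d C.M.sum_minus_minus_cancel)
  thus ?thesis using p by (simp add: Tot_def d_total_def ddA ddB ddC \<alpha>d)
qed

text \<open>A cocycle is reduced modulo coboundaries one component at a time: exactness of
  \<open>A\<close> removes the first component, then the second is removed, and what is left is a
  cocycle of \<open>C\<close>. Where \<open>B\<close> or \<open>C\<close> begins, exactness of that
  complex is replaced by exactness of the sequence of resolved modules.\<close>

lemma total_exact:
  assumes p: "p \<in> carrier (Tot (Suc n))" "d_total (Suc n) p = \<zero>\<^bsub>Tot (Suc (Suc n))\<^esub>"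
  shows "\<exists>q\<in>carrier (Tot n). d_total n q = p"
proof -
  let ?im = "d_total n ` carrier (Tot n)"
  interpret T: module R "Tot (Suc n)" by (rule total_mod)
  have im: "submodule ?im R (Tot (Suc n))"
    using submodule_mod_hom_image[OF total_mod total_mod d_total_hom module.carrier_is_submodule[OF total_mod]] .
  have reduce: "q \<in> ?im" if "q \<ominus>\<^bsub>Tot (Suc n)\<^esub> d_total n r \<in> ?im" "r \<in> carrier (Tot n)"
    "q \<in> carrier (Tot (Suc n))" for q r
    using submodule_add[OF im that(1) imageI[OF that(2)]] that mod_hom_closed[OF d_total_hom] by simp
  have cocycle: "d_total (Suc n) (q \<ominus>\<^bsub>Tot (Suc n)\<^esub> d_total n r) = \<zero>\<^bsub>Tot (Suc (Suc n))\<^esub>"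
    if "d_total (Suc n) q = \<zero>\<^bsub>Tot (Suc (Suc n))\<^esub>" "r \<in> carrier (Tot n)" "q \<in> carrier (Tot (Suc n))" for q r
  proof -
    interpret T': module R "Tot (Suc (Suc n))" by (rule total_mod)
    show ?thesis using that mod_hom_closed[OF d_total_hom]
      by (simp add: mod_hom_minus[OF total_mod total_mod d_total_hom] d_total_d_total)
  qed
  have minus: "(a, b, c) \<ominus>\<^bsub>Tot (Suc n)\<^esub> (a', b', c') =
     (a \<ominus>\<^bsub>A (Suc n)\<^esub> a', b \<ominus>\<^bsub>B (Suc n)\<^esub> b', c \<ominus>\<^bsub>C (Suc n)\<^esub> c')"
    if "(a, b, c) \<in> carrier (Tot (Suc n))" "(a', b', c') \<in> carrier (Tot (Suc n))" for a b c a' b' c'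
    using that unfolding Tot_def 
    by (simp add: prod_module_minus[OF A_mod module_prod_module[OF B_mod C_mod]]
        prod_module_minus[OF B_mod C_mod])
  have C_case: "(\<zero>\<^bsub>A (Suc n)\<^esub>, \<zero>\<^bsub>B (Suc n)\<^esub>, c) \<in> ?im"
    if c: "c \<in> carrier (C (Suc n))" "dC (Suc n) c = \<zero>\<^bsub>C (Suc (Suc n))\<^esub>" for c
  proof -
    \<comment> \<open>The target degree is \<open>Suc n\<close>. In degree 1 there is no
      \<open>C\<close> yet; in degree 2, the first of \<open>C\<close>, a cocycle comes from
      \<open>B\<close> by \<open>C_exact2\<close>; from degree 3 on \<open>C\<close> is
      exact.\<close>
    consider "n = 0" | "n = 1" | m where "n = Suc (Suc m)"
      by (metis One_nat_def not0_implies_Suc)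
    thus ?thesis
    proof cases
      case 1
      hence "c = \<zero>\<^bsub>C (Suc n)\<^esub>" using c C_zero1 by simp
      thus ?thesis using submodule_zero[OF im] by (simp add: Tot_def)
    next
      case 2
      then obtain b where b: "b \<in> carrier (B 1)" "dB 1 b = \<zero>\<^bsub>B 2\<^esub>" "\<beta> 1 b = c"
        using c C_exact2[of c] by (auto simp: numeral_2_eq_2 numeral_3_eq_3)
      have "d_total n (\<zero>\<^bsub>A n\<^esub>, b, \<zero>\<^bsub>C n\<^esub>) = (\<zero>\<^bsub>A (Suc n)\<^esub>, \<zero>\<^bsub>B (Suc n)\<^esub>, c)"
        using b c 2 unfolding 2 by (simp add: d_total_def numeral_2_eq_2)
      moreover have "(\<zero>\<^bsub>A n\<^esub>, b, \<zero>\<^bsub>C n\<^esub>) \<in> carrier (Tot n)" using b 2 by (simp add: Tot_def)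
      ultimately show ?thesis by (metis imageI)
    next
      case 3
      then obtain c' where c': "c' \<in> carrier (C n)" "dC n c' = c" using c C_exact[of c m] by auto
      have "d_total n (\<zero>\<^bsub>A n\<^esub>, \<zero>\<^bsub>B n\<^esub>, c') = (\<zero>\<^bsub>A (Suc n)\<^esub>, \<zero>\<^bsub>B (Suc n)\<^esub>, c)"
        using c c' by (simp add: d_total_def)
      moreover have "(\<zero>\<^bsub>A n\<^esub>, \<zero>\<^bsub>B n\<^esub>, c') \<in> carrier (Tot n)" using c' by (simp add: Tot_def)
      ultimately show ?thesis by (metis imageI)
    qed
  qed
  have B_case: "(\<zero>\<^bsub>A (Suc n)\<^esub>, b, c) \<in> ?im"
    if bc: "b \<in> carrier (B (Suc n))" "c \<in> carrier (C (Suc n))"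
      "d_total (Suc n) (\<zero>\<^bsub>A (Suc n)\<^esub>, b, c) = \<zero>\<^bsub>Tot (Suc (Suc n))\<^esub>" for b c
  proof -
    have "\<zero>\<^bsub>B (Suc (Suc n))\<^esub> = dB (Suc n) b"
      using bc by (simp add: Tot_def d_total_def)
    hence b0: "dB (Suc n) b = \<zero>\<^bsub>B (Suc (Suc n))\<^esub>" by (rule sym)
    \<comment> \<open>In target degree 1 the element \<open>b\<close> comes from a cocycle of
      \<open>A\<close>, since \<open>C 1\<close> is zero and \<open>\<beta>\<close> therefore kills
      \<open>b\<close>. In higher degrees it is \<open>dB\<close> of some element, which enters
      negated because \<open>d_total\<close> contains \<open>- dB\<close>.\<close>
    have "\<exists>a b'. (a, b', \<zero>\<^bsub>C n\<^esub>) \<in> carrier (Tot n) \<and> dA n a = \<zero>\<^bsub>A (Suc n)\<^esub> \<and> \<alpha> n a \<ominus>\<^bsub>B (Suc n)\<^esub> dB n b' = b"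
    proof (cases n)
      case 0
      have "c = \<zero>\<^bsub>C 1\<^esub>" using bc C_zero1 0 by simp
      hence "\<beta> 1 b = \<zero>\<^bsub>C 2\<^esub>" using bc 0 by (simp add: Tot_def d_total_def numeral_2_eq_2)
      then obtain a where "a \<in> carrier (A 0)" "dA 0 a = \<zero>\<^bsub>A 1\<^esub>" "\<alpha> 0 a = b"
        using B_exact1[of b] bc b0 0 by (auto simp: numeral_2_eq_2)
      thus ?thesis using 0 bc(1) by (intro exI[of _ a] exI[of _ "\<zero>\<^bsub>B 0\<^esub>"]) (simp add: Tot_def)
    next
      case (Suc m)
      then obtain b' where b': "b' \<in> carrier (B n)" "dB n b' = b" using bc b0 B_exact[of b m] by auto
      show ?thesis
        using b' bc(1) by (intro exI[of _ "\<zero>\<^bsub>A n\<^esub>"] exI[of _ "\<ominus>\<^bsub>B n\<^esub> b'"])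
          (simp add: Tot_def mod_hom_a_inv[OF B_mod B_mod dB] a_minus_def B.M.minus_minus)
    qed
    then obtain a b' where ab: "(a, b', \<zero>\<^bsub>C n\<^esub>) \<in> carrier (Tot n)" "dA n a = \<zero>\<^bsub>A (Suc n)\<^esub>"
      "\<alpha> n a \<ominus>\<^bsub>B (Suc n)\<^esub> dB n b' = b" by blast
    let ?r = "(a, b', \<zero>\<^bsub>C n\<^esub>)" and ?q = "(\<zero>\<^bsub>A (Suc n)\<^esub>, b, c)"
    have q: "?q \<in> carrier (Tot (Suc n))" using bc by (simp add: Tot_def)
    obtain c1 where dr: "d_total n ?r = (\<zero>\<^bsub>A (Suc n)\<^esub>, b, c1)" using ab by (auto simp: d_total_def)
    have drc: "d_total n ?r \<in> carrier (Tot (Suc n))" using mod_hom_closed[OF d_total_hom ab(1)] .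
    have c1: "c1 \<in> carrier (C (Suc n))" using drc dr by (simp add: Tot_def)
    have eq: "?q \<ominus>\<^bsub>Tot (Suc n)\<^esub> d_total n ?r = (\<zero>\<^bsub>A (Suc n)\<^esub>, \<zero>\<^bsub>B (Suc n)\<^esub>, c \<ominus>\<^bsub>C (Suc n)\<^esub> c1)"
      using minus[OF q drc[unfolded dr]] bc by (simp add: dr)
    have "dC (Suc n) (c \<ominus>\<^bsub>C (Suc n)\<^esub> c1) = \<zero>\<^bsub>C (Suc (Suc n))\<^esub>"
      using cocycle[OF bc(3) ab(1) q] bc c1 unfolding eq by (simp add: d_total_def Tot_def del: mod_hom_minus[OF C_mod C_mod dC])
    hence "?q \<ominus>\<^bsub>Tot (Suc n)\<^esub> d_total n ?r \<in> ?im"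
      unfolding eq using bc c1 by (intro C_case) auto
    from reduce[OF this ab(1) q] show ?thesis .
  qed
  obtain a b c where abc: "p = (a, b, c)" "a \<in> carrier (A (Suc n))" "b \<in> carrier (B (Suc n))"
    "c \<in> carrier (C (Suc n))" using p by (auto simp: Tot_def)
  have "dA (Suc n) a = \<zero>\<^bsub>A (Suc (Suc n))\<^esub>" using p abc by (simp add: Tot_def d_total_def)
  then obtain a' where a': "a' \<in> carrier (A n)" "dA n a' = a" using A_exact abc by blast
  let ?r = "(a', \<zero>\<^bsub>B n\<^esub>, \<zero>\<^bsub>C n\<^esub>)"
  have r: "?r \<in> carrier (Tot n)" using a' by (simp add: Tot_def)
  obtain b1 c1 where dr: "d_total n ?r = (a, b1, c1)" using a' by (auto simp: d_total_def)
  have drc: "d_total n ?r \<in> carrier (Tot (Suc n))" using mod_hom_closed[OF d_total_hom r] .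
  have bc1: "b1 \<in> carrier (B (Suc n))" "c1 \<in> carrier (C (Suc n))" using drc dr by (simp_all add: Tot_def)
  have eq: "p \<ominus>\<^bsub>Tot (Suc n)\<^esub> d_total n ?r = (\<zero>\<^bsub>A (Suc n)\<^esub>, b \<ominus>\<^bsub>B (Suc n)\<^esub> b1, c \<ominus>\<^bsub>C (Suc n)\<^esub> c1)"
    using minus[OF p(1)[unfolded abc(1)] drc[unfolded dr]] abc by (simp add: dr)
  have "p \<ominus>\<^bsub>Tot (Suc n)\<^esub> d_total n ?r \<in> ?im"
    using cocycle[OF p(2) r p(1)] bc1 abc unfolding eq by (intro B_case) auto
  from reduce[OF this r p(1)] show ?thesis by auto
qed

lemma total_zero0:
  assumes "p \<in> carrier (Tot 0)" "d_total 0 p = \<zero>\<^bsub>Tot 1\<^esub>"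
  shows "p = \<zero>\<^bsub>Tot 0\<^esub>"
proof -
  obtain a where p: "p = (a, \<zero>\<^bsub>B 0\<^esub>, \<zero>\<^bsub>C 0\<^esub>)" "a \<in> carrier (A 0)"
    using assms(1) B_zero0 C_zero0 by (auto simp: Tot_def)
  have "a = \<zero>\<^bsub>A 0\<^esub>" using assms(2) p by (intro A_exact0) (auto simp: Tot_def d_total_def)
  thus ?thesis using p by (simp add: Tot_def)
qed

sublocale T: injective_complex R Tot d_total
  using total_inj d_total_hom d_total_d_total total_exact by unfold_locales auto

text \<open>Exactness of the torsion of the cone, in components. All exactness statements about the
  connecting homomorphism come from inserting suitable triples here.\<close>

lemma torsion_total_exact:
  assumes "ideal \<aa> R" and "a \<in> torsion_elements R \<aa> (A (Suc n))" "b \<in> torsion_elements R \<aa> (B (Suc n))"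
    "c \<in> torsion_elements R \<aa> (C (Suc n))"
    and "dA (Suc n) a = \<zero>\<^bsub>A (Suc (Suc n))\<^esub>" "\<alpha> (Suc n) a = dB (Suc n) b"
    "(\<beta> (Suc n) b \<ominus>\<^bsub>C (Suc (Suc n))\<^esub> \<sigma> (Suc n) a) \<oplus>\<^bsub>C (Suc (Suc n))\<^esub> dC (Suc n) c = \<zero>\<^bsub>C (Suc (Suc n))\<^esub>"
  shows "\<exists>a'\<in>torsion_elements R \<aa> (A n). \<exists>b'\<in>torsion_elements R \<aa> (B n). \<exists>c'\<in>torsion_elements R \<aa> (C n).
     dA n a' = a \<and> \<alpha> n a' \<ominus>\<^bsub>B (Suc n)\<^esub> dB n b' = b \<and>
     (\<beta> n b' \<ominus>\<^bsub>C (Suc n)\<^esub> \<sigma> n a') \<oplus>\<^bsub>C (Suc n)\<^esub> dC n c' = c"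
proof -
  note c = torsion_elements_carrier[OF assms(2)] torsion_elements_carrier[OF assms(3)]
    torsion_elements_carrier[OF assms(4)]
  have tors: "torsion_elements R \<aa> (Tot m) =
     torsion_elements R \<aa> (A m) \<times> torsion_elements R \<aa> (B m) \<times> torsion_elements R \<aa> (C m)" for m
    unfolding Tot_def by (simp add: torsion_elements_prod_module A_mod B_mod C_mod module_prod_module assms(1))
  have "\<exists>q\<in>torsion_elements R \<aa> (Tot n). d_total n q = (a, b, c)"
    by (rule T.torsion_exact[OF assms(1)])
      (use assms c total_zero0 in \<open>auto simp: tors\<close>, simp add: d_total_def Tot_def)
  thus ?thesis by (auto simp: tors d_total_def)
qed

end

section \<open>Torsion cohomology\<close>

text \<open>These and the coboundaries belong to the torsion subcomplex but are kept as subsets of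
  \<open>I n\<close>, so that statements about cohomology become membership statements without
  cosets.\<close>

definition cocycles ::
  "('r, 'k) ring_scheme \<Rightarrow> 'r set \<Rightarrow> (nat \<Rightarrow> ('r, 'i, 'l) module_scheme) \<Rightarrow> (nat \<Rightarrow> 'i \<Rightarrow> 'i) \<Rightarrow> nat \<Rightarrow> 'i set" where
  "cocycles R \<aa> I d n = {a \<in> torsion_elements R \<aa> (I n). d n a = \<zero>\<^bsub>I (Suc n)\<^esub>}"

definition coboundaries ::
  "('r, 'k) ring_scheme \<Rightarrow> 'r set \<Rightarrow> (nat \<Rightarrow> ('r, 'i, 'l) module_scheme) \<Rightarrow> (nat \<Rightarrow> 'i \<Rightarrow> 'i) \<Rightarrow> nat \<Rightarrow> 'i set" where
  "coboundaries R \<aa> I d n =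
     (case n of 0 \<Rightarrow> {\<zero>\<^bsub>I 0\<^esub>} | Suc m \<Rightarrow> d m ` torsion_elements R \<aa> (I m))"

context injective_complex
begin

lemma torsion_d:
  "ideal \<aa> R \<Longrightarrow> a \<in> torsion_elements R \<aa> (I n) \<Longrightarrow> d n a \<in> torsion_elements R \<aa> (I (Suc n))"
  using mod_hom_torsion_elements[OF mod mod _ hom] .

lemma coboundaries_subset_cocycles:
  assumes "ideal \<aa> R"
  shows "coboundaries R \<aa> I d n \<subseteq> cocycles R \<aa> I d n"
  using torsion_d[OF assms] dd[OF torsion_elements_carrier] submodule_zero[OF submodule_torsion_elements[OF mod assms]]
  by (cases n) (auto simp: coboundaries_def cocycles_def zero)

lemma submodule_coboundaries:
  assumes "ideal \<aa> R"
  shows "submodule (coboundaries R \<aa> I d n) R (I n)"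
proof (cases n)
  case 0
  interpret I0: module R "I 0" by (rule mod)
  show ?thesis unfolding 0 by (rule submodule_if_closed[OF mod]) (auto simp: coboundaries_def)
next
  case (Suc m)
  show ?thesis
    using submodule_mod_hom_image[OF mod mod hom submodule_torsion_elements[OF mod assms], of m]
    by (simp add: coboundaries_def Suc)
qed

lemma submodule_cocycles:
  assumes "ideal \<aa> R"
  shows "submodule (cocycles R \<aa> I d n) R (I n)"
proof -
  interpret I: module R "I n" by (rule mod)
  interpret I': module R "I (Suc n)" by (rule mod)
  note T = submodule_torsion_elements[OF mod[of n] assms]
  show ?thesis
    by (rule submodule_if_closed[OF mod])
      (use submodule_subset[OF T] submodule_zero[OF T] submodule_add[OF T] submodule_smult[OF T] zero add smult in
        \<open>auto simp: cocycles_def dest!: torsion_elements_carrier\<close>)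
qed

end

section \<open>Chain maps on torsion cohomology\<close>

lemma chain_map_cocycles:
  assumes "injective_complex R I d" "injective_complex R J e" "ideal \<aa> R"
    and F: "\<And>n. F n \<in> mod_hom R (I n) (J n)"
    and Fd: "\<And>n a. a \<in> carrier (I n) \<Longrightarrow> F (Suc n) (d n a) = e n (F n a)"
  shows "z \<in> cocycles R \<aa> I d n \<Longrightarrow> F n z \<in> cocycles R \<aa> J e n"
    and "z \<in> coboundaries R \<aa> I d n \<Longrightarrow> F n z \<in> coboundaries R \<aa> J e n"
proof -
  interpret X: injective_complex R I d by fact
  interpret Y: injective_complex R J e by fact
  note FT = mod_hom_torsion_elements[OF X.mod Y.mod assms(3) F]
  note F0 = mod_hom_zero[OF X.mod Y.mod F]
  show "z \<in> cocycles R \<aa> I d n \<Longrightarrow> F n z \<in> cocycles R \<aa> J e n"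
    using FT F0[of "Suc n"] Fd[of z n] torsion_elements_carrier[of z R \<aa> "I n"] by (auto simp: cocycles_def)
  show "z \<in> coboundaries R \<aa> I d n \<Longrightarrow> F n z \<in> coboundaries R \<aa> J e n"
    using F0 Fd FT torsion_elements_carrier by (cases n) (fastforce simp: coboundaries_def)+
qed

text \<open>The homotopy identity makes the difference equal to \<open>e\<close> applied to a
  torsion element, or to zero in degree 0. It is stated for all torsion elements because it is also
  needed where \<open>d n a\<close> is not zero.\<close>

lemma null_homotopic_coboundary:
  assumes "injective_complex R I d" "injective_complex R J e" "ideal \<aa> R"
    and F: "\<And>n. F n \<in> mod_hom R (I n) (J n)"
    and s: "\<And>n. s n \<in> mod_hom R (I (Suc n)) (J n)"
    and s0: "\<And>a. a \<in> carrier (I 0) \<Longrightarrow> s 0 (d 0 a) = F 0 a"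
    and sS: "\<And>n a. a \<in> carrier (I (Suc n)) \<Longrightarrow>
      s (Suc n) (d (Suc n) a) \<oplus>\<^bsub>J (Suc n)\<^esub> e n (s n a) = F (Suc n) a"
    and a: "a \<in> torsion_elements R \<aa> (I n)"
  shows "F n a \<ominus>\<^bsub>J n\<^esub> s n (d n a) \<in> coboundaries R \<aa> J e n"
proof -
  interpret X: injective_complex R I d by fact
  interpret Y: injective_complex R J e by fact
  note ac = torsion_elements_carrier[OF a]
  interpret J: module R "J n" by (rule Y.mod)
  show ?thesis
  proof (cases n)
    case 0
    thus ?thesis using s0 ac mod_hom_closed[OF F, of a 0] J.M.minus_self by (simp add: coboundaries_def)
  next
    case (Suc m)
    interpret J': module R "J (Suc m)" by (rule Y.mod)
    have c: "s (Suc m) (d (Suc m) a) \<in> carrier (J (Suc m))" "e m (s m a) \<in> carrier (J (Suc m))"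
      using ac Suc X.closed Y.closed mod_hom_closed[OF s] by simp_all
    have "F n a \<ominus>\<^bsub>J n\<^esub> s n (d n a) = e m (s m a)"
      using c ac Suc by (simp add: J'.M.add_minus_cancel_left flip: sS)
    moreover have "s m a \<in> torsion_elements R \<aa> (J m)"
      using mod_hom_torsion_elements[OF X.mod Y.mod assms(3) s] a Suc by blast
    ultimately show ?thesis by (simp add: coboundaries_def Suc)
  qed
qed

text \<open>The difference of two lifts of the same map lifts zero and is null-homotopic; on a
  cocycle only the coboundary term of the homotopy identity remains.\<close>

lemma chain_maps_agree_cohomologous:
  assumes X: "injective_complex R I d" and Y: "injective_complex R J e" and \<aa>: "ideal \<aa> R"
    and F: "\<And>n. F n \<in> mod_hom R (I n) (J n)" and G: "\<And>n. G n \<in> mod_hom R (I n) (J n)"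
    and Fd: "\<And>n a. a \<in> carrier (I n) \<Longrightarrow> F (Suc n) (d n a) = e n (F n a)"
    and Gd: "\<And>n a. a \<in> carrier (I n) \<Longrightarrow> G (Suc n) (d n a) = e n (G n a)"
    and eq: "\<And>a. a \<in> carrier (I 0) \<Longrightarrow> d 0 a = \<zero>\<^bsub>I 1\<^esub> \<Longrightarrow> F 0 a = G 0 a"
    and z: "z \<in> cocycles R \<aa> I d n"
  shows "F n z \<ominus>\<^bsub>J n\<^esub> G n z \<in> coboundaries R \<aa> J e n"
proof -
  interpret X: injective_complex R I d by fact
  interpret Y: injective_complex R J e by fact
  define H where "H n a = F n a \<ominus>\<^bsub>J n\<^esub> G n a" for n a
  have H: "H n \<in> mod_hom R (I n) (J n)" for n
    unfolding H_def using mod_hom_diff[OF Y.mod F G] .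
  have Hd: "H (Suc n) (d n a) = e n (H n a)" if "a \<in> carrier (I n)" for n a
    using that by (simp add: H_def Fd Gd Y.minus mod_hom_closed[OF F] mod_hom_closed[OF G])
  have H0: "H 0 a = \<zero>\<^bsub>J 0\<^esub>" if "a \<in> carrier (I 0)" "d 0 a = \<zero>\<^bsub>I 1\<^esub>" for a
  proof -
    interpret J: module R "J 0" by (rule Y.mod)
    show ?thesis using eq[OF that] mod_hom_closed[OF G that(1)] by (simp add: H_def)
  qed
  obtain s where s: "\<And>n. s n \<in> mod_hom R (I (Suc n)) (J n)" "\<And>a. a \<in> carrier (I 0) \<Longrightarrow> s 0 (d 0 a) = H 0 a"
    "\<And>n a. a \<in> carrier (I (Suc n)) \<Longrightarrow> s (Suc n) (d (Suc n) a) \<oplus>\<^bsub>J (Suc n)\<^esub> e n (s n a) = H (Suc n) a"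
    using injective_complex_homotopy[OF X Y H Hd H0] by blast
  have zt: "z \<in> torsion_elements R \<aa> (I n)" "d n z = \<zero>\<^bsub>I (Suc n)\<^esub>" using z by (auto simp: cocycles_def)
  interpret J: module R "J n" by (rule Y.mod)
  have "H n z \<ominus>\<^bsub>J n\<^esub> s n (d n z) \<in> coboundaries R \<aa> J e n"
    by (rule null_homotopic_coboundary[where F = H and s = s]) (assumption | rule X Y \<aa> H s zt(1))+
  thus ?thesis
    using zt(2) mod_hom_zero[OF X.mod Y.mod s(1)] mod_hom_closed[OF H torsion_elements_carrier[OF zt(1)]]
    by (simp add: H_def)
qed

text \<open>Equal kernels of the augmentations mean that both complexes resolve the same quotient of
  \<open>M\<close>. Lifts of its identity in both directions are mutually inverse up to homotopy.
  The conclusion spells out that \<open>q\<close> is well defined, injective and surjective on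
  torsion cohomology.\<close>

lemma torsion_cohomology_comparison:
  assumes X: "injective_complex R I d" and Y: "injective_complex R J e" and \<aa>: "ideal \<aa> R"
    and M: "augmentation R M I d \<epsilon>" "augmentation R M J e \<eta>"
    and ker: "\<And>m. m \<in> carrier M \<Longrightarrow> \<epsilon> m = \<zero>\<^bsub>I 0\<^esub> \<longleftrightarrow> \<eta> m = \<zero>\<^bsub>J 0\<^esub>"
  shows "\<exists>q. (\<forall>n. q n \<in> mod_hom R (J n) (I n)) \<and>
     (\<forall>n. \<forall>z\<in>cocycles R \<aa> J e n. q n z \<in> cocycles R \<aa> I d n) \<and>
     (\<forall>n. \<forall>z\<in>coboundaries R \<aa> J e n. q n z \<in> coboundaries R \<aa> I d n) \<and>
     (\<forall>n. \<forall>z\<in>cocycles R \<aa> J e n. q n z \<in> coboundaries R \<aa> I d n \<longrightarrow> z \<in> coboundaries R \<aa> J e n) \<and>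
     (\<forall>n. \<forall>z\<in>cocycles R \<aa> I d n. \<exists>z'\<in>cocycles R \<aa> J e n. q n z' \<ominus>\<^bsub>I n\<^esub> z \<in> coboundaries R \<aa> I d n)"
proof -
  interpret X: injective_complex R I d by fact
  interpret Y: injective_complex R J e by fact
  have \<epsilon>: "\<epsilon> \<in> mod_hom R M (I 0)" "\<epsilon> ` carrier M = mod_ker (I 0) (I 1) (d 0)"
    and \<eta>: "\<eta> \<in> mod_hom R M (J 0)" "\<eta> ` carrier M = mod_ker (J 0) (J 1) (e 0)"
    using M by (auto simp: augmentation_def)
  have \<eta>0: "e 0 (\<eta> m) = \<zero>\<^bsub>J 1\<^esub>" if "m \<in> carrier M" for m
    using \<eta>(2) that by (auto simp: mod_ker_def)
  have \<epsilon>0: "d 0 (\<epsilon> m) = \<zero>\<^bsub>I 1\<^esub>" if "m \<in> carrier M" for m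
    using \<epsilon>(2) that by (auto simp: mod_ker_def)
  obtain p where p: "\<And>n. p n \<in> mod_hom R (I n) (J n)"
    "\<And>n a. a \<in> carrier (I n) \<Longrightarrow> p (Suc n) (d n a) = e n (p n a)" "\<And>m. m \<in> carrier M \<Longrightarrow> p 0 (\<epsilon> m) = \<eta> m"
    using injective_complex_lift[OF X Y M(1) \<eta>(1) \<eta>0] ker by blast
  obtain q where q: "\<And>n. q n \<in> mod_hom R (J n) (I n)"
    "\<And>n a. a \<in> carrier (J n) \<Longrightarrow> q (Suc n) (e n a) = d n (q n a)" "\<And>m. m \<in> carrier M \<Longrightarrow> q 0 (\<eta> m) = \<epsilon> m"
    using injective_complex_lift[OF Y X M(2) \<epsilon>(1) \<epsilon>0] ker by blast
  have pZ: "p n z \<in> cocycles R \<aa> J e n" if "z \<in> cocycles R \<aa> I d n" for n z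
    by (rule chain_map_cocycles(1)[OF X Y \<aa> p(1,2) that])
  have pB: "p n z \<in> coboundaries R \<aa> J e n" if "z \<in> coboundaries R \<aa> I d n" for n z
    by (rule chain_map_cocycles(2)[OF X Y \<aa> p(1,2) that])
  have qZ: "q n z \<in> cocycles R \<aa> I d n" if "z \<in> cocycles R \<aa> J e n" for n z
    by (rule chain_map_cocycles(1)[OF Y X \<aa> q(1,2) that])
  have qB: "q n z \<in> coboundaries R \<aa> I d n" if "z \<in> coboundaries R \<aa> J e n" for n z
    by (rule chain_map_cocycles(2)[OF Y X \<aa> q(1,2) that])
  have idI: "(\<lambda>a. a) \<in> mod_hom R (I n) (I n)" and idJ: "(\<lambda>a. a) \<in> mod_hom R (J n) (J n)" for n
    by (auto intro!: mod_homI)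
  have qp: "q n (p n z) \<ominus>\<^bsub>I n\<^esub> z \<in> coboundaries R \<aa> I d n" if z: "z \<in> cocycles R \<aa> I d n" for n z
  proof (rule chain_maps_agree_cohomologous[OF X X \<aa> mod_hom_compose[OF p(1) q(1)] idI _ _ _ z])
    fix a assume a: "a \<in> carrier (I 0)" "d 0 a = \<zero>\<^bsub>I 1\<^esub>"
    hence "a \<in> \<epsilon> ` carrier M" by (simp add: \<epsilon>(2) mod_ker_def)
    thus "q 0 (p 0 a) = a" using p(3) q(3) by auto
  qed (use p(1,2) q(2) mod_hom_closed in \<open>fastforce+\<close>)
  have pq: "p n (q n z) \<ominus>\<^bsub>J n\<^esub> z \<in> coboundaries R \<aa> J e n" if z: "z \<in> cocycles R \<aa> J e n" for n z
  proof (rule chain_maps_agree_cohomologous[OF Y Y \<aa> mod_hom_compose[OF q(1) p(1)] idJ _ _ _ z])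
    fix a assume a: "a \<in> carrier (J 0)" "e 0 a = \<zero>\<^bsub>J 1\<^esub>"
    hence "a \<in> \<eta> ` carrier M" by (simp add: \<eta>(2) mod_ker_def)
    thus "p 0 (q 0 a) = a" using p(3) q(3) by auto
  qed (use q(1,2) p(2) mod_hom_closed in \<open>fastforce+\<close>)
  have "z \<in> coboundaries R \<aa> J e n" if z: "z \<in> cocycles R \<aa> J e n" "q n z \<in> coboundaries R \<aa> I d n" for n z
  proof -
    interpret J: module R "J n" by (rule Y.mod)
    have zc: "z \<in> carrier (J n)" using z by (auto simp: cocycles_def torsion_elements_iff)
    have pc: "p n (q n z) \<in> carrier (J n)" using zc mod_hom_closed[OF p(1)] mod_hom_closed[OF q(1)] by blast
    \<comment> \<open>The first term is a coboundary since \<open>q n z\<close> is, the bracket is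
      one by \<open>pq\<close>, and their difference is \<open>z\<close>.\<close>
    have "p n (q n z) \<ominus>\<^bsub>J n\<^esub> (p n (q n z) \<ominus>\<^bsub>J n\<^esub> z) \<in> coboundaries R \<aa> J e n"
      using submodule_minus[OF Y.mod Y.submodule_coboundaries[OF \<aa>] pB[OF z(2)] pq[OF z(1)]] .
    thus ?thesis using zc pc by (simp add: a_minus_def J.M.minus_add J.M.r_neg2 J.M.minus_minus)
  qed
  thus ?thesis using q(1) qZ qB pZ qp by (intro exI[of _ q] conjI allI ballI impI) blast+
qed

section \<open>Multiplication by a regular element\<close>

text \<open>A shift by one degree, with a zero module in the vacated degree 0. One shift of
  \<open>I\<close> and two of \<open>J\<close> give the indexing of
  \<open>iterated_cone\<close>.\<close>

definition shift_modules :: "(nat \<Rightarrow> ('r, 'i) module) \<Rightarrow> nat \<Rightarrow> ('r, 'i) module" where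
  "shift_modules I n = (case n of 0 \<Rightarrow> (I 0)\<lparr>carrier := {\<zero>\<^bsub>I 0\<^esub>}\<rparr> | Suc m \<Rightarrow> I m)"

definition shift_maps :: "'j \<Rightarrow> (nat \<Rightarrow> 'i \<Rightarrow> 'j) \<Rightarrow> nat \<Rightarrow> 'i \<Rightarrow> 'j" where
  "shift_maps z f n = (case n of 0 \<Rightarrow> (\<lambda>_. z) | Suc m \<Rightarrow> f m)"

lemma shift_simps [simp]:
  "shift_modules I 0 = (I 0)\<lparr>carrier := {\<zero>\<^bsub>I 0\<^esub>}\<rparr>" "shift_modules I (Suc n) = I n"
  "shift_maps z f 0 = (\<lambda>_. z)" "shift_maps z f (Suc n) = f n"
  by (simp_all add: shift_modules_def shift_maps_def)

lemma baer_injective_zero_module: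
  assumes "module R M"
  shows "baer_injective R (M\<lparr>carrier := {\<zero>\<^bsub>M\<^esub>}\<rparr>)"
proof -
  interpret M: module R M by fact
  have "submodule {\<zero>\<^bsub>M\<^esub>} R M" by (rule submodule_if_closed[OF assms]) auto
  hence "module R (M\<lparr>carrier := {\<zero>\<^bsub>M\<^esub>}\<rparr>)" using module_restrict_carrier[OF assms] by blast
  moreover have "r \<in> carrier R" if "ideal J R" "r \<in> J" for J r
    using that by (meson additive_subgroup.a_subset ideal.axioms(1) subsetD)
  ultimately show ?thesis unfolding baer_injective_def by (auto simp: mod_hom_def Pi_iff)
qed

lemma baer_injective_shift_modules:
  "(\<And>n. baer_injective R (I n)) \<Longrightarrow> baer_injective R (shift_modules I n)"
  by (cases n) (auto intro: baer_injective_zero_module baer_injective_module)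

text \<open>With \<open>N\<close> the module resolved by \<open>I\<close>, the complex
  \<open>J\<close> resolves \<open>N/xN\<close>, \<open>\<psi>\<close> lifts the projection, and
  \<open>s\<close> is a homotopy from \<open>\<psi>\<close> after multiplication by \<open>x\<close>
  to zero. The last three assumptions are exactness of \<open>0 -> N -> N -> N/xN -> 0\<close>, read
  on the kernels in degree 0.\<close>

locale multiplication_sequence =
  X: injective_complex R I d + Y: injective_complex R J e
  for R :: "('r, 'k) ring_scheme" and I :: "nat \<Rightarrow> ('r, 'i) module" and d
    and J :: "nat \<Rightarrow> ('r, 'j) module" and e +
  fixes \<aa> x \<psi> s
  assumes \<aa>: "ideal \<aa> R" and x: "x \<in> carrier R"
    and \<psi>: "\<psi> n \<in> mod_hom R (I n) (J n)"
    and \<psi>d: "a \<in> carrier (I n) \<Longrightarrow> \<psi> (Suc n) (d n a) = e n (\<psi> n a)"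
    and s: "s n \<in> mod_hom R (I (Suc n)) (J n)"
    and s0: "a \<in> carrier (I 0) \<Longrightarrow> s 0 (d 0 a) = \<psi> 0 (x \<odot>\<^bsub>I 0\<^esub> a)"
    and sS: "a \<in> carrier (I (Suc n)) \<Longrightarrow>
      s (Suc n) (d (Suc n) a) \<oplus>\<^bsub>J (Suc n)\<^esub> e n (s n a) = \<psi> (Suc n) (x \<odot>\<^bsub>I (Suc n)\<^esub> a)"
    and x_inj: "a \<in> carrier (I 0) \<Longrightarrow> d 0 a = \<zero>\<^bsub>I 1\<^esub> \<Longrightarrow> x \<odot>\<^bsub>I 0\<^esub> a = \<zero>\<^bsub>I 0\<^esub> \<Longrightarrow> a = \<zero>\<^bsub>I 0\<^esub>"
    and \<psi>_ker: "a \<in> carrier (I 0) \<Longrightarrow> d 0 a = \<zero>\<^bsub>I 1\<^esub> \<Longrightarrow> \<psi> 0 a = \<zero>\<^bsub>J 0\<^esub> \<Longrightarrow>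
      \<exists>a'\<in>carrier (I 0). d 0 a' = \<zero>\<^bsub>I 1\<^esub> \<and> x \<odot>\<^bsub>I 0\<^esub> a' = a"
    and \<psi>_surj: "c \<in> carrier (J 0) \<Longrightarrow> e 0 c = \<zero>\<^bsub>J 1\<^esub> \<Longrightarrow>
      \<exists>a\<in>carrier (I 0). d 0 a = \<zero>\<^bsub>I 1\<^esub> \<and> \<psi> 0 a = c"
begin

sublocale I: module R "I n" for n by (rule X.mod)
sublocale J: module R "J n" for n by (rule Y.mod)

text \<open>The cone of \<open>I -> I -> J\<close>, where the first map is multiplication by
  \<open>x\<close>, the second is \<open>\<psi>\<close>, and \<open>s\<close> is the null-homotopy
  of the composite.\<close>

lemma iterated_cone:
  "iterated_cone R I (shift_modules I) (shift_modules (shift_modules J))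
    d (shift_maps \<zero>\<^bsub>I 0\<^esub> d) (shift_maps \<zero>\<^bsub>J 0\<^esub> (shift_maps \<zero>\<^bsub>J 0\<^esub> e))
    (\<lambda>n a. x \<odot>\<^bsub>I n\<^esub> a) (shift_maps \<zero>\<^bsub>J 0\<^esub> \<psi>) (shift_maps \<zero>\<^bsub>J 0\<^esub> s)"
proof
  note shiftJ = baer_injective_shift_modules[OF Y.inj]
  have z: "module R (shift_modules J n)" for n by (rule baer_injective_module[OF shiftJ])
  show "baer_injective R (I n)" for n by (rule X.inj)
  show "baer_injective R (shift_modules I n)" for n by (rule baer_injective_shift_modules[OF X.inj])
  show "baer_injective R (shift_modules (shift_modules J) n)" for n
    by (rule baer_injective_shift_modules[OF shiftJ])
  show "d n \<in> mod_hom R (I n) (I (Suc n))" for n by (rule X.hom)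
  show "shift_maps \<zero>\<^bsub>I 0\<^esub> d n \<in> mod_hom R (shift_modules I n) (shift_modules I (Suc n))" for n
    using X.hom mod_hom_const_zero[OF X.mod] by (cases n) auto
  have e1: "shift_maps \<zero>\<^bsub>J 0\<^esub> e n \<in> mod_hom R (shift_modules J n) (shift_modules J (Suc n))" for n
    using Y.hom mod_hom_const_zero[OF Y.mod] by (cases n) auto
  show "shift_maps \<zero>\<^bsub>J 0\<^esub> (shift_maps \<zero>\<^bsub>J 0\<^esub> e) n
      \<in> mod_hom R (shift_modules (shift_modules J) n) (shift_modules (shift_modules J) (Suc n))" for n
    using e1 mod_hom_const_zero[OF z[of 0]] by (cases n) auto
  show "(\<lambda>a. x \<odot>\<^bsub>I n\<^esub> a) \<in> mod_hom R (I n) (shift_modules I (Suc n))" for n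
    using mod_hom_smult_const[OF X.mod x] by simp
  show "shift_maps \<zero>\<^bsub>J 0\<^esub> \<psi> n \<in> mod_hom R (shift_modules I n) (shift_modules (shift_modules J) (Suc n))" for n
    using \<psi> mod_hom_const_zero[OF z[of 0]] by (cases n) auto
  show "shift_maps \<zero>\<^bsub>J 0\<^esub> s n \<in> mod_hom R (I n) (shift_modules (shift_modules J) (Suc n))" for n
    using s mod_hom_const_zero[OF z[of 0]] by (cases n) auto
  show "d (Suc n) (d n a) = \<zero>\<^bsub>I (Suc (Suc n))\<^esub>" if "a \<in> carrier (I n)" for a n using X.dd that .
  show "shift_maps \<zero>\<^bsub>I 0\<^esub> d (Suc n) (shift_maps \<zero>\<^bsub>I 0\<^esub> d n b) = \<zero>\<^bsub>shift_modules I (Suc (Suc n))\<^esub>"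
    if "b \<in> carrier (shift_modules I n)" for b n
    using that X.dd X.zero by (cases n) auto
  show "shift_maps \<zero>\<^bsub>J 0\<^esub> (shift_maps \<zero>\<^bsub>J 0\<^esub> e) (Suc n) (shift_maps \<zero>\<^bsub>J 0\<^esub> (shift_maps \<zero>\<^bsub>J 0\<^esub> e) n c) =
      \<zero>\<^bsub>shift_modules (shift_modules J) (Suc (Suc n))\<^esub>"
    if "c \<in> carrier (shift_modules (shift_modules J) n)" for c n
  proof (cases n)
    case (Suc m)
    thus ?thesis using that Y.dd Y.zero by (cases m) auto
  qed simp
  show "x \<odot>\<^bsub>I (Suc n)\<^esub> d n a = shift_maps \<zero>\<^bsub>I 0\<^esub> d (Suc n) (x \<odot>\<^bsub>I n\<^esub> a)" if "a \<in> carrier (I n)" for a n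
    using that X.smult x by simp
  show "shift_maps \<zero>\<^bsub>J 0\<^esub> \<psi> (Suc n) (shift_maps \<zero>\<^bsub>I 0\<^esub> d n b) =
      shift_maps \<zero>\<^bsub>J 0\<^esub> (shift_maps \<zero>\<^bsub>J 0\<^esub> e) (Suc n) (shift_maps \<zero>\<^bsub>J 0\<^esub> \<psi> n b)"
    if "b \<in> carrier (shift_modules I n)" for b n
    using that \<psi>d mod_hom_zero[OF X.mod Y.mod \<psi>] by (cases n) auto
  show "shift_maps \<zero>\<^bsub>J 0\<^esub> s (Suc n) (d n a) \<oplus>\<^bsub>shift_modules (shift_modules J) (Suc (Suc n))\<^esub>
      shift_maps \<zero>\<^bsub>J 0\<^esub> (shift_maps \<zero>\<^bsub>J 0\<^esub> e) (Suc n) (shift_maps \<zero>\<^bsub>J 0\<^esub> s n a) =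
      shift_maps \<zero>\<^bsub>J 0\<^esub> \<psi> (Suc n) (x \<odot>\<^bsub>I n\<^esub> a)" if "a \<in> carrier (I n)" for a n
    using that s0 sS x mod_hom_closed[OF \<psi>] by (cases n) auto
  show "a = \<zero>\<^bsub>I 0\<^esub>" if "a \<in> carrier (I 0)" "d 0 a = \<zero>\<^bsub>I 1\<^esub>" "x \<odot>\<^bsub>I 0\<^esub> a = \<zero>\<^bsub>shift_modules I 1\<^esub>" for a
    using x_inj that by simp
  show "\<exists>a'\<in>carrier (I n). d n a' = a" if "a \<in> carrier (I (Suc n))" "d (Suc n) a = \<zero>\<^bsub>I (Suc (Suc n))\<^esub>" for a n
    using X.exact that .
  show "carrier (shift_modules I 0) = {\<zero>\<^bsub>shift_modules I 0\<^esub>}" by simp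
  show "\<exists>a\<in>carrier (I 0). d 0 a = \<zero>\<^bsub>I 1\<^esub> \<and> x \<odot>\<^bsub>I 0\<^esub> a = b"
    if "b \<in> carrier (shift_modules I 1)" "shift_maps \<zero>\<^bsub>I 0\<^esub> d 1 b = \<zero>\<^bsub>shift_modules I 2\<^esub>"
      "shift_maps \<zero>\<^bsub>J 0\<^esub> \<psi> 1 b = \<zero>\<^bsub>shift_modules (shift_modules J) 2\<^esub>" for b
    using that \<psi>_ker[of b] by (simp add: numeral_2_eq_2)
  show "\<exists>b'\<in>carrier (shift_modules I (Suc n)). shift_maps \<zero>\<^bsub>I 0\<^esub> d (Suc n) b' = b"
    if "b \<in> carrier (shift_modules I (Suc (Suc n)))"
      "shift_maps \<zero>\<^bsub>I 0\<^esub> d (Suc (Suc n)) b = \<zero>\<^bsub>shift_modules I (Suc (Suc (Suc n)))\<^esub>" for b n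
    using that X.exact by simp
  show "carrier (shift_modules (shift_modules J) 0) = {\<zero>\<^bsub>shift_modules (shift_modules J) 0\<^esub>}" by simp
  show "carrier (shift_modules (shift_modules J) 1) = {\<zero>\<^bsub>shift_modules (shift_modules J) 1\<^esub>}" by simp
  show "\<exists>b\<in>carrier (shift_modules I 1). shift_maps \<zero>\<^bsub>I 0\<^esub> d 1 b = \<zero>\<^bsub>shift_modules I 2\<^esub> \<and>
      shift_maps \<zero>\<^bsub>J 0\<^esub> \<psi> 1 b = c"
    if "c \<in> carrier (shift_modules (shift_modules J) 2)"
      "shift_maps \<zero>\<^bsub>J 0\<^esub> (shift_maps \<zero>\<^bsub>J 0\<^esub> e) 2 c = \<zero>\<^bsub>shift_modules (shift_modules J) 3\<^esub>" for c
    using that \<psi>_surj[of c] by (simp add: numeral_2_eq_2 numeral_3_eq_3)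
  show "\<exists>c'\<in>carrier (shift_modules (shift_modules J) (Suc (Suc n))).
      shift_maps \<zero>\<^bsub>J 0\<^esub> (shift_maps \<zero>\<^bsub>J 0\<^esub> e) (Suc (Suc n)) c' = c"
    if "c \<in> carrier (shift_modules (shift_modules J) (Suc (Suc (Suc n))))"
      "shift_maps \<zero>\<^bsub>J 0\<^esub> (shift_maps \<zero>\<^bsub>J 0\<^esub> e) (Suc (Suc (Suc n))) c =
       \<zero>\<^bsub>shift_modules (shift_modules J) (Suc (Suc (Suc (Suc n))))\<^esub>" for c n
    using that Y.exact by simp
qed

section \<open>The connecting homomorphism as a relation between cocycles\<close>

abbreviation "ZI \<equiv> cocycles R \<aa> I d"
abbreviation "BI \<equiv> coboundaries R \<aa> I d"
abbreviation "ZJ \<equiv> cocycles R \<aa> J e"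
abbreviation "BJ \<equiv> coboundaries R \<aa> J e"
abbreviation "TI n \<equiv> torsion_elements R \<aa> (I n)"
abbreviation "TJ n \<equiv> torsion_elements R \<aa> (J n)"

lemmas BI = X.submodule_coboundaries[OF \<aa>] and BJ = Y.submodule_coboundaries[OF \<aa>]
  and ZI = X.submodule_cocycles[OF \<aa>] and ZJ = Y.submodule_cocycles[OF \<aa>]
  and TI = submodule_torsion_elements[OF X.mod \<aa>] and TJ = submodule_torsion_elements[OF Y.mod \<aa>]
  and \<psi>T = mod_hom_torsion_elements[OF X.mod Y.mod \<aa> \<psi>]
  and sT = mod_hom_torsion_elements[OF X.mod Y.mod \<aa> s]

lemma \<psi>BJ: "z \<in> BI n \<Longrightarrow> \<psi> n z \<in> BJ n"
  by (rule chain_map_cocycles(2)[where F = \<psi>])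
    (assumption | rule X.injective_complex_axioms Y.injective_complex_axioms \<aa> \<psi> \<psi>d)+

lemma xT: "a \<in> TI n \<Longrightarrow> x \<odot>\<^bsub>I n\<^esub> a \<in> TI n"
  using submodule_smult[OF TI x] .

lemma homotopy_coboundary:
  "a \<in> TI n \<Longrightarrow> \<psi> n (x \<odot>\<^bsub>I n\<^esub> a) \<ominus>\<^bsub>J n\<^esub> s n (d n a) \<in> BJ n"
  by (rule null_homotopic_coboundary[where F = "\<lambda>n a. \<psi> n (x \<odot>\<^bsub>I n\<^esub> a)" and s = s])
    (assumption | rule X.injective_complex_axioms Y.injective_complex_axioms \<aa>
        mod_hom_compose[OF mod_hom_smult_const[OF X.mod x] \<psi>] s s0 sS)+

text \<open>Since \<open>\<psi>\<close> need not be surjective on cochains, the connecting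
  homomorphism is read backwards: if \<open>x a = d b\<close>, then \<open>\<psi> b - s a\<close>
  represents a class of \<open>J\<close> that corresponds to the class of \<open>a\<close>. The term
  \<open>s a\<close> is the correction that makes it a cocycle:
  \<open>e (\<psi> b) = \<psi> (x a) = e (s a)\<close>, because \<open>d a = 0\<close>.\<close>

lemma connecting_cocycle:
  assumes a: "a \<in> ZI (Suc n)" and b: "b \<in> TI n" and ab: "x \<odot>\<^bsub>I (Suc n)\<^esub> a = d n b"
  shows "\<psi> n b \<ominus>\<^bsub>J n\<^esub> s n a \<in> ZJ n"
proof -
  have at: "a \<in> TI (Suc n)" "d (Suc n) a = \<zero>\<^bsub>I (Suc (Suc n))\<^esub>" using a by (auto simp: cocycles_def)
  note ac = torsion_elements_carrier[OF at(1)] and bc = torsion_elements_carrier[OF b]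
  have c: "s n a \<in> carrier (J n)" "\<psi> n b \<in> carrier (J n)"
    using mod_hom_closed[OF s ac] mod_hom_closed[OF \<psi> bc] .
  have "e n (\<psi> n b) = e n (s n a)"
    using sS[OF ac] at(2) ab \<psi>d[OF bc] c mod_hom_zero[OF X.mod Y.mod s] Y.closed by simp
  hence "e n (\<psi> n b \<ominus>\<^bsub>J n\<^esub> s n a) = \<zero>\<^bsub>J (Suc n)\<^esub>" using c Y.closed by (simp add: Y.minus)
  thus ?thesis using submodule_minus[OF Y.mod TJ \<psi>T[OF b] sT[OF at(1)]] by (simp add: cocycles_def)
qed

text \<open>A cochain with coboundary \<open>\<psi> b - s a\<close>, negated, completes
  \<open>a\<close> and \<open>b\<close> to a cocycle of the cone. Exactness of the torsion cone
  returns a primitive, whose first component exhibits \<open>a\<close> as a coboundary.\<close>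

lemma connecting_injective:
  assumes a: "a \<in> ZI (Suc n)" and b: "b \<in> TI n" and ab: "x \<odot>\<^bsub>I (Suc n)\<^esub> a = d n b"
    and bd: "\<psi> n b \<ominus>\<^bsub>J n\<^esub> s n a \<in> BJ n"
  shows "a \<in> BI (Suc n)"
proof -
  have at: "a \<in> TI (Suc n)" "d (Suc n) a = \<zero>\<^bsub>I (Suc (Suc n))\<^esub>" using a by (auto simp: cocycles_def)
  note ac = torsion_elements_carrier[OF at(1)] and bc = torsion_elements_carrier[OF b]
  have pc: "\<psi> n b \<ominus>\<^bsub>J n\<^esub> s n a \<in> carrier (J n)"
    using mod_hom_closed[OF s ac] mod_hom_closed[OF \<psi> bc] by simp
  have "\<exists>c\<in>torsion_elements R \<aa> (shift_modules J n).
      (\<psi> n b \<ominus>\<^bsub>J n\<^esub> s n a) \<oplus>\<^bsub>J n\<^esub> shift_maps \<zero>\<^bsub>J 0\<^esub> e n c = \<zero>\<^bsub>J n\<^esub>"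
  proof (cases n)
    case 0
    have "\<zero>\<^bsub>shift_modules J 0\<^esub> \<in> torsion_elements R \<aa> (shift_modules J 0)"
      using submodule_zero[OF submodule_torsion_elements[OF
            baer_injective_module[OF baer_injective_shift_modules[OF Y.inj]] \<aa>]] .
    thus ?thesis using bd 0 by (auto simp: coboundaries_def)
  next
    case (Suc m)
    then obtain c where c: "c \<in> TJ m" "\<psi> n b \<ominus>\<^bsub>J n\<^esub> s n a = e m c" using bd by (auto simp: coboundaries_def)
    have cc: "c \<in> carrier (J m)" using torsion_elements_carrier[OF c(1)] .
    have "\<ominus>\<^bsub>J m\<^esub> c \<in> TJ m" using J.submoduleE(3)[OF TJ] c by blast
    moreover have "(\<psi> n b \<ominus>\<^bsub>J n\<^esub> s n a) \<oplus>\<^bsub>J n\<^esub> e m (\<ominus>\<^bsub>J m\<^esub> c) = \<zero>\<^bsub>J n\<^esub>"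
      using c(2) Suc cc Y.closed[OF cc] by (simp add: mod_hom_a_inv[OF Y.mod Y.mod Y.hom] J.M.r_neg)
    ultimately show ?thesis using Suc by auto
  qed
  then obtain c where c: "c \<in> torsion_elements R \<aa> (shift_modules J n)"
    "(\<psi> n b \<ominus>\<^bsub>J n\<^esub> s n a) \<oplus>\<^bsub>J n\<^esub> shift_maps \<zero>\<^bsub>J 0\<^esub> e n c = \<zero>\<^bsub>J n\<^esub>" by blast
  show ?thesis
    using iterated_cone.torsion_total_exact[OF iterated_cone \<aa> at(1), of b c] b c at(2) ab
    by (auto simp: coboundaries_def)
qed

text \<open>The triple \<open>(0, 0, c)\<close> is a cocycle of the cone in degree
  \<open>n + 2\<close>, where the third entry lies in \<open>J n\<close>. The components of a
  primitive are \<open>a\<close>, \<open>b\<close> and a cochain accounting for the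
  difference.\<close>

lemma connecting_surjective:
  assumes c: "c \<in> ZJ n"
  shows "\<exists>a\<in>ZI (Suc n). \<exists>b\<in>TI n. x \<odot>\<^bsub>I (Suc n)\<^esub> a = d n b \<and> c \<ominus>\<^bsub>J n\<^esub> (\<psi> n b \<ominus>\<^bsub>J n\<^esub> s n a) \<in> BJ n"
proof -
  have ct: "c \<in> TJ n" "e n c = \<zero>\<^bsub>J (Suc n)\<^esub>" using c by (auto simp: cocycles_def)
  obtain a b c' where abc: "a \<in> TI (Suc n)" "b \<in> TI n" "c' \<in> torsion_elements R \<aa> (shift_modules J n)"
    "d (Suc n) a = \<zero>\<^bsub>I (Suc (Suc n))\<^esub>" "x \<odot>\<^bsub>I (Suc n)\<^esub> a \<ominus>\<^bsub>I (Suc n)\<^esub> d n b = \<zero>\<^bsub>I (Suc n)\<^esub>"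
    "(\<psi> n b \<ominus>\<^bsub>J n\<^esub> s n a) \<oplus>\<^bsub>J n\<^esub> shift_maps \<zero>\<^bsub>J 0\<^esub> e n c' = c"
    using iterated_cone.torsion_total_exact[OF iterated_cone \<aa> submodule_zero[OF TI], of "\<zero>\<^bsub>I (Suc n)\<^esub>" "Suc n" c]
      submodule_zero[OF TI] ct X.zero x mod_hom_zero[OF X.mod Y.mod \<psi>] mod_hom_zero[OF X.mod Y.mod s]
    by auto
  note ac = torsion_elements_carrier[OF abc(1)] and bc = torsion_elements_carrier[OF abc(2)]
  have pc: "\<psi> n b \<ominus>\<^bsub>J n\<^esub> s n a \<in> carrier (J n)"
    using mod_hom_closed[OF s ac] mod_hom_closed[OF \<psi> bc] by simp
  have ec: "shift_maps \<zero>\<^bsub>J 0\<^esub> e n c' \<in> BJ n"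
    using abc(3) by (cases n) (auto simp: coboundaries_def)
  hence ecc: "shift_maps \<zero>\<^bsub>J 0\<^esub> e n c' \<in> carrier (J n)" using submodule_subset[OF BJ] by blast
  have "c \<ominus>\<^bsub>J n\<^esub> (\<psi> n b \<ominus>\<^bsub>J n\<^esub> s n a) = shift_maps \<zero>\<^bsub>J 0\<^esub> e n c'"
    using pc ecc J.M.add_minus_cancel_left[of _ n] abc(6) by metis
  moreover have "x \<odot>\<^bsub>I (Suc n)\<^esub> a = d n b" using abc(5) X.closed[OF bc] ac x by simp
  ultimately show ?thesis using abc ec by (intro bexI[of _ a] bexI[of _ b]) (auto simp: cocycles_def)
qed

text \<open>If \<open>a = d a'\<close>, then \<open>b - x a'\<close> is a cocycle, and by
  \<open>surj\<close> it is \<open>x z\<close> up to a coboundary. The homotopy turns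
  \<open>\<psi> (x z)\<close> and \<open>\<psi> (x a') - s a\<close> into coboundaries. The
  assumption \<open>surj\<close> controls the freedom in \<open>b\<close>, which is determined by
  \<open>a\<close> only up to a cocycle.\<close>

lemma connecting_zero:
  assumes "a \<in> BI (Suc n)" and b: "b \<in> TI n" and ab: "x \<odot>\<^bsub>I (Suc n)\<^esub> a = d n b"
    and surj: "\<And>z. z \<in> ZI n \<Longrightarrow> \<exists>z'\<in>ZI n. z \<ominus>\<^bsub>I n\<^esub> x \<odot>\<^bsub>I n\<^esub> z' \<in> BI n"
  shows "\<psi> n b \<ominus>\<^bsub>J n\<^esub> s n a \<in> BJ n"
proof -
  obtain a' where a': "a' \<in> TI n" "a = d n a'" using assms(1) by (auto simp: coboundaries_def)
  note ac = torsion_elements_carrier[OF a'(1)] and bc = torsion_elements_carrier[OF b]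
  have "d n (b \<ominus>\<^bsub>I n\<^esub> x \<odot>\<^bsub>I n\<^esub> a') = \<zero>\<^bsub>I (Suc n)\<^esub>"
    using ac bc x ab a'(2) X.closed by (simp add: X.minus X.smult)
  moreover have "b \<ominus>\<^bsub>I n\<^esub> x \<odot>\<^bsub>I n\<^esub> a' \<in> TI n"
    using submodule_minus[OF X.mod TI b xT[OF a'(1)]] .
  ultimately have "b \<ominus>\<^bsub>I n\<^esub> x \<odot>\<^bsub>I n\<^esub> a' \<in> ZI n" by (simp add: cocycles_def)
  then obtain z where z: "z \<in> ZI n" "b \<ominus>\<^bsub>I n\<^esub> x \<odot>\<^bsub>I n\<^esub> a' \<ominus>\<^bsub>I n\<^esub> x \<odot>\<^bsub>I n\<^esub> z \<in> BI n" using surj by blast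
  have zt: "z \<in> TI n" "d n z = \<zero>\<^bsub>I (Suc n)\<^esub>" using z by (auto simp: cocycles_def)
  note zc = torsion_elements_carrier[OF zt(1)]
  have 1: "\<psi> n (b \<ominus>\<^bsub>I n\<^esub> x \<odot>\<^bsub>I n\<^esub> a' \<ominus>\<^bsub>I n\<^esub> x \<odot>\<^bsub>I n\<^esub> z) \<in> BJ n" using \<psi>BJ[OF z(2)] .
  have 2: "\<psi> n (x \<odot>\<^bsub>I n\<^esub> a') \<ominus>\<^bsub>J n\<^esub> s n a \<in> BJ n" using homotopy_coboundary[OF a'(1)] a'(2) by simp
  have 3: "\<psi> n (x \<odot>\<^bsub>I n\<^esub> z) \<in> BJ n"
    using homotopy_coboundary[OF zt(1)] zt(2) x zc mod_hom_zero[OF X.mod Y.mod s] mod_hom_closed[OF \<psi>] by simp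
  define p q r t where "p = \<psi> n b" and "q = \<psi> n (x \<odot>\<^bsub>I n\<^esub> a')" and "r = \<psi> n (x \<odot>\<^bsub>I n\<^esub> z)" and "t = s n a"
  have pqr: "p \<in> carrier (J n)" "q \<in> carrier (J n)" "r \<in> carrier (J n)" "t \<in> carrier (J n)"
    using bc ac zc x a'(2) X.closed mod_hom_closed[OF \<psi>] mod_hom_closed[OF s]
    by (simp_all add: p_def q_def r_def t_def)
  have "\<psi> n (b \<ominus>\<^bsub>I n\<^esub> x \<odot>\<^bsub>I n\<^esub> a' \<ominus>\<^bsub>I n\<^esub> x \<odot>\<^bsub>I n\<^esub> z) = p \<ominus>\<^bsub>J n\<^esub> q \<ominus>\<^bsub>J n\<^esub> r"
    using bc ac zc x by (simp add: p_def q_def r_def mod_hom_minus[OF X.mod Y.mod \<psi>])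
  hence "(p \<ominus>\<^bsub>J n\<^esub> q \<ominus>\<^bsub>J n\<^esub> r) \<oplus>\<^bsub>J n\<^esub> r \<oplus>\<^bsub>J n\<^esub> (q \<ominus>\<^bsub>J n\<^esub> t) \<in> BJ n"
    using submodule_add[OF BJ submodule_add[OF BJ 1 3] 2] by (simp add: q_def r_def t_def)
  moreover have "(p \<ominus>\<^bsub>J n\<^esub> q \<ominus>\<^bsub>J n\<^esub> r) \<oplus>\<^bsub>J n\<^esub> r \<oplus>\<^bsub>J n\<^esub> (q \<ominus>\<^bsub>J n\<^esub> t) = p \<ominus>\<^bsub>J n\<^esub> t"
    using pqr J.M.minus_add_minus_cancel by simp
  ultimately show ?thesis by (simp add: p_def t_def)
qed

text \<open>The vanishing consequences of the long exact sequence
  \<open>H\<^sup>n(I) \<rightarrow> H\<^sup>n(I) \<rightarrow> H\<^sup>n(J) \<rightarrow> H\<^sup>n\<^sup>+\<^sup>1(I) \<rightarrow> H\<^sup>n\<^sup>+\<^sup>1(I)\<close>.\<close>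

lemma quotient_cohomology_zero:
  assumes surj: "\<And>z. z \<in> ZI n \<Longrightarrow> \<exists>z'\<in>ZI n. z \<ominus>\<^bsub>I n\<^esub> x \<odot>\<^bsub>I n\<^esub> z' \<in> BI n"
    and inj: "\<And>z. z \<in> ZI (Suc n) \<Longrightarrow> x \<odot>\<^bsub>I (Suc n)\<^esub> z \<in> BI (Suc n) \<Longrightarrow> z \<in> BI (Suc n)"
  shows "ZJ n \<subseteq> BJ n"
proof
  fix c assume c: "c \<in> ZJ n"
  obtain a b where ab: "a \<in> ZI (Suc n)" "b \<in> TI n" "x \<odot>\<^bsub>I (Suc n)\<^esub> a = d n b"
    "c \<ominus>\<^bsub>J n\<^esub> (\<psi> n b \<ominus>\<^bsub>J n\<^esub> s n a) \<in> BJ n" using connecting_surjective[OF c] by blast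
  have "a \<in> BI (Suc n)" by (rule inj[OF ab(1)]) (use ab in \<open>simp add: coboundaries_def\<close>)
  hence "\<psi> n b \<ominus>\<^bsub>J n\<^esub> s n a \<in> BJ n" using ab(2,3) surj by (rule connecting_zero)
  moreover from this have "\<psi> n b \<ominus>\<^bsub>J n\<^esub> s n a \<in> carrier (J n)" using submodule_subset[OF BJ] by blast
  moreover have "c \<in> carrier (J n)" using c submodule_subset[OF ZJ] by blast
  ultimately show "c \<in> BJ n" using submodule_add[OF BJ ab(4)] by (metis J.M.minus_add_cancel_right)
qed

lemma multiplication_injective:
  assumes "ZJ n \<subseteq> BJ n" "a \<in> ZI (Suc n)" "x \<odot>\<^bsub>I (Suc n)\<^esub> a \<in> BI (Suc n)"
  shows "a \<in> BI (Suc n)"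
proof -
  obtain b where b: "b \<in> TI n" "x \<odot>\<^bsub>I (Suc n)\<^esub> a = d n b" using assms(3) by (auto simp: coboundaries_def)
  show ?thesis using connecting_injective[OF assms(2) b] connecting_cocycle[OF assms(2) b] assms(1) by blast
qed

end

text \<open>\<open>\<rho>\<close> is the graph of an isomorphism from the cohomology of the torsion of \<open>J\<close> in degree \<open>k\<close>
  to the submodule \<open>K\<close> of \<open>H\<close>, read as a relation between cocycles and elements of \<open>K\<close>.\<close>

definition cohomology_graph ::
  "('r, 'k) ring_scheme \<Rightarrow> 'r set \<Rightarrow> (nat \<Rightarrow> ('r, 'i) module) \<Rightarrow> (nat \<Rightarrow> 'i \<Rightarrow> 'i) \<Rightarrow> nat \<Rightarrow>
     ('r, 'h) module \<Rightarrow> 'h set \<Rightarrow> ('i \<times> 'h) set \<Rightarrow> bool" where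
  "cohomology_graph R \<aa> J e k H K \<rho> \<longleftrightarrow>
     submodule \<rho> R (prod_module (J k) H) \<and> \<rho> \<subseteq> cocycles R \<aa> J e k \<times> K \<and>
     (\<forall>z\<in>cocycles R \<aa> J e k. \<exists>h. (z, h) \<in> \<rho>) \<and> (\<forall>h\<in>K. \<exists>z. (z, h) \<in> \<rho>) \<and>
     (\<forall>z h. (z, h) \<in> \<rho> \<longrightarrow> (z \<in> coboundaries R \<aa> J e k \<longleftrightarrow> h = \<zero>\<^bsub>H\<^esub>))"

text \<open>When the cohomology of \<open>I\<close> vanishes in degree \<open>k\<close>, the
  connecting homomorphism identifies that of \<open>J\<close> in degree \<open>k\<close> with the
  kernel of \<open>x\<close> in degree \<open>k + 1\<close> of \<open>I\<close>. The new graph is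
  the composite of this relation with \<open>\<rho>\<close>.\<close>

lemma (in multiplication_sequence) cohomology_graph_step:
  assumes H: "module R H" and \<rho>: "cohomology_graph R \<aa> I d (Suc k) H K \<rho>" and van: "ZI k \<subseteq> BI k"
    and KH: "K \<subseteq> carrier H"
  shows "\<exists>\<rho>'. cohomology_graph R \<aa> J e k H {h \<in> K. x \<odot>\<^bsub>H\<^esub> h = \<zero>\<^bsub>H\<^esub>} \<rho>'"
proof -
  interpret H: module R H by fact
  have sub: "submodule \<rho> R (prod_module (I (Suc k)) H)" using \<rho> by (simp add: cohomology_graph_def)
  have \<rho>sub: "a \<in> ZI (Suc k)" "h \<in> K" if "(a, h) \<in> \<rho>" for a h
    using \<rho> that by (auto simp: cohomology_graph_def)
  have tot: "\<exists>h. (a, h) \<in> \<rho>" if "a \<in> ZI (Suc k)" for a using \<rho> that by (auto simp: cohomology_graph_def)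
  have sur: "\<exists>a. (a, h) \<in> \<rho>" if "h \<in> K" for h using \<rho> that by (auto simp: cohomology_graph_def)
  have iff: "a \<in> BI (Suc k) \<longleftrightarrow> h = \<zero>\<^bsub>H\<^esub>" if "(a, h) \<in> \<rho>" for a h
    using \<rho> that by (auto simp: cohomology_graph_def)
  have add: "(a \<oplus>\<^bsub>I (Suc k)\<^esub> a', h \<oplus>\<^bsub>H\<^esub> h') \<in> \<rho>" if "(a, h) \<in> \<rho>" "(a', h') \<in> \<rho>" for a h a' h'
    using submodule_add[OF sub that] by simp
  have sm: "(r \<odot>\<^bsub>I (Suc k)\<^esub> a, r \<odot>\<^bsub>H\<^esub> h) \<in> \<rho>" if "(a, h) \<in> \<rho>" "r \<in> carrier R" for a h r
    using submodule_smult[OF sub that(2,1)] by simp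
  have zer: "(\<zero>\<^bsub>I (Suc k)\<^esub>, \<zero>\<^bsub>H\<^esub>) \<in> \<rho>" using submodule_zero[OF sub] by simp
  have ZIc: "a \<in> carrier (I n)" if "a \<in> ZI n" for a n using that submodule_subset[OF ZI] by blast
  have ZJc: "a \<in> carrier (J n)" if "a \<in> ZJ n" for a n using that submodule_subset[OF ZJ] by blast
  have TIc: "a \<in> carrier (I n)" if "a \<in> TI n" for a n by (rule torsion_elements_carrier[OF that])
  \<comment> \<open>The defect of \<open>c\<close> from the representative attached to
    \<open>a\<close> and \<open>b\<close>; it is additive in all three arguments, so the composite
    relation is a submodule.\<close>
  define L where "L c a b = c \<ominus>\<^bsub>J k\<^esub> (\<psi> k b \<ominus>\<^bsub>J k\<^esub> s k a)" for c a b
  define \<rho>' where "\<rho>' = {(c, h). c \<in> ZJ k \<and> (\<exists>a b. (a, h) \<in> \<rho> \<and> b \<in> TI k \<and>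
     x \<odot>\<^bsub>I (Suc k)\<^esub> a = d k b \<and> L c a b \<in> BJ k)}"
  have \<rho>'D: "c \<in> ZJ k \<and> (\<exists>a b. (a, h) \<in> \<rho> \<and> b \<in> TI k \<and> x \<odot>\<^bsub>I (Suc k)\<^esub> a = d k b \<and> L c a b \<in> BJ k)"
    if "(c, h) \<in> \<rho>'" for c h using that by (simp add: \<rho>'_def)
  have \<rho>'I: "(c, h) \<in> \<rho>'" if "c \<in> ZJ k" "(a, h) \<in> \<rho>" "b \<in> TI k" "x \<odot>\<^bsub>I (Suc k)\<^esub> a = d k b" "L c a b \<in> BJ k"
    for c h a b using that by (auto simp: \<rho>'_def)
  have P: "module R (prod_module (J k) H)" using module_prod_module[OF Y.mod H] .
  have "submodule \<rho>' R (prod_module (J k) H)"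
  proof (rule submodule_if_closed[OF P])
    show "\<rho>' \<subseteq> carrier (prod_module (J k) H)"
    proof clarify
      fix c h assume "(c, h) \<in> \<rho>'"
      thus "(c, h) \<in> carrier (prod_module (J k) H)" using \<rho>'D ZJc \<rho>sub(2) KH by fastforce
    qed
    have "L \<zero>\<^bsub>J k\<^esub> \<zero>\<^bsub>I (Suc k)\<^esub> \<zero>\<^bsub>I k\<^esub> = \<zero>\<^bsub>J k\<^esub>"
      by (simp add: L_def mod_hom_zero[OF X.mod Y.mod \<psi>] mod_hom_zero[OF X.mod Y.mod s])
    hence "(\<zero>\<^bsub>J k\<^esub>, \<zero>\<^bsub>H\<^esub>) \<in> \<rho>'"
      using x zer submodule_zero[OF BJ] submodule_zero[OF ZJ] submodule_zero[OF TI] X.zero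
      by (intro \<rho>'I[where a = "\<zero>\<^bsub>I (Suc k)\<^esub>" and b = "\<zero>\<^bsub>I k\<^esub>"]) auto
    thus "\<zero>\<^bsub>prod_module (J k) H\<^esub> \<in> \<rho>'" by simp
  next
    fix p q assume "p \<in> \<rho>'" "q \<in> \<rho>'"
    then obtain c h a b c' h' a' b' where 1: "p = (c, h)" "c \<in> ZJ k" "(a, h) \<in> \<rho>" "b \<in> TI k"
        "x \<odot>\<^bsub>I (Suc k)\<^esub> a = d k b" "L c a b \<in> BJ k"
      and 2: "q = (c', h')" "c' \<in> ZJ k" "(a', h') \<in> \<rho>" "b' \<in> TI k"
        "x \<odot>\<^bsub>I (Suc k)\<^esub> a' = d k b'" "L c' a' b' \<in> BJ k"
      using \<rho>'D by (metis surj_pair)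
    note c = ZJc[OF 1(2)] ZJc[OF 2(2)] TIc[OF 1(4)] TIc[OF 2(4)]
      ZIc[OF \<rho>sub(1)[OF 1(3)]] ZIc[OF \<rho>sub(1)[OF 2(3)]]
    have "L (c \<oplus>\<^bsub>J k\<^esub> c') (a \<oplus>\<^bsub>I (Suc k)\<^esub> a') (b \<oplus>\<^bsub>I k\<^esub> b') = L c a b \<oplus>\<^bsub>J k\<^esub> L c' a' b'"
      using c mod_hom_closed[OF \<psi>] mod_hom_closed[OF s]
      by (simp add: L_def mod_hom_add[OF \<psi>] mod_hom_add[OF s] a_minus_def J.M.minus_add J.M.minus_minus J.M.a_ac)
    hence "(c \<oplus>\<^bsub>J k\<^esub> c', h \<oplus>\<^bsub>H\<^esub> h') \<in> \<rho>'"
      using 1 2 c x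
      by (intro \<rho>'I[OF submodule_add[OF ZJ 1(2) 2(2)] add[OF 1(3) 2(3)] submodule_add[OF TI 1(4) 2(4)]])
       (auto simp: I.smult_r_distr X.add submodule_add[OF BJ])
    thus "p \<oplus>\<^bsub>prod_module (J k) H\<^esub> q \<in> \<rho>'" using 1 2 by simp
  next
    fix r p assume r: "r \<in> carrier R" and "p \<in> \<rho>'"
    then obtain c h a b where 1: "p = (c, h)" "c \<in> ZJ k" "(a, h) \<in> \<rho>" "b \<in> TI k"
        "x \<odot>\<^bsub>I (Suc k)\<^esub> a = d k b" "L c a b \<in> BJ k"
      using \<rho>'D by (metis surj_pair)
    note c = ZJc[OF 1(2)] TIc[OF 1(4)] ZIc[OF \<rho>sub(1)[OF 1(3)]]
    have "L (r \<odot>\<^bsub>J k\<^esub> c) (r \<odot>\<^bsub>I (Suc k)\<^esub> a) (r \<odot>\<^bsub>I k\<^esub> b) = r \<odot>\<^bsub>J k\<^esub> L c a b"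
      using c r mod_hom_closed[OF \<psi>] mod_hom_closed[OF s]
      by (simp add: L_def mod_hom_smult[OF \<psi>] mod_hom_smult[OF s] module_smult_minus[OF Y.mod])
    moreover have "x \<odot>\<^bsub>I (Suc k)\<^esub> (r \<odot>\<^bsub>I (Suc k)\<^esub> a) = d k (r \<odot>\<^bsub>I k\<^esub> b)"
      using c r x 1(5) X.smult I.m_comm by (metis I.smult_assoc1)
    ultimately have "(r \<odot>\<^bsub>J k\<^esub> c, r \<odot>\<^bsub>H\<^esub> h) \<in> \<rho>'"
      using 1 r by (intro \<rho>'I[OF submodule_smult[OF ZJ r 1(2)] sm[OF 1(3) r] submodule_smult[OF TI r 1(4)]])
       (auto simp: submodule_smult[OF BJ])
    thus "r \<odot>\<^bsub>prod_module (J k) H\<^esub> p \<in> \<rho>'" using 1 by simp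
  qed
  moreover have "\<rho>' \<subseteq> ZJ k \<times> {h \<in> K. x \<odot>\<^bsub>H\<^esub> h = \<zero>\<^bsub>H\<^esub>}"
  proof
    fix p assume "p \<in> \<rho>'"
    then obtain c h where p: "p = (c, h)" "(c, h) \<in> \<rho>'" by (cases p) auto
    then obtain a b where 1: "c \<in> ZJ k" "(a, h) \<in> \<rho>" "b \<in> TI k" "x \<odot>\<^bsub>I (Suc k)\<^esub> a = d k b"
      using \<rho>'D by blast
    have "x \<odot>\<^bsub>I (Suc k)\<^esub> a \<in> BI (Suc k)" using 1 by (simp add: coboundaries_def)
    hence "x \<odot>\<^bsub>H\<^esub> h = \<zero>\<^bsub>H\<^esub>" using iff[OF sm[OF 1(2) x]] by simp
    thus "p \<in> ZJ k \<times> {h \<in> K. x \<odot>\<^bsub>H\<^esub> h = \<zero>\<^bsub>H\<^esub>}" using p 1 \<rho>sub by blast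
  qed
  moreover have "\<exists>h. (c, h) \<in> \<rho>'" if cz: "c \<in> ZJ k" for c
  proof -
    obtain a b where ab: "a \<in> ZI (Suc k)" "b \<in> TI k" "x \<odot>\<^bsub>I (Suc k)\<^esub> a = d k b" "L c a b \<in> BJ k"
      using connecting_surjective[OF cz] unfolding L_def by blast
    obtain h where "(a, h) \<in> \<rho>" using tot[OF ab(1)] by blast
    thus ?thesis using \<rho>'I[OF cz _ ab(2-4)] by blast
  qed
  moreover have "\<exists>c. (c, h) \<in> \<rho>'" if h: "h \<in> K" "x \<odot>\<^bsub>H\<^esub> h = \<zero>\<^bsub>H\<^esub>" for h
  proof -
    obtain a where a: "(a, h) \<in> \<rho>" using sur[OF h(1)] by blast
    have "x \<odot>\<^bsub>I (Suc k)\<^esub> a \<in> BI (Suc k)" using iff[OF sm[OF a x]] h by simp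
    then obtain b where b: "b \<in> TI k" "x \<odot>\<^bsub>I (Suc k)\<^esub> a = d k b" by (auto simp: coboundaries_def)
    have z: "\<psi> k b \<ominus>\<^bsub>J k\<^esub> s k a \<in> ZJ k" using connecting_cocycle[OF \<rho>sub(1)[OF a] b] .
    have "L (\<psi> k b \<ominus>\<^bsub>J k\<^esub> s k a) a b \<in> BJ k" using ZJc[OF z] submodule_zero[OF BJ] by (simp add: L_def)
    thus ?thesis using \<rho>'I[OF z a b] by blast
  qed
  moreover have "c \<in> BJ k \<longleftrightarrow> h = \<zero>\<^bsub>H\<^esub>" if ch: "(c, h) \<in> \<rho>'" for c h
  proof -
    obtain a b where 1: "c \<in> ZJ k" "(a, h) \<in> \<rho>" "b \<in> TI k" "x \<odot>\<^bsub>I (Suc k)\<^esub> a = d k b" "L c a b \<in> BJ k"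
      using \<rho>'D[OF ch] by blast
    note aZ = \<rho>sub(1)[OF 1(2)]
    define w where "w = \<psi> k b \<ominus>\<^bsub>J k\<^esub> s k a"
    have wZ: "w \<in> ZJ k" unfolding w_def using connecting_cocycle[OF aZ 1(3,4)] .
    have cw: "c \<ominus>\<^bsub>J k\<^esub> w \<in> BJ k" using 1(5) by (simp add: L_def w_def)
    have eq: "c \<in> BJ k \<longleftrightarrow> w \<in> BJ k"
    proof
      assume "c \<in> BJ k"
      hence "c \<ominus>\<^bsub>J k\<^esub> (c \<ominus>\<^bsub>J k\<^esub> w) \<in> BJ k" using submodule_minus[OF Y.mod BJ _ cw] by blast
      thus "w \<in> BJ k" using ZJc[OF 1(1)] ZJc[OF wZ]
        by (simp add: a_minus_def J.M.minus_add J.M.r_neg2 J.M.minus_minus)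
    next
      assume "w \<in> BJ k"
      from submodule_add[OF BJ cw this] show "c \<in> BJ k" using ZJc[OF 1(1)] ZJc[OF wZ] by simp
    qed
    \<comment> \<open>Every cocycle of degree \<open>k\<close> is a coboundary, so zero serves as
      \<open>z'\<close>.\<close>
    have surj: "\<exists>z'\<in>ZI k. z \<ominus>\<^bsub>I k\<^esub> x \<odot>\<^bsub>I k\<^esub> z' \<in> BI k" if "z \<in> ZI k" for z
      using that van x ZIc[OF that] by (intro bexI[of _ "\<zero>\<^bsub>I k\<^esub>"]) (auto intro: submodule_zero[OF ZI])
    have "w \<in> BJ k \<longleftrightarrow> a \<in> BI (Suc k)"
      using connecting_zero[OF _ 1(3,4) surj] connecting_injective[OF aZ 1(3,4)] unfolding w_def by blast
    thus ?thesis using eq iff[OF 1(2)] by simp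
  qed
  ultimately show ?thesis unfolding cohomology_graph_def by (intro exI[of _ \<rho>']) auto
qed

text \<open>Both augmentations start from the same \<open>M\<close>. The hypothesis
  \<open>reg\<close> is regularity of \<open>x\<close> on \<open>M\<close> modulo the kernel of
  \<open>\<epsilon>\<close>, and \<open>ker\<close> says that the kernel of \<open>\<eta>\<close> is
  that of \<open>\<epsilon>\<close> plus \<open>x M\<close>.\<close>

lemma multiplication_sequence_exists:
  assumes X: "injective_complex R I d" and Y: "injective_complex R J e" and \<aa>: "ideal \<aa> R"
    and x: "x \<in> carrier R"
    and aug: "augmentation R M I d \<epsilon>" "augmentation R M J e \<eta>"
    and reg: "\<And>m. m \<in> carrier M \<Longrightarrow> \<epsilon> (x \<odot>\<^bsub>M\<^esub> m) = \<zero>\<^bsub>I 0\<^esub> \<Longrightarrow> \<epsilon> m = \<zero>\<^bsub>I 0\<^esub>"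
    and ker: "\<And>m. m \<in> carrier M \<Longrightarrow> \<eta> m = \<zero>\<^bsub>J 0\<^esub> \<longleftrightarrow> (\<exists>m'\<in>carrier M. \<epsilon> m = \<epsilon> (x \<odot>\<^bsub>M\<^esub> m'))"
  shows "\<exists>\<psi> s. multiplication_sequence R I d J e \<aa> x \<psi> s"
proof -
  interpret X: injective_complex R I d by fact
  interpret Y: injective_complex R J e by fact
  have \<epsilon>: "\<epsilon> \<in> mod_hom R M (I 0)" "\<epsilon> ` carrier M = mod_ker (I 0) (I 1) (d 0)" and M: "module R M"
    and \<eta>: "\<eta> \<in> mod_hom R M (J 0)" "\<eta> ` carrier M = mod_ker (J 0) (J 1) (e 0)"
    using aug by (auto simp: augmentation_def)
  interpret M: module R M by fact
  interpret I0: module R "I 0" by (rule X.mod)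
  have \<eta>0: "e 0 (\<eta> m) = \<zero>\<^bsub>J 1\<^esub>" if "m \<in> carrier M" for m
    using \<eta>(2) that by (auto simp: mod_ker_def)
  have Ik: "\<exists>m\<in>carrier M. a = \<epsilon> m" if "a \<in> carrier (I 0)" "d 0 a = \<zero>\<^bsub>I 1\<^esub>" for a
  proof -
    have "a \<in> \<epsilon> ` carrier M" using that by (simp add: \<epsilon>(2) mod_ker_def)
    thus ?thesis by blast
  qed
  have \<epsilon>k: "\<epsilon> m \<in> carrier (I 0)" "d 0 (\<epsilon> m) = \<zero>\<^bsub>I 1\<^esub>" if "m \<in> carrier M" for m
    using \<epsilon>(2) that by (auto simp: mod_ker_def)
  have Jk: "\<exists>m\<in>carrier M. a = \<eta> m" if "a \<in> carrier (J 0)" "e 0 a = \<zero>\<^bsub>J 1\<^esub>" for a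
  proof -
    have "a \<in> \<eta> ` carrier M" using that by (simp add: \<eta>(2) mod_ker_def)
    thus ?thesis by blast
  qed
  have k0: "\<eta> m = \<zero>\<^bsub>J 0\<^esub>" if "m \<in> carrier M" "\<epsilon> m = \<zero>\<^bsub>I 0\<^esub>" for m
    using that x mod_hom_zero[OF M X.mod \<epsilon>(1)] ker[OF that(1)] by (metis M.smult_r_null M.zero_closed)
  obtain \<psi> where \<psi>: "\<And>n. \<psi> n \<in> mod_hom R (I n) (J n)"
    "\<And>n a. a \<in> carrier (I n) \<Longrightarrow> \<psi> (Suc n) (d n a) = e n (\<psi> n a)" "\<And>m. m \<in> carrier M \<Longrightarrow> \<psi> 0 (\<epsilon> m) = \<eta> m"
    using injective_complex_lift[OF X Y aug(1) \<eta>(1) \<eta>0 k0] by blast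
  have \<eta>x: "\<eta> (x \<odot>\<^bsub>M\<^esub> m) = \<zero>\<^bsub>J 0\<^esub>" if "m \<in> carrier M" for m using ker that x by blast
  \<comment> \<open>Multiplication by \<open>x\<close> followed by \<open>\<psi>\<close> is zero on
    the resolved module, by \<open>\<eta>x\<close>; its null-homotopy is the required
    \<open>s\<close>.\<close>
  define F where "F n a = \<psi> n (x \<odot>\<^bsub>I n\<^esub> a)" for n a
  have F: "F n \<in> mod_hom R (I n) (J n)" for n
    unfolding F_def by (rule mod_hom_compose[OF mod_hom_smult_const[OF X.mod x] \<psi>(1)])
  have Fd: "F (Suc n) (d n a) = e n (F n a)" if "a \<in> carrier (I n)" for n a
  proof -
    interpret In: module R "I n" by (rule X.mod)
    show ?thesis using that x by (simp add: F_def \<psi>(2)[symmetric] X.smult)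
  qed
  have F0: "F 0 a = \<zero>\<^bsub>J 0\<^esub>" if "a \<in> carrier (I 0)" "d 0 a = \<zero>\<^bsub>I 1\<^esub>" for a
  proof -
    obtain m where m: "m \<in> carrier M" "a = \<epsilon> m" using Ik \<open>a \<in> carrier (I 0)\<close> \<open>d 0 a = \<zero>\<^bsub>I 1\<^esub>\<close> by blast
    have "x \<odot>\<^bsub>I 0\<^esub> a = \<epsilon> (x \<odot>\<^bsub>M\<^esub> m)" using m x mod_hom_smult[OF \<epsilon>(1)] by simp
    thus ?thesis using m x \<psi>(3) \<eta>x by (simp add: F_def)
  qed
  obtain s where s: "\<And>n. s n \<in> mod_hom R (I (Suc n)) (J n)" "\<And>a. a \<in> carrier (I 0) \<Longrightarrow> s 0 (d 0 a) = F 0 a"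
    "\<And>n a. a \<in> carrier (I (Suc n)) \<Longrightarrow> s (Suc n) (d (Suc n) a) \<oplus>\<^bsub>J (Suc n)\<^esub> e n (s n a) = F (Suc n) a"
    using injective_complex_homotopy[OF X Y F Fd F0] by blast
  have "multiplication_sequence R I d J e \<aa> x \<psi> s"
  proof (intro multiplication_sequence.intro multiplication_sequence_axioms.intro X Y \<aa> x \<psi>(1))
    fix a assume a: "a \<in> carrier (I 0)" "d 0 a = \<zero>\<^bsub>I 1\<^esub>"
    then obtain m where m: "m \<in> carrier M" "a = \<epsilon> m" using Ik by blast
    show "a = \<zero>\<^bsub>I 0\<^esub>" if "x \<odot>\<^bsub>I 0\<^esub> a = \<zero>\<^bsub>I 0\<^esub>"
      using that reg[OF m(1)] m(2) mod_hom_smult[OF \<epsilon>(1) x m(1)] by simp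
    show "\<exists>a'\<in>carrier (I 0). d 0 a' = \<zero>\<^bsub>I 1\<^esub> \<and> x \<odot>\<^bsub>I 0\<^esub> a' = a" if p0: "\<psi> 0 a = \<zero>\<^bsub>J 0\<^esub>"
    proof -
      obtain m' where m': "m' \<in> carrier M" "\<epsilon> m = \<epsilon> (x \<odot>\<^bsub>M\<^esub> m')" using p0 m(2) \<psi>(3)[OF m(1)] ker[OF m(1)] by auto
      show ?thesis using m m' \<epsilon>k[OF m'(1)] x mod_hom_smult[OF \<epsilon>(1)] by (intro bexI[of _ "\<epsilon> m'"]) auto
    qed
  next
    fix c assume "c \<in> carrier (J 0)" "e 0 c = \<zero>\<^bsub>J 1\<^esub>"
    then obtain m where "m \<in> carrier M" "c = \<eta> m" using Jk by blast
    thus "\<exists>a\<in>carrier (I 0). d 0 a = \<zero>\<^bsub>I 1\<^esub> \<and> \<psi> 0 a = c" using \<epsilon>k \<psi>(3) by auto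
  qed (use \<psi>(2) s in \<open>auto simp: F_def\<close>)
  thus ?thesis by blast
qed

section \<open>Quotient modules\<close>

lemma abelian_subgroup_submodule:
  assumes "module R M" "submodule N R M"
  shows "abelian_subgroup N M"
  using assms by (intro abelian_subgroupI3 additive_subgroup.intro submodule.axioms(1) module.axioms(2))

lemma coset_eq_iff:
  assumes "module R M" "submodule N R M" "a \<in> carrier M" "b \<in> carrier M"
  shows "N +>\<^bsub>M\<^esub> a = N +>\<^bsub>M\<^esub> b \<longleftrightarrow> a \<ominus>\<^bsub>M\<^esub> b \<in> N"
proof -
  interpret M: module R M by fact
  interpret S: abelian_subgroup N M using assms by (intro abelian_subgroup_submodule)
  have Nc: "n \<in> carrier M" if "n \<in> N" for n using that submodule_subset[OF assms(2)] by blast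
  show ?thesis
  proof
    assume "N +>\<^bsub>M\<^esub> a = N +>\<^bsub>M\<^esub> b"
    hence "a \<in> N +>\<^bsub>M\<^esub> b" using S.a_rcos_self[OF assms(3)] by simp
    then obtain n where "n \<in> N" "a = n \<oplus>\<^bsub>M\<^esub> b" by (auto simp: a_r_coset_def')
    thus "a \<ominus>\<^bsub>M\<^esub> b \<in> N" using Nc assms by (simp add: a_minus_def M.a_assoc M.r_neg)
  next
    assume n: "a \<ominus>\<^bsub>M\<^esub> b \<in> N"
    have "a = (a \<ominus>\<^bsub>M\<^esub> b) \<oplus>\<^bsub>M\<^esub> b" using assms by simp
    hence "a \<in> N +>\<^bsub>M\<^esub> b" using n by (auto simp: a_r_coset_def')
    thus "N +>\<^bsub>M\<^esub> a = N +>\<^bsub>M\<^esub> b" using S.a_repr_independence' assms(4) by simp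
  qed
qed

lemma mod_quot_simps:
  assumes "module R M" "submodule N R M"
  shows "carrier (mod_quot M N) = (\<lambda>m. N +>\<^bsub>M\<^esub> m) ` carrier M" and "\<zero>\<^bsub>mod_quot M N\<^esub> = N"
    and "a \<in> carrier M \<Longrightarrow> b \<in> carrier M \<Longrightarrow>
      (N +>\<^bsub>M\<^esub> a) \<oplus>\<^bsub>mod_quot M N\<^esub> (N +>\<^bsub>M\<^esub> b) = N +>\<^bsub>M\<^esub> (a \<oplus>\<^bsub>M\<^esub> b)"
    and "r \<in> carrier R \<Longrightarrow> a \<in> carrier M \<Longrightarrow>
      r \<odot>\<^bsub>mod_quot M N\<^esub> (N +>\<^bsub>M\<^esub> a) = N +>\<^bsub>M\<^esub> (r \<odot>\<^bsub>M\<^esub> a)"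
    and "a \<in> carrier M \<Longrightarrow> N +>\<^bsub>M\<^esub> a = N \<longleftrightarrow> a \<in> N"
proof -
  interpret M: module R M by fact
  interpret S: abelian_subgroup N M using assms by (intro abelian_subgroup_submodule)
  have Nc: "n \<in> carrier M" if "n \<in> N" for n using that submodule_subset[OF assms(2)] by blast
  show "carrier (mod_quot M N) = (\<lambda>m. N +>\<^bsub>M\<^esub> m) ` carrier M"
    by (auto simp: mod_quot_def A_RCOSETS_def')
  show "\<zero>\<^bsub>mod_quot M N\<^esub> = N" by (simp add: mod_quot_def)
  show "(N +>\<^bsub>M\<^esub> a) \<oplus>\<^bsub>mod_quot M N\<^esub> (N +>\<^bsub>M\<^esub> b) = N +>\<^bsub>M\<^esub> (a \<oplus>\<^bsub>M\<^esub> b)"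
    if "a \<in> carrier M" "b \<in> carrier M" using S.a_rcos_sum that by (simp add: mod_quot_def)
  show "r \<odot>\<^bsub>mod_quot M N\<^esub> (N +>\<^bsub>M\<^esub> a) = N +>\<^bsub>M\<^esub> (r \<odot>\<^bsub>M\<^esub> a)"
    if ra: "r \<in> carrier R" "a \<in> carrier M"
  proof -
    \<comment> \<open>The scalar multiple of a coset is a union over all representatives; each of
      them contributes the same coset.\<close>
    have eq: "N +>\<^bsub>M\<^esub> (r \<odot>\<^bsub>M\<^esub> b) = N +>\<^bsub>M\<^esub> (r \<odot>\<^bsub>M\<^esub> a)" if ba: "b \<in> N +>\<^bsub>M\<^esub> a" for b
    proof -
      obtain n where n: "n \<in> N" "b = n \<oplus>\<^bsub>M\<^esub> a" using ba by (auto simp: a_r_coset_def')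
      have "r \<odot>\<^bsub>M\<^esub> b \<ominus>\<^bsub>M\<^esub> r \<odot>\<^bsub>M\<^esub> a = r \<odot>\<^bsub>M\<^esub> n"
        using n ra Nc by (simp add: M.smult_r_distr a_minus_def M.a_assoc M.M.r_neg)
      thus ?thesis
        using n ra Nc submodule_smult[OF assms(2) ra(1) n(1)] by (subst coset_eq_iff[OF assms]) auto
    qed
    have self: "a \<in> N +>\<^bsub>M\<^esub> a" using S.a_rcos_self ra by blast
    have "(\<Union>b\<in>N +>\<^bsub>M\<^esub> a. N +>\<^bsub>M\<^esub> (r \<odot>\<^bsub>M\<^esub> b)) = (\<Union>b\<in>N +>\<^bsub>M\<^esub> a. N +>\<^bsub>M\<^esub> (r \<odot>\<^bsub>M\<^esub> a))"
      by (rule SUP_cong[OF refl eq])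
    also have "\<dots> = N +>\<^bsub>M\<^esub> (r \<odot>\<^bsub>M\<^esub> a)" using self by blast
    finally show ?thesis by (simp add: mod_quot_def)
  qed
  show "N +>\<^bsub>M\<^esub> a = N \<longleftrightarrow> a \<in> N" if "a \<in> carrier M"
  proof -
    have z: "N +>\<^bsub>M\<^esub> \<zero>\<^bsub>M\<^esub> = N"
      by (rule M.a_coset_join2[OF M.M.zero_closed S.a_subgroup submodule_zero[OF assms(2)]])
    show ?thesis
      using coset_eq_iff[OF assms that M.M.zero_closed] unfolding z M.M.minus_zero_right[OF that] .
  qed
qed

lemma module_mod_quot:
  assumes "module R M" "submodule N R M"
  shows "module R (mod_quot M N)"
proof -
  interpret M: module R M by fact
  note [simp] = mod_quot_simps(1,3,4)[OF assms]
  have N: "N = N +>\<^bsub>M\<^esub> \<zero>\<^bsub>M\<^esub>" using mod_quot_simps(5)[OF assms M.M.zero_closed] submodule_zero[OF assms(2)] by blast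
  have [simp]: "\<zero>\<^bsub>mod_quot M N\<^esub> = N +>\<^bsub>M\<^esub> \<zero>\<^bsub>M\<^esub>" using mod_quot_simps(2)[OF assms] N by simp
  show ?thesis
  proof (intro moduleI abelian_groupI)
    show "cring R" by (rule M.is_cring)
    fix p assume p: "p \<in> carrier (mod_quot M N)"
    then obtain x where x: "x \<in> carrier M" "p = N +>\<^bsub>M\<^esub> x" by auto
    show "\<exists>q\<in>carrier (mod_quot M N). q \<oplus>\<^bsub>mod_quot M N\<^esub> p = \<zero>\<^bsub>mod_quot M N\<^esub>"
      using x by (intro bexI[of _ "N +>\<^bsub>M\<^esub> (\<ominus>\<^bsub>M\<^esub> x)"]) (auto simp: M.M.l_neg)
  qed (auto simp: M.M.a_ac M.smult_l_distr M.smult_r_distr M.smult_assoc1)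
qed

lemma mod_quot_hom:
  assumes "module R M" "submodule N R M"
  shows "(\<lambda>m. N +>\<^bsub>M\<^esub> m) \<in> mod_hom R M (mod_quot M N)"
proof -
  interpret M: module R M by fact
  show ?thesis by (rule mod_homI) (auto simp: mod_quot_simps[OF assms])
qed

lemma zero_module_mod_quot_iff:
  assumes "module R M" "submodule N R M"
  shows "zero_module (mod_quot M N) \<longleftrightarrow> carrier M \<subseteq> N"
proof -
  interpret M: module R M by fact
  show ?thesis
    unfolding zero_module_def mod_quot_simps(1,2)[OF assms]
    using mod_quot_simps(5)[OF assms] M.M.zero_closed by auto
qed

lemma nonzerodivisor_on_mod_quot_iff:
  assumes "module R M" "submodule N R M" "x \<in> carrier R"
  shows "nonzerodivisor_on (mod_quot M N) x \<longleftrightarrow> (\<forall>m\<in>carrier M. x \<odot>\<^bsub>M\<^esub> m \<in> N \<longrightarrow> m \<in> N)"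
proof -
  interpret M: module R M by fact
  show ?thesis
    using assms(3) unfolding nonzerodivisor_on_def mod_quot_simps(1,2)[OF assms(1,2)]
    by (auto simp: mod_quot_simps(4,5)[OF assms(1,2)])
qed

section \<open>The submodule generated by the products of \<open>S\<close> and
  \<open>M\<close>\<close>

definition mult_submodule ::
  "('r, 'k) ring_scheme \<Rightarrow> ('r, 'm, 'l) module_scheme \<Rightarrow> 'r set \<Rightarrow> 'm set" where
  "mult_submodule R M S = module_span R M {s \<odot>\<^bsub>M\<^esub> m | s m. s \<in> S \<and> m \<in> carrier M}"

lemma mod_quot_mult_eq: "mod_quot_mult R M S = mod_quot M (mult_submodule R M S)"
  by (simp add: mod_quot_mult_def mult_submodule_def)

lemma submodule_module_span:
  assumes "module R M" "S \<subseteq> carrier M"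
  shows "submodule (module_span R M S) R M"
proof -
  interpret M: module R M by fact
  show ?thesis
    by (rule submodule_if_closed[OF assms(1)])
      (use assms M.carrier_is_submodule in \<open>auto simp: module_span_def submodule_zero submodule_add submodule_smult\<close>)
qed

lemma mult_submodule_least:
  assumes "submodule N R M" "\<And>s m. s \<in> S \<Longrightarrow> m \<in> carrier M \<Longrightarrow> s \<odot>\<^bsub>M\<^esub> m \<in> N"
  shows "mult_submodule R M S \<subseteq> N"
  unfolding mult_submodule_def module_span_def using assms by blast

lemma smult_in_mult_submodule:
  "s \<in> S \<Longrightarrow> m \<in> carrier M \<Longrightarrow> s \<odot>\<^bsub>M\<^esub> m \<in> mult_submodule R M S"
  unfolding mult_submodule_def module_span_def by blast

lemma submodule_mult_submodule:
  assumes "module R M" "S \<subseteq> carrier R"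
  shows "submodule (mult_submodule R M S) R M"
proof -
  interpret M: module R M by fact
  show ?thesis unfolding mult_submodule_def
    using assms by (intro submodule_module_span) auto
qed

lemma mult_submodule_mono:
  assumes "module R M" "T \<subseteq> carrier R" "S \<subseteq> T"
  shows "mult_submodule R M S \<subseteq> mult_submodule R M T"
  using assms by (intro mult_submodule_least submodule_mult_submodule) (auto intro: smult_in_mult_submodule)

lemma mult_submodule_empty:
  assumes "module R M"
  shows "mult_submodule R M {} = {\<zero>\<^bsub>M\<^esub>}"
proof -
  interpret M: module R M by fact
  have "submodule {\<zero>\<^bsub>M\<^esub>} R M" by (rule submodule_if_closed[OF assms]) auto
  hence "mult_submodule R M {} \<subseteq> {\<zero>\<^bsub>M\<^esub>}" by (rule mult_submodule_least) simp
  thus ?thesis using submodule_zero[OF submodule_mult_submodule[OF assms, of "{}"]] by blast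
qed

lemma mult_submodule_insert:
  assumes M: "module R M" and "S \<subseteq> carrier R" "x \<in> carrier R" "m \<in> carrier M"
  shows "m \<in> mult_submodule R M (insert x S) \<longleftrightarrow>
     (\<exists>m'\<in>carrier M. m \<ominus>\<^bsub>M\<^esub> x \<odot>\<^bsub>M\<^esub> m' \<in> mult_submodule R M S)"
proof -
  interpret M: module R M by fact
  let ?N = "mult_submodule R M S" and ?N' = "mult_submodule R M (insert x S)"
  have N: "submodule ?N R M" and N': "submodule ?N' R M"
    using assms by (auto intro: submodule_mult_submodule)
  have Nc: "n \<in> carrier M" if "n \<in> ?N" for n using that submodule_subset[OF N] by blast
  \<comment> \<open>The sum of \<open>?N\<close> and \<open>x M\<close>: a submodule containing
    every generator of \<open>?N'\<close>, hence \<open>?N'\<close> itself.\<close>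
  define L where "L = {n \<oplus>\<^bsub>M\<^esub> x \<odot>\<^bsub>M\<^esub> m' | n m'. n \<in> ?N \<and> m' \<in> carrier M}"
  have LI: "n \<oplus>\<^bsub>M\<^esub> x \<odot>\<^bsub>M\<^esub> m' \<in> L" if "n \<in> ?N" "m' \<in> carrier M" for n m' using that by (auto simp: L_def)
  have "submodule L R M"
  proof (rule submodule_if_closed[OF M])
    show "L \<subseteq> carrier M" using Nc assms by (auto simp: L_def)
    show "\<zero>\<^bsub>M\<^esub> \<in> L" using LI[OF submodule_zero[OF N] M.M.zero_closed] assms by simp
  next
    fix a b assume "a \<in> L" "b \<in> L"
    then obtain n m n' m' where *: "n \<in> ?N" "m \<in> carrier M" "n' \<in> ?N" "m' \<in> carrier M"
      "a = n \<oplus>\<^bsub>M\<^esub> x \<odot>\<^bsub>M\<^esub> m" "b = n' \<oplus>\<^bsub>M\<^esub> x \<odot>\<^bsub>M\<^esub> m'" by (auto simp: L_def)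
    have "a \<oplus>\<^bsub>M\<^esub> b = (n \<oplus>\<^bsub>M\<^esub> n') \<oplus>\<^bsub>M\<^esub> x \<odot>\<^bsub>M\<^esub> (m \<oplus>\<^bsub>M\<^esub> m')"
      using * Nc assms by (simp add: M.smult_r_distr M.M.a_ac)
    thus "a \<oplus>\<^bsub>M\<^esub> b \<in> L" using LI[OF submodule_add[OF N *(1,3)]] * by simp
  next
    fix r a assume r: "r \<in> carrier R" and "a \<in> L"
    then obtain n m where *: "n \<in> ?N" "m \<in> carrier M" "a = n \<oplus>\<^bsub>M\<^esub> x \<odot>\<^bsub>M\<^esub> m" by (auto simp: L_def)
    have "r \<odot>\<^bsub>M\<^esub> a = r \<odot>\<^bsub>M\<^esub> n \<oplus>\<^bsub>M\<^esub> x \<odot>\<^bsub>M\<^esub> (r \<odot>\<^bsub>M\<^esub> m)"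
      using * Nc assms r by (simp add: M.smult_r_distr M.R.m_comm flip: M.smult_assoc1)
    thus "r \<odot>\<^bsub>M\<^esub> a \<in> L" using LI[OF submodule_smult[OF N r *(1)]] * r by simp
  qed
  moreover have "s \<odot>\<^bsub>M\<^esub> m \<in> L" if "s \<in> insert x S" "m \<in> carrier M" for s m
  proof (cases "s = x")
    case True
    thus ?thesis using LI[OF submodule_zero[OF N] that(2)] that assms by simp
  next
    case False
    hence "s \<in> S" using that by blast
    thus ?thesis using LI[OF smult_in_mult_submodule[OF \<open>s \<in> S\<close> that(2)] M.M.zero_closed] that assms by auto
  qed
  ultimately have sub: "?N' \<subseteq> L" by (rule mult_submodule_least)
  show ?thesis
  proof
    assume "m \<in> ?N'"
    then obtain n m' where *: "n \<in> ?N" "m' \<in> carrier M" "m = n \<oplus>\<^bsub>M\<^esub> x \<odot>\<^bsub>M\<^esub> m'" using sub by (auto simp: L_def)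
    hence "m \<ominus>\<^bsub>M\<^esub> x \<odot>\<^bsub>M\<^esub> m' = n" using Nc assms by (simp add: a_minus_def M.a_assoc M.M.r_neg)
    thus "\<exists>m'\<in>carrier M. m \<ominus>\<^bsub>M\<^esub> x \<odot>\<^bsub>M\<^esub> m' \<in> ?N" using * by (intro bexI[of _ m']) auto
  next
    assume "\<exists>m'\<in>carrier M. m \<ominus>\<^bsub>M\<^esub> x \<odot>\<^bsub>M\<^esub> m' \<in> ?N"
    then obtain m' where m': "m' \<in> carrier M" "m \<ominus>\<^bsub>M\<^esub> x \<odot>\<^bsub>M\<^esub> m' \<in> ?N" by blast
    have "m \<ominus>\<^bsub>M\<^esub> x \<odot>\<^bsub>M\<^esub> m' \<in> ?N'" using m' mult_submodule_mono[OF M, of "insert x S" S] assms by blast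
    from submodule_add[OF N' this smult_in_mult_submodule[of x "insert x S" m' M R]]
    show "m \<in> ?N'" using m' assms by simp
  qed
qed

section \<open>Matlis duality\<close>

lemma Hom_module_simps [simp]:
  "carrier (Hom_module R M N) = mod_hom R M N \<inter> extensional (carrier M)"
  "\<zero>\<^bsub>Hom_module R M N\<^esub> = (\<lambda>x\<in>carrier M. \<zero>\<^bsub>N\<^esub>)"
  "f \<oplus>\<^bsub>Hom_module R M N\<^esub> g = (\<lambda>x\<in>carrier M. f x \<oplus>\<^bsub>N\<^esub> g x)"
  "r \<odot>\<^bsub>Hom_module R M N\<^esub> f = (\<lambda>x\<in>carrier M. r \<odot>\<^bsub>N\<^esub> f x)"
  by (simp_all add: Hom_module_def)

lemma mod_hom_restrict:
  assumes "module R M" "f \<in> mod_hom R M N"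
  shows "restrict f (carrier M) \<in> mod_hom R M N"
proof -
  interpret M: module R M by fact
  show ?thesis using assms(2) by (auto simp: mod_hom_def)
qed

lemma module_Hom_module:
  assumes "module R M" "module R N"
  shows "module R (Hom_module R M N)"
proof -
  interpret M: module R M by fact
  interpret N: module R N by fact
  let ?H = "Hom_module R M N"
  have cl: "f x \<in> carrier N" if "f \<in> carrier ?H" "x \<in> carrier M" for f x
    using that mod_hom_closed by fastforce
  have ext: "f = g" if "f \<in> carrier ?H" "g \<in> carrier ?H" "\<And>x. x \<in> carrier M \<Longrightarrow> f x = g x" for f g
    using that by (auto intro: extensionalityI)
  have addc: "f \<oplus>\<^bsub>?H\<^esub> g \<in> carrier ?H" if "f \<in> carrier ?H" "g \<in> carrier ?H" for f g
    using that cl[OF that(1)] cl[OF that(2)]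
    by (auto intro!: mod_homI simp: mod_hom_add mod_hom_smult N.smult_r_distr N.M.a_ac)
  have zeroc: "\<zero>\<^bsub>?H\<^esub> \<in> carrier ?H" by (auto intro!: mod_homI)
  have smc: "r \<odot>\<^bsub>?H\<^esub> f \<in> carrier ?H" if "r \<in> carrier R" "f \<in> carrier ?H" for r f
    using that cl[OF that(2)]
    by (auto intro!: mod_homI simp: mod_hom_add mod_hom_smult N.smult_r_distr M.R.m_comm simp flip: N.smult_assoc1)
  show ?thesis
  proof (intro moduleI abelian_groupI)
    show "cring R" by (rule M.is_cring)
    fix f assume f: "f \<in> carrier ?H"
    have "(\<ominus>\<^bsub>R\<^esub> \<one>\<^bsub>R\<^esub>) \<odot>\<^bsub>?H\<^esub> f \<oplus>\<^bsub>?H\<^esub> f = \<zero>\<^bsub>?H\<^esub>"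
      by (rule ext[OF addc[OF smc[OF _ f] f] zeroc]) (use cl[OF f] in \<open>auto simp: N.smult_l_minus N.M.l_neg\<close>)
    thus "\<exists>g\<in>carrier ?H. g \<oplus>\<^bsub>?H\<^esub> f = \<zero>\<^bsub>?H\<^esub>" using smc[OF _ f] by (metis M.R.a_inv_closed M.R.one_closed)
    show "\<zero>\<^bsub>?H\<^esub> \<oplus>\<^bsub>?H\<^esub> f = f" by (rule ext[OF addc[OF zeroc f] f]) (use cl[OF f] in auto)
    show "\<one>\<^bsub>R\<^esub> \<odot>\<^bsub>?H\<^esub> f = f" by (rule ext[OF smc[OF _ f] f]) (use cl[OF f] in auto)
    fix g assume g: "g \<in> carrier ?H"
    show "f \<oplus>\<^bsub>?H\<^esub> g \<in> carrier ?H" by (rule addc[OF f g])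
    show "f \<oplus>\<^bsub>?H\<^esub> g = g \<oplus>\<^bsub>?H\<^esub> f"
      by (rule ext[OF addc[OF f g] addc[OF g f]]) (use cl[OF f] cl[OF g] in \<open>auto simp: N.M.a_comm\<close>)
    fix h assume h: "h \<in> carrier ?H"
    show "f \<oplus>\<^bsub>?H\<^esub> g \<oplus>\<^bsub>?H\<^esub> h = f \<oplus>\<^bsub>?H\<^esub> (g \<oplus>\<^bsub>?H\<^esub> h)"
      by (rule ext[OF addc[OF addc[OF f g] h] addc[OF f addc[OF g h]]])
        (use cl[OF f] cl[OF g] cl[OF h] in \<open>auto simp: N.M.a_assoc\<close>)
  next
    show "\<zero>\<^bsub>?H\<^esub> \<in> carrier ?H" by (rule zeroc)
    fix r f assume r: "r \<in> carrier R" and f: "f \<in> carrier ?H"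
    show "r \<odot>\<^bsub>?H\<^esub> f \<in> carrier ?H" by (rule smc[OF r f])
    fix g assume g: "g \<in> carrier ?H"
    show "r \<odot>\<^bsub>?H\<^esub> (f \<oplus>\<^bsub>?H\<^esub> g) = r \<odot>\<^bsub>?H\<^esub> f \<oplus>\<^bsub>?H\<^esub> r \<odot>\<^bsub>?H\<^esub> g"
      by (rule ext[OF smc[OF r addc[OF f g]] addc[OF smc[OF r f] smc[OF r g]]])
        (use cl[OF f] cl[OF g] r in \<open>auto simp: N.smult_r_distr\<close>)
  next
    fix r q f assume r: "r \<in> carrier R" and q: "q \<in> carrier R" and f: "f \<in> carrier ?H"
    show "(r \<oplus>\<^bsub>R\<^esub> q) \<odot>\<^bsub>?H\<^esub> f = r \<odot>\<^bsub>?H\<^esub> f \<oplus>\<^bsub>?H\<^esub> q \<odot>\<^bsub>?H\<^esub> f"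
      by (rule ext[OF smc[OF _ f] addc[OF smc[OF r f] smc[OF q f]]])
        (use cl[OF f] r q in \<open>auto simp: N.smult_l_distr\<close>)
    show "(r \<otimes>\<^bsub>R\<^esub> q) \<odot>\<^bsub>?H\<^esub> f = r \<odot>\<^bsub>?H\<^esub> (q \<odot>\<^bsub>?H\<^esub> f)"
      by (rule ext[OF smc[OF _ f] smc[OF r smc[OF q f]]])
        (use cl[OF f] r q in \<open>auto simp: N.smult_assoc1\<close>)
  qed
qed

text \<open>In a Noetherian ring a nonempty chain of ideals contains its union, so Zorn's lemma
  yields an ideal maximal among the proper ones above \<open>J\<close>. It is a maximal ideal, hence
  \<open>\<mm>\<close>.\<close>

lemma proper_ideal_subset_maximal:
  assumes "noetherian_ring R" "local_ring R \<mm>" "ideal J R" "\<one>\<^bsub>R\<^esub> \<notin> J"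
  shows "J \<subseteq> \<mm>"
proof -
  interpret noetherian_ring R by fact
  define S where "S = {K. ideal K R \<and> J \<subseteq> K \<and> \<one>\<^bsub>R\<^esub> \<notin> K}"
  have "S \<noteq> {}" using assms(3,4) by (auto simp: S_def)
  then obtain K where K: "K \<in> S" "\<And>X. X \<in> S \<Longrightarrow> K \<subseteq> X \<Longrightarrow> X = K"
  proof (rule subset_Zorn_nonempty[THEN bexE])
    fix C assume C: "C \<noteq> {}" "subset.chain S C"
    have "subset.chain {I. ideal I R} C" using C(2) by (auto simp: subset_chain_def S_def)
    hence "\<Union>C \<in> C" using ideal_chain_is_trivial C(1) by blast
    thus "\<Union>C \<in> S" using C(2) by (auto simp: subset_chain_def)
  qed blast
  have "maximalideal K R"
  proof (rule maximalidealI)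
    show "ideal K R" using K by (simp add: S_def)
    show "carrier R \<noteq> K" using K by (auto simp: S_def)
    fix X assume X: "ideal X R" "K \<subseteq> X" "X \<subseteq> carrier R"
    show "X = K \<or> X = carrier R"
    proof (cases "\<one>\<^bsub>R\<^esub> \<in> X")
      case True
      thus ?thesis using ideal.one_imp_carrier[OF X(1)] by blast
    next
      case False
      thus ?thesis using X K by (intro disjI1 K(2)) (auto simp: S_def)
    qed
  qed
  hence "K = \<mm>" using assms(2) by (simp add: local_ring_def)
  thus ?thesis using K by (auto simp: S_def)
qed

text \<open>The coset of \<open>y\<close> generates a copy of \<open>R/J\<close> inside
  \<open>H/B\<close>, where \<open>J\<close> is the proper ideal \<open>B : y\<close>. As
  \<open>J\<close> lies in \<open>\<mm>\<close>, this copy maps onto \<open>R/\<mm>\<close> and on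
  into \<open>E\<close> with nonzero value at the generator; injectivity of \<open>E\<close> extends
  the map to \<open>H/B\<close>.\<close>

lemma residue_hull_cogenerator:
  assumes R: "noetherian_ring R" "local_ring R \<mm>"
    and E: "injective_hull R (mod_quot (self_module R) \<mm>) E"
    and H: "module R H" and B: "submodule B R H" and y: "y \<in> carrier H" "y \<notin> B"
  shows "\<exists>u\<in>mod_hom R H E. (\<forall>b\<in>B. u b = \<zero>\<^bsub>E\<^esub>) \<and> u y \<noteq> \<zero>\<^bsub>E\<^esub>"
proof -
  interpret H: module R H by fact
  let ?S = "self_module R" and ?Q = "mod_quot H B"
  have S: "module R ?S" using module_self_module[OF H.is_cring] .
  have max: "maximalideal \<mm> R" using R(2) by (simp add: local_ring_def)
  have m: "submodule \<mm> R ?S" using submodule_ideal[OF H.is_cring maximalideal.axioms(1)[OF max]] .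
  have Q: "module R ?Q" using module_mod_quot[OF H B] .
  interpret Q: module R ?Q by fact
  obtain \<epsilon> where \<epsilon>: "\<epsilon> \<in> mod_hom R (mod_quot ?S \<mm>) E" "inj_on \<epsilon> (carrier (mod_quot ?S \<mm>))"
    and inj: "injective_module R E" using E by (auto simp: injective_hull_def)
  have E': "baer_injective R E" using injective_module_imp_baer_injective[OF inj] .
  have mE: "module R E" using baer_injective_module[OF E'] .
  have carS: "carrier ?S = carrier R" by (simp add: self_module_def)
  define q where "q = B +>\<^bsub>H\<^esub> y"
  have q: "q \<in> carrier ?Q" using y by (auto simp: q_def mod_quot_simps[OF H B])
  have rq: "r \<odot>\<^bsub>?Q\<^esub> q = \<zero>\<^bsub>?Q\<^esub> \<longleftrightarrow> r \<odot>\<^bsub>H\<^esub> y \<in> B" if "r \<in> carrier R" for r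
    using that y by (simp add: q_def mod_quot_simps[OF H B])
  define J where "J = {r \<in> carrier R. r \<odot>\<^bsub>H\<^esub> y \<in> B}"
  have "ideal J R" unfolding J_def using ideal_colon[OF H B y(1)] .
  hence Jm: "J \<subseteq> \<mm>" using y by (intro proper_ideal_subset_maximal[OF R]) (auto simp: J_def)
  have \<alpha>: "(\<lambda>r. r \<odot>\<^bsub>?Q\<^esub> q) \<in> mod_hom R ?S ?Q"
    using q by (intro mod_homI) (auto simp: self_module_def Q.smult_l_distr Q.smult_assoc1)
  have u0: "(\<lambda>r. \<epsilon> (\<mm> +>\<^bsub>?S\<^esub> r)) \<in> mod_hom R ?S E"
    using mod_hom_compose[OF mod_quot_hom[OF S m] \<epsilon>(1)] .
  have \<epsilon>0: "\<epsilon> (\<mm> +>\<^bsub>?S\<^esub> r) = \<zero>\<^bsub>E\<^esub> \<longleftrightarrow> r \<in> \<mm>" if "r \<in> carrier R" for r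
  proof -
    have z: "\<epsilon> \<zero>\<^bsub>mod_quot ?S \<mm>\<^esub> = \<zero>\<^bsub>E\<^esub>" using mod_hom_zero[OF module_mod_quot[OF S m] mE \<epsilon>(1)] .
    have c: "\<mm> +>\<^bsub>?S\<^esub> r \<in> carrier (mod_quot ?S \<mm>)" "\<zero>\<^bsub>mod_quot ?S \<mm>\<^esub> \<in> carrier (mod_quot ?S \<mm>)"
      using that mod_hom_closed[OF mod_quot_hom[OF S m]] carS
        abelian_monoid.zero_closed[OF abelian_group.axioms(1)[OF module.axioms(2)[OF module_mod_quot[OF S m]]]] by auto
    have "\<epsilon> (\<mm> +>\<^bsub>?S\<^esub> r) = \<epsilon> \<zero>\<^bsub>mod_quot ?S \<mm>\<^esub> \<longleftrightarrow> \<mm> +>\<^bsub>?S\<^esub> r = \<zero>\<^bsub>mod_quot ?S \<mm>\<^esub>"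
      using inj_on_eq_iff[OF \<epsilon>(2) c] .
    thus ?thesis using z mod_quot_simps(2,5)[OF S m] that carS by simp
  qed
  obtain v where v: "v \<in> mod_hom R ?Q E" "\<And>r. r \<in> carrier R \<Longrightarrow> v (r \<odot>\<^bsub>?Q\<^esub> q) = \<epsilon> (\<mm> +>\<^bsub>?S\<^esub> r)"
  proof -
    have "\<epsilon> (\<mm> +>\<^bsub>?S\<^esub> r) = \<zero>\<^bsub>E\<^esub>" if "r \<in> carrier ?S" "r \<odot>\<^bsub>?Q\<^esub> q = \<zero>\<^bsub>?Q\<^esub>" for r
      using that \<epsilon>0 rq Jm carS by (auto simp: J_def)
    from baer_injective_factor[OF E' S Q \<alpha> u0 this] show ?thesis using that carS by auto
  qed
  define u where "u h = v (B +>\<^bsub>H\<^esub> h)" for h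
  have u: "u \<in> mod_hom R H E" unfolding u_def using mod_hom_compose[OF mod_quot_hom[OF H B] v(1)] .
  moreover have "u b = \<zero>\<^bsub>E\<^esub>" if "b \<in> B" for b
  proof -
    have "b \<in> carrier H" using that submodule_subset[OF B] by blast
    hence "B +>\<^bsub>H\<^esub> b = \<zero>\<^bsub>?Q\<^esub>" using mod_quot_simps(2,5)[OF H B] that by simp
    thus ?thesis using mod_hom_zero[OF Q mE v(1)] by (simp add: u_def)
  qed
  moreover have "u y \<noteq> \<zero>\<^bsub>E\<^esub>"
  proof -
    have "u y = \<epsilon> (\<mm> +>\<^bsub>?S\<^esub> \<one>\<^bsub>R\<^esub>)" using v(2)[of "\<one>\<^bsub>R\<^esub>"] q by (simp add: u_def q_def)
    moreover have "\<one>\<^bsub>R\<^esub> \<notin> \<mm>"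
      using maximalideal.I_notcarr[OF max] ideal.one_imp_carrier[OF maximalideal.axioms(1)[OF max]] by blast
    ultimately show ?thesis using \<epsilon>0 by simp
  qed
  ultimately show ?thesis by blast
qed

text \<open>The colon module \<open>0 : S\<close> in \<open>H\<close>; its dual is the dual of
  \<open>H\<close> modulo \<open>S\<close>.\<close>

definition annihilated ::
  "('r, 'h, 'l) module_scheme \<Rightarrow> 'r set \<Rightarrow> 'h set" where
  "annihilated H S = {h \<in> carrier H. \<forall>s\<in>S. s \<odot>\<^bsub>H\<^esub> h = \<zero>\<^bsub>H\<^esub>}"

lemma submodule_annihilated:
  assumes "module R H" "S \<subseteq> carrier R"
  shows "submodule (annihilated H S) R H"
proof -
  interpret H: module R H by fact
  have "s \<odot>\<^bsub>H\<^esub> (r \<odot>\<^bsub>H\<^esub> h) = \<zero>\<^bsub>H\<^esub>" if "s \<in> S" "r \<in> carrier R" "h \<in> annihilated H S" for r s h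
  proof -
    have "s \<odot>\<^bsub>H\<^esub> (r \<odot>\<^bsub>H\<^esub> h) = r \<odot>\<^bsub>H\<^esub> (s \<odot>\<^bsub>H\<^esub> h)"
      using that assms(2) by (intro module_smult_commute[OF assms(1)]) (auto simp: annihilated_def)
    thus ?thesis using that by (simp add: annihilated_def)
  qed
  thus ?thesis
    using assms(2) by (intro submodule_if_closed[OF assms(1)])
      (auto simp: annihilated_def subset_iff H.smult_r_distr)
qed

text \<open>This is exactness of \<open>Hom(-, E)\<close>, proved one generator at a time: a
  functional that vanishes on the part killed by \<open>x\<close> and \<open>S\<close> is corrected
  by an \<open>x\<close>-multiple until it vanishes on the larger part killed by \<open>S\<close>
  alone.\<close>

lemma dual_mult_submodule_iff:
  assumes E: "baer_injective R E" and H: "module R H" and S: "finite S" "S \<subseteq> carrier R"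
    and g: "g \<in> carrier (Hom_module R H E)"
  shows "g \<in> mult_submodule R (Hom_module R H E) S \<longleftrightarrow> (\<forall>h\<in>annihilated H S. g h = \<zero>\<^bsub>E\<^esub>)"
proof -
  interpret H: module R H by fact
  interpret E: module R E using baer_injective_module[OF E] .
  let ?D = "Hom_module R H E"
  have D: "module R ?D" using module_Hom_module[OF H E.module_axioms] .
  interpret D: module R ?D by fact
  have DD: "f \<in> mod_hom R H E" if "f \<in> carrier ?D" for f using that by simp
  have vanish: "\<forall>h\<in>annihilated H S. g h = \<zero>\<^bsub>E\<^esub>" if "g \<in> mult_submodule R ?D S"
  proof -
    let ?V = "{f \<in> carrier ?D. \<forall>h\<in>annihilated H S. f h = \<zero>\<^bsub>E\<^esub>}"
    have anc: "h \<in> carrier H" if "h \<in> annihilated H S" for h using that by (simp add: annihilated_def)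
    have "submodule ?V R ?D"
    proof (rule submodule_if_closed[OF D])
      show "?V \<subseteq> carrier ?D" by blast
      show "\<zero>\<^bsub>?D\<^esub> \<in> ?V" using D.M.zero_closed anc by auto
    next
      fix a b assume "a \<in> ?V" "b \<in> ?V"
      moreover from this have "a \<oplus>\<^bsub>?D\<^esub> b \<in> carrier ?D" by (intro D.M.a_closed) auto
      ultimately show "a \<oplus>\<^bsub>?D\<^esub> b \<in> ?V" using anc by auto
    next
      fix r a assume r: "r \<in> carrier R" "a \<in> ?V"
      moreover from this have "r \<odot>\<^bsub>?D\<^esub> a \<in> carrier ?D" by (intro D.smult_closed) auto
      ultimately show "r \<odot>\<^bsub>?D\<^esub> a \<in> ?V" using anc by auto
    qed
    moreover have "s \<odot>\<^bsub>?D\<^esub> f \<in> ?V" if "s \<in> S" "f \<in> carrier ?D" for s f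
    proof -
      have s: "s \<in> carrier R" using that S by blast
      have "s \<odot>\<^bsub>E\<^esub> f h = \<zero>\<^bsub>E\<^esub>" if h: "h \<in> annihilated H S" for h
        using mod_hom_smult[OF DD[OF \<open>f \<in> carrier ?D\<close>] s anc[OF h]]
          mod_hom_zero[OF H E.module_axioms DD[OF \<open>f \<in> carrier ?D\<close>]] h \<open>s \<in> S\<close>
        by (simp add: annihilated_def)
      thus ?thesis using D.smult_closed[OF s that(2)] anc by simp
    qed
    ultimately have "mult_submodule R ?D S \<subseteq> ?V" by (rule mult_submodule_least)
    thus ?thesis using that by blast
  qed
  have "g \<in> mult_submodule R ?D S" if "\<forall>h\<in>annihilated H S. g h = \<zero>\<^bsub>E\<^esub>"
    using S g that
  proof (induction S arbitrary: g rule: finite_induct)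
    case empty
    hence "g = \<zero>\<^bsub>?D\<^esub>" by (auto simp: annihilated_def intro: extensionalityI)
    thus ?case using mult_submodule_empty[OF D] by blast
  next
    case (insert x S)
    have x: "x \<in> carrier R" and S: "S \<subseteq> carrier R" using insert.prems by auto
    note A = submodule_annihilated[OF H S]
    let ?A = "H\<lparr>carrier := annihilated H S\<rparr>"
    have gh: "g \<in> mod_hom R H E" using insert.prems(2) by simp
    have Asub: "annihilated H S \<subseteq> carrier H" using submodule_subset[OF A] .
    have u: "g \<in> mod_hom R ?A E" using mod_hom_restrict_carrier[OF gh Asub] .
    have al: "(\<lambda>a. x \<odot>\<^bsub>H\<^esub> a) \<in> mod_hom R ?A H"
      using mod_hom_restrict_carrier[OF mod_hom_smult_const[OF H x] Asub] .
    \<comment> \<open>An element killed by \<open>S\<close> and by \<open>x\<close> is killed by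
      \<open>insert x S\<close>. So on the part killed by \<open>S\<close>, the functional
      \<open>g\<close> factors through multiplication by \<open>x\<close>, and the factor extends to
      a functional \<open>v\<close> on \<open>H\<close>.\<close>
    have "g a = \<zero>\<^bsub>E\<^esub>" if "a \<in> carrier ?A" "x \<odot>\<^bsub>H\<^esub> a = \<zero>\<^bsub>H\<^esub>" for a
      using that insert.prems(3) by (simp add: annihilated_def)
    from baer_injective_factor[OF E module_restrict_carrier[OF H A] H al u this]
    obtain v where v: "v \<in> mod_hom R H E" "\<And>a. a \<in> annihilated H S \<Longrightarrow> v (x \<odot>\<^bsub>H\<^esub> a) = g a" by auto
    define w where "w = restrict v (carrier H)"
    have w: "w \<in> carrier ?D" using mod_hom_restrict[OF H v(1)] by (simp add: w_def)
    have xw: "x \<odot>\<^bsub>?D\<^esub> w \<in> carrier ?D" using D.smult_closed[OF x w] .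
    have gw: "g \<ominus>\<^bsub>?D\<^esub> x \<odot>\<^bsub>?D\<^esub> w \<in> carrier ?D" using D.M.minus_closed[OF insert.prems(2) xw] .
    have "(g \<ominus>\<^bsub>?D\<^esub> x \<odot>\<^bsub>?D\<^esub> w) h = \<zero>\<^bsub>E\<^esub>" if h: "h \<in> annihilated H S" for h
    proof -
      have hc: "h \<in> carrier H" using h Asub by blast
      \<comment> \<open>Subtraction in \<open>?D\<close> is defined through an abstract inverse, so
        its value at \<open>h\<close> is read off from \<open>t + x w = g\<close>.\<close>
      define t where "t = g \<ominus>\<^bsub>?D\<^esub> x \<odot>\<^bsub>?D\<^esub> w"
      have tc: "t h \<in> carrier E" unfolding t_def using mod_hom_closed[OF DD[OF gw] hc] .
      have "t \<oplus>\<^bsub>?D\<^esub> x \<odot>\<^bsub>?D\<^esub> w = g"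
        unfolding t_def using D.M.minus_add_cancel_right[OF insert.prems(2) xw] .
      hence "(t \<oplus>\<^bsub>?D\<^esub> x \<odot>\<^bsub>?D\<^esub> w) h = g h" by (rule arg_cong)
      moreover have "(t \<oplus>\<^bsub>?D\<^esub> x \<odot>\<^bsub>?D\<^esub> w) h = t h \<oplus>\<^bsub>E\<^esub> g h"
        using hc v(2)[OF h] mod_hom_smult[OF v(1) x hc] by (simp add: w_def)
      ultimately have "t h \<oplus>\<^bsub>E\<^esub> g h = g h" by simp
      hence "t h = \<zero>\<^bsub>E\<^esub>"
        using E.M.add.r_cancel_one[OF mod_hom_closed[OF gh hc] tc] by simp
      thus ?thesis by (simp only: t_def)
    qed
    hence "g \<ominus>\<^bsub>?D\<^esub> x \<odot>\<^bsub>?D\<^esub> w \<in> mult_submodule R ?D S" using insert.IH[OF S gw] by blast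
    thus ?case using mult_submodule_insert[OF D S x insert.prems(2)] w by blast
  qed
  thus ?thesis using vanish by blast
qed

text \<open>Let \<open>K\<close> be the part killed by \<open>S\<close>. If \<open>h\<close> were
  outside \<open>x K\<close>, a functional \<open>u\<close> would vanish on \<open>x K\<close> but
  not at \<open>h\<close>. Then \<open>x u\<close> vanishes on \<open>K\<close> and so lies in
  \<open>S\<close> times the dual; by regularity \<open>u\<close> does as well, hence it vanishes on
  \<open>K\<close> and at \<open>h\<close>.\<close>

theorem dual_regular_imp_coregular:
  assumes R: "noetherian_ring R" "local_ring R \<mm>"
    and hull: "injective_hull R (mod_quot (self_module R) \<mm>) E"
    and H: "module R H" and S: "finite S" "S \<subseteq> carrier R" and x: "x \<in> carrier R"
    and reg: "nonzerodivisor_on (mod_quot_mult R (matlis_dual R E H) S) x"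
    and h: "h \<in> annihilated H S"
  shows "\<exists>h'\<in>annihilated H S. x \<odot>\<^bsub>H\<^esub> h' = h"
proof (rule ccontr)
  assume neg: "\<not> ?thesis"
  have E: "baer_injective R E"
    using hull injective_module_imp_baer_injective by (auto simp: injective_hull_def)
  interpret H: module R H by fact
  interpret E: module R E using baer_injective_module[OF E] .
  let ?D = "Hom_module R H E" and ?A = "annihilated H S"
  have D: "module R ?D" using module_Hom_module[OF H E.module_axioms] .
  interpret D: module R ?D by fact
  note A = submodule_annihilated[OF H S(2)]
  have Asub: "?A \<subseteq> carrier H" using submodule_subset[OF A] .
  define B where "B = (\<lambda>a. x \<odot>\<^bsub>H\<^esub> a) ` ?A"
  have B: "submodule B R H"
    unfolding B_def using submodule_mod_hom_image[OF H H mod_hom_smult_const[OF H x] A] .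
  have "h \<notin> B" using neg by (auto simp: B_def)
  then obtain u where u: "u \<in> mod_hom R H E" "\<And>b. b \<in> B \<Longrightarrow> u b = \<zero>\<^bsub>E\<^esub>" "u h \<noteq> \<zero>\<^bsub>E\<^esub>"
    using residue_hull_cogenerator[OF R hull H B] h Asub by blast
  define w where "w = restrict u (carrier H)"
  have w: "w \<in> carrier ?D" using mod_hom_restrict[OF H u(1)] by (simp add: w_def)
  have xw: "x \<odot>\<^bsub>?D\<^esub> w \<in> carrier ?D" using D.smult_closed[OF x w] .
  have "(x \<odot>\<^bsub>?D\<^esub> w) a = \<zero>\<^bsub>E\<^esub>" if "a \<in> ?A" for a
  proof -
    have ac: "a \<in> carrier H" using that Asub by blast
    have "x \<odot>\<^bsub>H\<^esub> a \<in> B" using that by (simp add: B_def)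
    hence "u (x \<odot>\<^bsub>H\<^esub> a) = \<zero>\<^bsub>E\<^esub>" by (rule u(2))
    thus ?thesis using ac mod_hom_smult[OF u(1) x ac] by (simp add: w_def)
  qed
  hence "x \<odot>\<^bsub>?D\<^esub> w \<in> mult_submodule R ?D S" using dual_mult_submodule_iff[OF E H S xw] by blast
  hence "w \<in> mult_submodule R ?D S"
    using reg w nonzerodivisor_on_mod_quot_iff[OF D submodule_mult_submodule[OF D S(2)] x]
    unfolding matlis_dual_def mod_quot_mult_eq by blast
  hence "w h = \<zero>\<^bsub>E\<^esub>" using dual_mult_submodule_iff[OF E H S w] h by blast
  thus False using u(3) h Asub by (auto simp: w_def)
qed

section \<open>Enough injective modules\<close>

lemma baer_injective_map_module:
  assumes "baer_injective R I" "inj_on j (carrier I)"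
  shows "baer_injective R (map_module j I)"
  unfolding baer_injective_def
proof (intro conjI allI impI)
  have I: "module R I" using baer_injective_module[OF assms(1)] .
  show "module R (map_module j I)" using module_map_module[OF I assms(2)] .
  fix J f assume J: "ideal J R" and f: "f \<in> mod_hom R ((self_module R)\<lparr>carrier := J\<rparr>) (map_module j I)"
  obtain e where e: "e \<in> carrier I" "\<And>r. r \<in> J \<Longrightarrow> inv_into (carrier I) j (f r) = r \<odot>\<^bsub>I\<^esub> e"
    using assms(1) J mod_hom_compose[OF f map_module_hom(2)[OF I assms(2)]]
    unfolding baer_injective_def by blast
  have "f r = r \<odot>\<^bsub>map_module j I\<^esub> j e" if "r \<in> J" for r
  proof -
    have "f r \<in> j ` carrier I" using mod_hom_closed[OF f] that by (simp add: map_module_simps[OF assms(2)])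
    hence "f r = j (inv_into (carrier I) j (f r))" by (simp add: f_inv_into_f)
    thus ?thesis using e that by (simp add: map_module_simps[OF assms(2)])
  qed
  thus "\<exists>e\<in>carrier (map_module j I). \<forall>r\<in>J. f r = r \<odot>\<^bsub>map_module j I\<^esub> e"
    using e by (auto simp: map_module_simps[OF assms(2)])
qed

subsection \<open>Divisible abelian groups\<close>

text \<open>An integer multiple of \<open>v\<close> is reached from zero by adding and subtracting
  \<open>v\<close>, so facts about integer scalars reduce to additive ones.\<close>

lemma int_module_smult_induct:
  assumes "module int_ring V" "v \<in> carrier V" "P \<zero>\<^bsub>V\<^esub>"
    and "\<And>w. w \<in> carrier V \<Longrightarrow> P w \<Longrightarrow> P (w \<oplus>\<^bsub>V\<^esub> v)" "\<And>w. w \<in> carrier V \<Longrightarrow> P w \<Longrightarrow> P (w \<ominus>\<^bsub>V\<^esub> v)"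
  shows "P (k \<odot>\<^bsub>V\<^esub> v)"
proof -
  interpret V: module int_ring V by fact
  have one: "1 \<odot>\<^bsub>V\<^esub> v = v" and z: "0 \<odot>\<^bsub>V\<^esub> v = \<zero>\<^bsub>V\<^esub>"
    using V.smult_one[OF assms(2)] V.smult_l_null[OF assms(2)] by simp_all
  have add: "(k + l) \<odot>\<^bsub>V\<^esub> v = k \<odot>\<^bsub>V\<^esub> v \<oplus>\<^bsub>V\<^esub> l \<odot>\<^bsub>V\<^esub> v" for k l :: int
    using V.smult_l_distr[of k l v] assms(2) by simp
  have cl: "k \<odot>\<^bsub>V\<^esub> v \<in> carrier V" for k using V.smult_closed[of k v] assms(2) by simp
  have "(-1 + 1) \<odot>\<^bsub>V\<^esub> v = (-1) \<odot>\<^bsub>V\<^esub> v \<oplus>\<^bsub>V\<^esub> 1 \<odot>\<^bsub>V\<^esub> v" by (rule add)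
  hence neg: "(-1) \<odot>\<^bsub>V\<^esub> v = \<ominus>\<^bsub>V\<^esub> v"
    using one z V.M.minus_equality[OF _ assms(2) cl] by simp
  show ?thesis
  proof (induction k rule: int_induct[of _ 0])
    case base
    show ?case using z assms(3) by simp
  next
    case (step1 i)
    thus ?case using assms(4)[OF cl] add[of i 1] one by simp
  next
    case (step2 i)
    thus ?case using assms(5)[OF cl] add[of i "-1"] neg by (simp add: a_minus_def)
  qed
qed

lemma additive_imp_int_mod_hom:
  assumes V: "module int_ring V" and W: "module int_ring W"
    and cl: "\<And>x. x \<in> carrier V \<Longrightarrow> f x \<in> carrier W"
    and add: "\<And>x y. x \<in> carrier V \<Longrightarrow> y \<in> carrier V \<Longrightarrow> f (x \<oplus>\<^bsub>V\<^esub> y) = f x \<oplus>\<^bsub>W\<^esub> f y"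
  shows "f \<in> mod_hom int_ring V W"
proof (rule mod_homI)
  interpret V: module int_ring V by fact
  interpret W: module int_ring W by fact
  have minus: "f (x \<ominus>\<^bsub>V\<^esub> y) = f x \<ominus>\<^bsub>W\<^esub> f y" if "x \<in> carrier V" "y \<in> carrier V" for x y
  proof -
    have "f x = f (x \<ominus>\<^bsub>V\<^esub> y) \<oplus>\<^bsub>W\<^esub> f y" using add[of "x \<ominus>\<^bsub>V\<^esub> y" y] that by simp
    moreover have "(f (x \<ominus>\<^bsub>V\<^esub> y) \<oplus>\<^bsub>W\<^esub> f y) \<ominus>\<^bsub>W\<^esub> f y = f (x \<ominus>\<^bsub>V\<^esub> y)"
      using cl that by (simp add: a_minus_def W.M.a_assoc W.M.r_neg)
    ultimately show ?thesis by simp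
  qed
  have zero: "f \<zero>\<^bsub>V\<^esub> = \<zero>\<^bsub>W\<^esub>" using minus[of "\<zero>\<^bsub>V\<^esub>" "\<zero>\<^bsub>V\<^esub>"] cl by simp
  fix k x assume x: "x \<in> carrier V"
  have P: "module int_ring (prod_module V W)" using module_prod_module[OF V W] .
  \<comment> \<open>The induction runs in the product module: starting at zero, adding or
    subtracting \<open>(x, f x)\<close> never leaves the graph of \<open>f\<close>.\<close>
  have "(\<lambda>p. f (fst p) = snd p) (k \<odot>\<^bsub>prod_module V W\<^esub> (x, f x))"
  proof (rule int_module_smult_induct[OF P])
    show "(x, f x) \<in> carrier (prod_module V W)" using x cl by simp
    show "f (fst \<zero>\<^bsub>prod_module V W\<^esub>) = snd \<zero>\<^bsub>prod_module V W\<^esub>" using zero by simp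
    fix w assume w: "w \<in> carrier (prod_module V W)" "f (fst w) = snd w"
    obtain a b where ab: "w = (a, b)" "a \<in> carrier V" "b \<in> carrier W" using w by auto
    show "f (fst (w \<oplus>\<^bsub>prod_module V W\<^esub> (x, f x))) = snd (w \<oplus>\<^bsub>prod_module V W\<^esub> (x, f x))"
      using w ab x add by simp
    show "f (fst (w \<ominus>\<^bsub>prod_module V W\<^esub> (x, f x))) = snd (w \<ominus>\<^bsub>prod_module V W\<^esub> (x, f x))"
      using w ab x cl minus by (simp add: prod_module_minus[OF V W])
  qed
  thus "f (k \<odot>\<^bsub>V\<^esub> x) = k \<odot>\<^bsub>W\<^esub> f x" by simp
qed (use cl add in auto)

text \<open>A nonzero ideal of the integers is generated by its least positive element
  \<open>n\<close>; dividing \<open>f n\<close> by \<open>n\<close> in \<open>D\<close> gives the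
  required element.\<close>

lemma divisible_imp_baer_injective:
  assumes D: "module int_ring D"
    and div: "\<And>k v. k > 0 \<Longrightarrow> v \<in> carrier D \<Longrightarrow> \<exists>w\<in>carrier D. k \<odot>\<^bsub>D\<^esub> w = v"
  shows "baer_injective int_ring D"
  unfolding baer_injective_def
proof (intro conjI allI impI)
  interpret D: module int_ring D by fact
  show "module int_ring D" by fact
  fix J f assume J: "ideal J int_ring" and f: "f \<in> mod_hom int_ring ((self_module int_ring)\<lparr>carrier := J\<rparr>) D"
  have S: "submodule J int_ring (self_module int_ring)" using submodule_ideal[OF int_is_cring J] .
  have sm: "k * r \<in> J" if "r \<in> J" for k r using submodule_smult[OF S _ that, of k] by (simp add: self_module_def)
  have ad: "r + q \<in> J" if "r \<in> J" "q \<in> J" for r q using submodule_add[OF S that] by (simp add: self_module_def)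
  have f_sm: "f (k * r) = k \<odot>\<^bsub>D\<^esub> f r" if "r \<in> J" for k r
    using mod_hom_smult[OF f, of k r] that by (simp add: self_module_def)
  have fc: "f r \<in> carrier D" if "r \<in> J" for r using mod_hom_closed[OF f] that by simp
  show "\<exists>e\<in>carrier D. \<forall>r\<in>J. f r = r \<odot>\<^bsub>D\<^esub> e"
  proof (cases "J \<subseteq> {0}")
    case True
    have "f r = r \<odot>\<^bsub>D\<^esub> \<zero>\<^bsub>D\<^esub>" if "r \<in> J" for r
    proof -
      have "f (0 * r) = 0 \<odot>\<^bsub>D\<^esub> f r" by (rule f_sm[OF that])
      moreover have "0 \<odot>\<^bsub>D\<^esub> f r = \<zero>\<^bsub>D\<^esub>" using D.smult_l_null[OF fc[OF that]] by simp
      moreover have "0 \<odot>\<^bsub>D\<^esub> \<zero>\<^bsub>D\<^esub> = \<zero>\<^bsub>D\<^esub>" using D.smult_l_null[OF D.M.zero_closed] by simp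
      ultimately show ?thesis using True that by auto
    qed
    thus ?thesis by blast
  next
    case False
    then obtain r0 where r0: "r0 \<in> J" "r0 \<noteq> 0" by blast
    hence "int (nat \<bar>r0\<bar>) \<in> J \<and> nat \<bar>r0\<bar> > 0" using sm[OF r0(1), of "-1"] by (auto simp: abs_if)
    hence "\<exists>n. int n \<in> J \<and> n > 0" by blast
    \<comment> \<open>Division with remainder shows that \<open>n\<close> generates
      \<open>J\<close>.\<close>
    define n where "n = (LEAST n. int n \<in> J \<and> n > 0)"
    have n: "int n \<in> J" "n > 0" using LeastI_ex[OF \<open>\<exists>n. int n \<in> J \<and> n > 0\<close>] by (auto simp: n_def)
    have dvd: "r = (r div int n) * int n" if "r \<in> J" for r
    proof -
      have "r + (- (r div int n)) * int n \<in> J" using ad[OF that sm[OF n(1)]] .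
      moreover have "r + (- (r div int n)) * int n = r mod int n" by (simp add: minus_div_mult_eq_mod)
      ultimately have "r mod int n \<in> J" by simp
      moreover have "0 \<le> r mod int n" "r mod int n < int n" using n(2) by auto
      ultimately have "\<not> nat (r mod int n) > 0"
        using not_less_Least[of "nat (r mod int n)" "\<lambda>n. int n \<in> J \<and> n > 0"] unfolding n_def[symmetric] by auto
      hence "r mod int n = 0" using \<open>0 \<le> r mod int n\<close> by simp
      thus ?thesis by (metis add.right_neutral div_mult_mod_eq)
    qed
    obtain e where e: "e \<in> carrier D" "int n \<odot>\<^bsub>D\<^esub> e = f (int n)" using div[OF _ fc[OF n(1)], of "int n"] n(2) by auto
    have "f r = r \<odot>\<^bsub>D\<^esub> e" if "r \<in> J" for r
    proof -
      have "f r = f ((r div int n) * int n)" using dvd[OF that] by simp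
      also have "\<dots> = (r div int n) \<odot>\<^bsub>D\<^esub> (int n \<odot>\<^bsub>D\<^esub> e)" using f_sm[OF n(1)] e by simp
      also have "\<dots> = ((r div int n) * int n) \<odot>\<^bsub>D\<^esub> e"
        using D.smult_assoc1[of "r div int n" "int n" e] e by simp
      finally show ?thesis using dvd[OF that] by simp
    qed
    thus ?thesis using e by blast
  qed
qed

definition scale_frag :: "rat \<Rightarrow> ('u \<Rightarrow>\<^sub>0 rat) \<Rightarrow> ('u \<Rightarrow>\<^sub>0 rat)" where
  "scale_frag c v = Poly_Mapping.map ((*) c) v"

lemma lookup_scale_frag: "Poly_Mapping.lookup (scale_frag c v) x = c * Poly_Mapping.lookup v x"
  by (simp add: scale_frag_def Poly_Mapping.map.rep_eq when_def)

definition frag_of_int :: "('u \<Rightarrow>\<^sub>0 int) \<Rightarrow> ('u \<Rightarrow>\<^sub>0 rat)" where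
  "frag_of_int v = Poly_Mapping.map of_int v"

lemma lookup_frag_of_int: "Poly_Mapping.lookup (frag_of_int v) x = of_int (Poly_Mapping.lookup v x)"
  by (simp add: frag_of_int_def Poly_Mapping.map.rep_eq when_def)

text \<open>The rational vector space with basis \<open>'u\<close>, regarded as an abelian group;
  all its quotients are divisible.\<close>

definition rat_frag_module :: "(int, 'u \<Rightarrow>\<^sub>0 rat) module" where
  "rat_frag_module =
     \<lparr>carrier = UNIV, monoid.mult = undefined, one = undefined, ring.zero = 0, ring.add = (+),
      module.smult = (\<lambda>k. scale_frag (of_int k))\<rparr>"

lemma module_rat_frag_module: "module int_ring (rat_frag_module :: (int, 'u \<Rightarrow>\<^sub>0 rat) module)"
proof (intro moduleI abelian_groupI)
  show "cring int_ring" by (rule int_is_cring)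
  fix v :: "'u \<Rightarrow>\<^sub>0 rat"
  show "\<exists>w\<in>carrier rat_frag_module. w \<oplus>\<^bsub>rat_frag_module\<^esub> v = \<zero>\<^bsub>rat_frag_module\<^esub>"
    by (intro bexI[of _ "- v"]) (auto simp: rat_frag_module_def)
qed (auto simp: rat_frag_module_def lookup_scale_frag lookup_add algebra_simps intro!: poly_mapping_eqI)

text \<open>The group \<open>N\<close> is the free abelian group on its own elements modulo the
  kernel of the evaluation \<open>h\<close>. The same kernel \<open>K\<close>, viewed with rational
  coefficients, gives a quotient of a rational vector space that contains \<open>N\<close>.\<close>

lemma abelian_group_embeds_divisible:
  fixes N :: "('r, 'u, 'l) module_scheme"
  assumes N: "module R N"
  shows "\<exists>(K :: ('u \<Rightarrow>\<^sub>0 rat) set) \<iota>. submodule K int_ring rat_frag_module \<and>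
     (\<forall>x\<in>carrier N. \<iota> x \<in> carrier (mod_quot rat_frag_module K)) \<and> inj_on \<iota> (carrier N) \<and>
     (\<forall>x\<in>carrier N. \<forall>y\<in>carrier N. \<iota> (x \<oplus>\<^bsub>N\<^esub> y) = \<iota> x \<oplus>\<^bsub>mod_quot rat_frag_module K\<^esub> \<iota> y)"
proof -
  interpret N: module R N by fact
  let ?F = "free_Abelian_group (carrier N)"
  let ?V = "rat_frag_module :: (int, 'u \<Rightarrow>\<^sub>0 rat) module"
  obtain h where h: "h \<in> hom ?F (add_monoid N)" "\<And>x. x \<in> carrier N \<Longrightarrow> h (frag_of x) = x"
    using comm_group.free_Abelian_group_universal[OF N.a_comm_group, of id "carrier N"] by auto
  interpret h: group_hom ?F "add_monoid N" h
    using h(1) by (simp add: group_hom_def group_hom_axioms_def)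
  have h_add: "h (v + w) = h v \<oplus>\<^bsub>N\<^esub> h w"
    if "Poly_Mapping.keys v \<subseteq> carrier N" "Poly_Mapping.keys w \<subseteq> carrier N" for v w
    using h.hom_mult[of v w] that by simp
  have hc: "h v \<in> carrier N" if "Poly_Mapping.keys v \<subseteq> carrier N" for v using h.hom_closed[of v] that by simp
  have h_neg: "h (- v) = \<ominus>\<^bsub>N\<^esub> h v" if "Poly_Mapping.keys v \<subseteq> carrier N" for v
    using h.hom_inv[of v] that by (simp add: a_inv_def)
  define K where "K = frag_of_int ` {v. Poly_Mapping.keys v \<subseteq> carrier N \<and> h v = \<zero>\<^bsub>N\<^esub>}"
  have KI: "frag_of_int v \<in> K" if "Poly_Mapping.keys v \<subseteq> carrier N" "h v = \<zero>\<^bsub>N\<^esub>" for v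
    using that by (auto simp: K_def)
  have foi_add: "frag_of_int (v + w) = frag_of_int v + frag_of_int w" for v w :: "'u \<Rightarrow>\<^sub>0 int"
    by (rule poly_mapping_eqI) (simp add: lookup_frag_of_int lookup_add)
  have foi_neg: "frag_of_int (- v) = - frag_of_int v" for v :: "'u \<Rightarrow>\<^sub>0 int"
    by (rule poly_mapping_eqI) (simp add: lookup_frag_of_int)
  have foi_0: "frag_of_int 0 = (0 :: 'u \<Rightarrow>\<^sub>0 rat)" by (rule poly_mapping_eqI) (simp add: lookup_frag_of_int)
  have V: "module int_ring ?V" by (rule module_rat_frag_module)
  interpret V: module int_ring ?V by (rule V)
  have V_minus: "v \<ominus>\<^bsub>?V\<^esub> w = v - w" for v w
  proof -
    have "\<ominus>\<^bsub>?V\<^esub> w = - w" by (rule V.M.minus_equality) (auto simp: rat_frag_module_def)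
    thus ?thesis by (simp add: a_minus_def) (simp add: rat_frag_module_def)
  qed
  have K0: "0 \<in> K" using KI[of 0] h.hom_one by (simp add: foi_0)
  have Kadd: "v + w \<in> K" if "v \<in> K" "w \<in> K" for v w
  proof -
    obtain v' w' where "Poly_Mapping.keys v' \<subseteq> carrier N" "h v' = \<zero>\<^bsub>N\<^esub>" "v = frag_of_int v'"
      "Poly_Mapping.keys w' \<subseteq> carrier N" "h w' = \<zero>\<^bsub>N\<^esub>" "w = frag_of_int w'" using \<open>v \<in> K\<close> \<open>w \<in> K\<close> by (auto simp: K_def)
    thus ?thesis using KI[of "v' + w'"] keys_add[of v' w'] by (auto simp: foi_add h_add)
  qed
  have Kneg: "- v \<in> K" if "v \<in> K" for v
  proof -
    obtain v' where "Poly_Mapping.keys v' \<subseteq> carrier N" "h v' = \<zero>\<^bsub>N\<^esub>" "v = frag_of_int v'"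
      using \<open>v \<in> K\<close> by (auto simp: K_def)
    thus ?thesis using KI[of "- v'"] by (simp add: foi_neg h_neg)
  qed
  have K: "submodule K int_ring ?V"
  proof (rule submodule_if_closed[OF V])
    fix k :: int and v assume v: "v \<in> K"
    show "k \<odot>\<^bsub>?V\<^esub> v \<in> K"
    proof (rule int_module_smult_induct[OF V, of _ "\<lambda>w. w \<in> K"])
      fix w assume w: "w \<in> K"
      show "w \<oplus>\<^bsub>?V\<^esub> v \<in> K" using Kadd[OF w v] by (simp add: rat_frag_module_def)
      show "w \<ominus>\<^bsub>?V\<^esub> v \<in> K" using Kadd[OF w Kneg[OF v]] by (simp add: V_minus)
    qed (use K0 in \<open>auto simp: rat_frag_module_def\<close>)
  qed (use K0 Kadd in \<open>auto simp: rat_frag_module_def\<close>)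
  define \<iota> where "\<iota> x = K +>\<^bsub>?V\<^esub> frag_of_int (frag_of x)" for x
  have Vc: "v \<in> carrier ?V" for v by (simp add: rat_frag_module_def)
  have foi_inj: "v = w" if "frag_of_int v = frag_of_int w" for v w :: "'u \<Rightarrow>\<^sub>0 int"
    using that by (metis lookup_frag_of_int of_int_eq_iff poly_mapping_eqI)
  have inj: "inj_on \<iota> (carrier N)"
  proof (rule inj_onI)
    fix x y assume xy: "x \<in> carrier N" "y \<in> carrier N" "\<iota> x = \<iota> y"
    hence "frag_of_int (frag_of x) - frag_of_int (frag_of y) \<in> K"
      using coset_eq_iff[OF V K Vc Vc] by (simp add: \<iota>_def V_minus)
    hence "frag_of_int (frag_of x - frag_of y) \<in> K"
      using foi_add[of "frag_of x" "- frag_of y"] by (simp add: foi_neg)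
    then obtain v where v: "h v = \<zero>\<^bsub>N\<^esub>" "frag_of_int (frag_of x - frag_of y) = frag_of_int v"
      by (auto simp: K_def)
    hence "h (frag_of x + - frag_of y) = \<zero>\<^bsub>N\<^esub>" using foi_inj by fastforce
    moreover have "h (frag_of x + - frag_of y) = x \<oplus>\<^bsub>N\<^esub> \<ominus>\<^bsub>N\<^esub> y"
      using xy by (subst h_add) (auto simp: h_neg h(2) split: if_splits)
    ultimately have "x \<ominus>\<^bsub>N\<^esub> y = \<zero>\<^bsub>N\<^esub>" by (simp add: a_minus_def)
    thus "x = y" using xy by simp
  qed
  have "\<iota> (x \<oplus>\<^bsub>N\<^esub> y) = \<iota> x \<oplus>\<^bsub>mod_quot ?V K\<^esub> \<iota> y" if xy: "x \<in> carrier N" "y \<in> carrier N" for x y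
  proof -
    define u w where "u = frag_of (x \<oplus>\<^bsub>N\<^esub> y)" and "w = frag_of x + frag_of y"
    have ku: "Poly_Mapping.keys u \<subseteq> carrier N" using xy by (simp add: u_def)
    have kw: "Poly_Mapping.keys w \<subseteq> carrier N"
      using keys_add[of "frag_of x" "frag_of y"] xy by (auto simp: w_def)
    have "h w = x \<oplus>\<^bsub>N\<^esub> y" using xy by (simp add: w_def h_add h(2))
    moreover have "h u = x \<oplus>\<^bsub>N\<^esub> y" using xy by (simp add: u_def h(2))
    ultimately have "h (u + - w) = \<zero>\<^bsub>N\<^esub>"
      using xy ku kw by (subst h_add) (simp_all add: h_neg N.M.r_neg)
    moreover have "Poly_Mapping.keys (u + - w) \<subseteq> carrier N"
      using keys_add[of u "- w"] ku kw by auto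
    ultimately have "frag_of_int (u + - w) \<in> K" using KI by blast
    hence "frag_of_int u - frag_of_int w \<in> K" unfolding foi_add foi_neg by simp
    hence "frag_of_int (frag_of (x \<oplus>\<^bsub>N\<^esub> y)) - (frag_of_int (frag_of x) + frag_of_int (frag_of y)) \<in> K"
      by (simp add: u_def w_def foi_add)
    hence "\<iota> (x \<oplus>\<^bsub>N\<^esub> y) = K +>\<^bsub>?V\<^esub> (frag_of_int (frag_of x) \<oplus>\<^bsub>?V\<^esub> frag_of_int (frag_of y))"
      using coset_eq_iff[OF V K Vc Vc] unfolding \<iota>_def V_minus by (simp add: rat_frag_module_def)
    thus ?thesis using mod_quot_simps(3)[OF V K Vc Vc] by (simp add: \<iota>_def)
  qed
  moreover have "\<iota> x \<in> carrier (mod_quot ?V K)" for x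
    using Vc by (auto simp: \<iota>_def mod_quot_simps(1)[OF V K])
  ultimately show ?thesis using K inj by blast
qed

lemma rat_frag_quotient_baer_injective:
  assumes K: "submodule K int_ring rat_frag_module"
  shows "baer_injective int_ring (mod_quot rat_frag_module K)"
proof (rule divisible_imp_baer_injective)
  note V = module_rat_frag_module
  show "module int_ring (mod_quot rat_frag_module K)" using module_mod_quot[OF V K] .
  fix k :: int and A assume k: "k > 0" and "A \<in> carrier (mod_quot rat_frag_module K)"
  then obtain v where v: "A = K +>\<^bsub>rat_frag_module\<^esub> v" by (auto simp: mod_quot_simps(1)[OF V K])
  have Vc: "v \<in> carrier rat_frag_module" for v by (simp add: rat_frag_module_def)
  have "k \<odot>\<^bsub>rat_frag_module\<^esub> scale_frag (1 / of_int k) v = v"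
    using k by (intro poly_mapping_eqI) (simp add: rat_frag_module_def lookup_scale_frag)
  thus "\<exists>w\<in>carrier (mod_quot rat_frag_module K). k \<odot>\<^bsub>mod_quot rat_frag_module K\<^esub> w = A"
    using v mod_quot_simps(4)[OF V K _ Vc, of k "scale_frag (1 / of_int k) v"] Vc
    by (intro bexI[of _ "K +>\<^bsub>rat_frag_module\<^esub> scale_frag (1 / of_int k) v"])
      (auto simp: mod_quot_simps(1)[OF V K])
qed

subsection \<open>Coinduced modules\<close>

definition additive_module :: "('r, 'k) ring_scheme \<Rightarrow> (int, 'r) module" where
  "additive_module R =
     \<lparr>carrier = carrier R, monoid.mult = undefined, one = undefined, ring.zero = \<zero>\<^bsub>R\<^esub>,
      ring.add = ring.add R, module.smult = (\<lambda>k r. pow (add_monoid R) r k)\<rparr>"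

lemma additive_module_simps [simp]:
  "carrier (additive_module R) = carrier R" "\<zero>\<^bsub>additive_module R\<^esub> = \<zero>\<^bsub>R\<^esub>"
  "r \<oplus>\<^bsub>additive_module R\<^esub> s = r \<oplus>\<^bsub>R\<^esub> s"
  by (simp_all add: additive_module_def)

lemma module_additive_module:
  assumes "abelian_group R"
  shows "module int_ring (additive_module R)"
proof -
  interpret abelian_group R by fact
  show ?thesis
  proof (intro moduleI abelian_groupI)
    show "cring int_ring" by (rule int_is_cring)
    fix r assume "r \<in> carrier (additive_module R)"
    thus "\<exists>s\<in>carrier (additive_module R). s \<oplus>\<^bsub>additive_module R\<^esub> r = \<zero>\<^bsub>additive_module R\<^esub>"
      by (intro bexI[of _ "\<ominus>\<^bsub>R\<^esub> r"]) (auto simp: l_neg)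
  next
    fix k l :: int and r assume r: "r \<in> carrier (additive_module R)"
    show "(k \<oplus>\<^bsub>int_ring\<^esub> l) \<odot>\<^bsub>additive_module R\<^esub> r =
      k \<odot>\<^bsub>additive_module R\<^esub> r \<oplus>\<^bsub>additive_module R\<^esub> l \<odot>\<^bsub>additive_module R\<^esub> r"
      using group.int_pow_mult[OF a_group, of r k l] r by (simp add: additive_module_def)
    show "(k \<otimes>\<^bsub>int_ring\<^esub> l) \<odot>\<^bsub>additive_module R\<^esub> r = k \<odot>\<^bsub>additive_module R\<^esub> (l \<odot>\<^bsub>additive_module R\<^esub> r)"
      using group.int_pow_pow[OF a_group, of r l k] r by (simp add: additive_module_def mult.commute)
  next
    fix k :: int and r s assume "r \<in> carrier (additive_module R)" "s \<in> carrier (additive_module R)"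
    thus "k \<odot>\<^bsub>additive_module R\<^esub> (r \<oplus>\<^bsub>additive_module R\<^esub> s) =
      k \<odot>\<^bsub>additive_module R\<^esub> r \<oplus>\<^bsub>additive_module R\<^esub> k \<odot>\<^bsub>additive_module R\<^esub> s"
      using comm_group.int_pow_distrib[OF a_comm_group, of r s k] by (simp add: additive_module_def)
  next
    fix k :: int and r assume "r \<in> carrier (additive_module R)"
    thus "k \<odot>\<^bsub>additive_module R\<^esub> r \<in> carrier (additive_module R)" "\<one>\<^bsub>int_ring\<^esub> \<odot>\<^bsub>additive_module R\<^esub> r = r"
      using group.int_pow_closed[OF a_group, of r k] group.int_pow_1[OF a_group, of r] by (simp_all add: additive_module_def)
  qed (auto simp: a_ac)
qed

text \<open>The additive maps from \<open>R\<close> to \<open>D\<close>, where scalars act on the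
  argument: the right adjoint of forgetting the \<open>R\<close>-module structure.\<close>

definition coinduced_module ::
  "('r, 'k) ring_scheme \<Rightarrow> (int, 'd) module \<Rightarrow> ('r, 'r \<Rightarrow> 'd) module" where
  "coinduced_module R D =
     \<lparr>carrier = carrier (Hom_module int_ring (additive_module R) D), monoid.mult = undefined,
      one = undefined, ring.zero = \<zero>\<^bsub>Hom_module int_ring (additive_module R) D\<^esub>,
      ring.add = ring.add (Hom_module int_ring (additive_module R) D),
      module.smult = (\<lambda>r f. \<lambda>s\<in>carrier R. f (s \<otimes>\<^bsub>R\<^esub> r))\<rparr>"

text \<open>By adjunction, a homomorphism \<open>F\<close> from an ideal amounts to the additive map
  \<open>u\<close> obtained by evaluation at one. Extending \<open>u\<close> additively to
  \<open>R\<close> produces the element \<open>e\<close>, and \<open>F j s = u (s j)\<close>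
  recovers \<open>F\<close> from \<open>u\<close>.\<close>

lemma baer_injective_coinduced_module:
  assumes R: "cring R" and D: "baer_injective int_ring D"
  shows "baer_injective R (coinduced_module R D)"
proof -
  interpret R: cring R by fact
  have AR: "module int_ring (additive_module R)" using module_additive_module[OF R.abelian_group_axioms] .
  have mD: "module int_ring D" using baer_injective_module[OF D] .
  interpret D: module int_ring D by fact
  let ?H = "Hom_module int_ring (additive_module R) D" and ?C = "coinduced_module R D"
  have mH: "module int_ring ?H" using module_Hom_module[OF AR mD] .
  interpret H: module int_ring ?H by fact
  have C: "carrier ?C = carrier ?H" "\<zero>\<^bsub>?C\<^esub> = \<zero>\<^bsub>?H\<^esub>" "f \<oplus>\<^bsub>?C\<^esub> g = f \<oplus>\<^bsub>?H\<^esub> g"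
    "r \<odot>\<^bsub>?C\<^esub> f = (\<lambda>s\<in>carrier R. f (s \<otimes>\<^bsub>R\<^esub> r))" for f g r
    by (simp_all add: coinduced_module_def)
  have cl: "f s \<in> carrier D" if "f \<in> carrier ?H" "s \<in> carrier R" for f s
    using that mod_hom_closed[of f int_ring "additive_module R" D s] by simp
  have fadd: "f (s \<oplus>\<^bsub>R\<^esub> t) = f s \<oplus>\<^bsub>D\<^esub> f t" if "f \<in> carrier ?H" "s \<in> carrier R" "t \<in> carrier R" for f s t
    using that mod_hom_add[of f int_ring "additive_module R" D s t] by simp
  have HI: "f \<in> carrier ?H" if "\<And>s. s \<in> carrier R \<Longrightarrow> f s \<in> carrier D" "f \<in> extensional (carrier R)"
    "\<And>s t. s \<in> carrier R \<Longrightarrow> t \<in> carrier R \<Longrightarrow> f (s \<oplus>\<^bsub>R\<^esub> t) = f s \<oplus>\<^bsub>D\<^esub> f t" for f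
    using that additive_imp_int_mod_hom[OF AR mD, of f] by simp
  have ext: "f = g" if "f \<in> carrier ?H" "g \<in> carrier ?H" "\<And>s. s \<in> carrier R \<Longrightarrow> f s = g s" for f g
    using that by (auto intro: extensionalityI)
  have smc: "r \<odot>\<^bsub>?C\<^esub> f \<in> carrier ?H" if "r \<in> carrier R" "f \<in> carrier ?H" for r f
    unfolding C by (rule HI) (use that cl fadd in \<open>auto simp: R.l_distr\<close>)
  have addc: "f \<oplus>\<^bsub>?H\<^esub> g \<in> carrier ?H" if "f \<in> carrier ?H" "g \<in> carrier ?H" for f g
    using that by (rule H.M.a_closed)
  have add_ap: "(f \<oplus>\<^bsub>?H\<^esub> g) s = f s \<oplus>\<^bsub>D\<^esub> g s" if "s \<in> carrier R" for f g s using that by simp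
  have mC: "module R ?C"
  proof (intro moduleI abelian_groupI)
    show "cring R" by fact
    fix f assume "f \<in> carrier ?C"
    hence f: "f \<in> carrier ?H" by (simp only: C)
    show "\<exists>g\<in>carrier ?C. g \<oplus>\<^bsub>?C\<^esub> f = \<zero>\<^bsub>?C\<^esub>"
      unfolding C using H.M.l_neg[OF f] H.M.a_inv_closed[OF f] by blast
    show "\<zero>\<^bsub>?C\<^esub> \<oplus>\<^bsub>?C\<^esub> f = f" unfolding C by (rule H.M.l_zero[OF f])
    show "\<one>\<^bsub>R\<^esub> \<odot>\<^bsub>?C\<^esub> f = f"
      by (rule ext[OF smc[OF R.one_closed f] f]) (simp add: C)
    fix g assume "g \<in> carrier ?C"
    hence g: "g \<in> carrier ?H" by (simp only: C)
    show "f \<oplus>\<^bsub>?C\<^esub> g \<in> carrier ?C" unfolding C by (rule addc[OF f g])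
    show "f \<oplus>\<^bsub>?C\<^esub> g = g \<oplus>\<^bsub>?C\<^esub> f" unfolding C by (rule H.M.a_comm[OF f g])
    fix h assume "h \<in> carrier ?C"
    hence h: "h \<in> carrier ?H" by (simp only: C)
    show "f \<oplus>\<^bsub>?C\<^esub> g \<oplus>\<^bsub>?C\<^esub> h = f \<oplus>\<^bsub>?C\<^esub> (g \<oplus>\<^bsub>?C\<^esub> h)" unfolding C by (rule H.M.a_assoc[OF f g h])
  next
    show "\<zero>\<^bsub>?C\<^esub> \<in> carrier ?C" unfolding C by (rule H.M.zero_closed)
    fix r f assume r: "r \<in> carrier R" and "f \<in> carrier ?C"
    hence f: "f \<in> carrier ?H" by (simp only: C)
    show "r \<odot>\<^bsub>?C\<^esub> f \<in> carrier ?C" unfolding C(1) by (rule smc[OF r f])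
    fix g assume "g \<in> carrier ?C"
    hence g: "g \<in> carrier ?H" by (simp only: C)
    show "r \<odot>\<^bsub>?C\<^esub> (f \<oplus>\<^bsub>?C\<^esub> g) = r \<odot>\<^bsub>?C\<^esub> f \<oplus>\<^bsub>?C\<^esub> r \<odot>\<^bsub>?C\<^esub> g"
      unfolding C(3) by (rule ext[OF smc[OF r addc[OF f g]] addc[OF smc[OF r f] smc[OF r g]]])
        (use r in \<open>simp add: C(4)\<close>)
  next
    fix r q f assume r: "r \<in> carrier R" and q: "q \<in> carrier R" and "f \<in> carrier ?C"
    hence f: "f \<in> carrier ?H" by (simp only: C)
    show "(r \<oplus>\<^bsub>R\<^esub> q) \<odot>\<^bsub>?C\<^esub> f = r \<odot>\<^bsub>?C\<^esub> f \<oplus>\<^bsub>?C\<^esub> q \<odot>\<^bsub>?C\<^esub> f"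
      unfolding C(3) by (rule ext[OF smc[OF _ f] addc[OF smc[OF r f] smc[OF q f]]])
        (use r q fadd[OF f] in \<open>simp_all add: C(4) R.r_distr\<close>)
    show "(r \<otimes>\<^bsub>R\<^esub> q) \<odot>\<^bsub>?C\<^esub> f = r \<odot>\<^bsub>?C\<^esub> (q \<odot>\<^bsub>?C\<^esub> f)"
      by (rule ext[OF smc[OF _ f] smc[OF r smc[OF q f]]])
        (use r q in \<open>simp_all add: C(4) R.m_assoc\<close>)
  qed
  show ?thesis
    unfolding baer_injective_def
  proof (intro conjI allI impI mC)
    fix J F assume J: "ideal J R" and F: "F \<in> mod_hom R ((self_module R)\<lparr>carrier := J\<rparr>) ?C"
    have Jsub: "J \<subseteq> carrier R" using J by (simp add: additive_subgroup.a_subset ideal.axioms(1))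
    have Fc: "F j \<in> carrier ?H" if "j \<in> J" for j using mod_hom_closed[OF F] that C(1) by simp
    have Fadd: "F (j \<oplus>\<^bsub>R\<^esub> j') = F j \<oplus>\<^bsub>?H\<^esub> F j'" if "j \<in> J" "j' \<in> J" for j j'
      using mod_hom_add[OF F, of j j'] that unfolding C(3) by (simp add: self_module_def)
    have Fsm: "F (r \<otimes>\<^bsub>R\<^esub> j) = r \<odot>\<^bsub>?C\<^esub> F j" if "j \<in> J" "r \<in> carrier R" for j r
      using mod_hom_smult[OF F, of r j] that by (simp add: self_module_def)
    have "submodule J int_ring (additive_module R)"
    proof -
      interpret A: module int_ring "additive_module R" by fact
      have inv: "\<ominus>\<^bsub>additive_module R\<^esub> j = \<ominus>\<^bsub>R\<^esub> j" if "j \<in> J" for j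
        using that Jsub by (intro A.M.minus_equality) (auto simp: R.l_neg)
      have m: "i \<ominus>\<^bsub>additive_module R\<^esub> j = i \<ominus>\<^bsub>R\<^esub> j" if "j \<in> J" for i j
        using inv[OF that] by (simp add: a_minus_def)
      have J0: "\<zero>\<^bsub>R\<^esub> \<in> J" and Ja: "i \<oplus>\<^bsub>R\<^esub> j \<in> J" and Jm: "i \<ominus>\<^bsub>R\<^esub> j \<in> J" if "i \<in> J" "j \<in> J" for i j
        using that J additive_subgroup.zero_closed[OF ideal.axioms(1)[OF J]]
          additive_subgroup.a_closed[OF ideal.axioms(1)[OF J]] additive_subgroup.a_inv_closed[OF ideal.axioms(1)[OF J]]
        by (auto simp: a_minus_def)
      show ?thesis
      proof (rule submodule_if_closed[OF AR])
        fix k :: int and j assume j: "j \<in> J"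
        show "k \<odot>\<^bsub>additive_module R\<^esub> j \<in> J"
          by (rule int_module_smult_induct[OF AR, of _ "\<lambda>w. w \<in> J"])
            (use j Jsub J0 Ja Jm m in auto)
      qed (use Jsub Ja additive_subgroup.zero_closed[OF ideal.axioms(1)[OF J]] in auto)
    qed
    note SJ = this
    define u where "u j = F j \<one>\<^bsub>R\<^esub>" for j
    have "u \<in> mod_hom int_ring ((additive_module R)\<lparr>carrier := J\<rparr>) D"
      by (rule additive_imp_int_mod_hom[OF module_restrict_carrier[OF AR SJ] mD])
        (use cl[OF Fc] Fadd in \<open>auto simp: u_def\<close>)
    from baer_injective_extend[OF D AR SJ this]
    obtain g where g: "g \<in> mod_hom int_ring (additive_module R) D" "\<And>j. j \<in> J \<Longrightarrow> g j = u j" by blast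
    define e where "e = restrict g (carrier R)"
    have e: "e \<in> carrier ?H" using mod_hom_restrict[OF AR g(1)] by (simp add: e_def)
    have "F j = j \<odot>\<^bsub>?C\<^esub> e" if j: "j \<in> J" for j
    proof (rule ext[OF Fc[OF j] smc[OF _ e]])
      show "j \<in> carrier R" using j Jsub by blast
      fix s assume s: "s \<in> carrier R"
      have sj: "s \<otimes>\<^bsub>R\<^esub> j \<in> J" using ideal.I_l_closed[OF J j s] .
      have "(j \<odot>\<^bsub>?C\<^esub> e) s = u (s \<otimes>\<^bsub>R\<^esub> j)" using s sj Jsub g(2) by (auto simp: C(4) e_def)
      also have "\<dots> = F j s" using Fsm[OF j s] s by (simp add: u_def C(4))
      finally show "F j s = (j \<odot>\<^bsub>?C\<^esub> e) s" by simp
    qed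
    thus "\<exists>e\<in>carrier ?C. \<forall>r\<in>J. F r = r \<odot>\<^bsub>?C\<^esub> e" using e C(1) by blast
  qed
qed

text \<open>The embedding sends \<open>n\<close> to the map \<open>r |-> \<iota> (r n)\<close> into
  the coinduced module, which is then transported to the type \<open>'w\<close>.\<close>

lemma module_embeds_injective:
  fixes N :: "('r, 'u, 'l) module_scheme" and R :: "('r, 'k) ring_scheme"
    and j :: "('r \<Rightarrow> ('u \<Rightarrow>\<^sub>0 rat)) \<Rightarrow> 'w"
  assumes N: "module R N" and j: "inj j"
  shows "\<exists>(I :: ('r, 'w) module) e. baer_injective R I \<and> e \<in> mod_hom R N I \<and> inj_on e (carrier N)"
proof -
  interpret N: module R N by fact
  note V = module_rat_frag_module
  obtain K :: "('u \<Rightarrow>\<^sub>0 rat) set" and \<iota> where K: "submodule K int_ring rat_frag_module"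
    and \<iota>: "\<And>x. x \<in> carrier N \<Longrightarrow> \<iota> x \<in> carrier (mod_quot rat_frag_module K)" "inj_on \<iota> (carrier N)"
     "\<And>x y. x \<in> carrier N \<Longrightarrow> y \<in> carrier N \<Longrightarrow> \<iota> (x \<oplus>\<^bsub>N\<^esub> y) = \<iota> x \<oplus>\<^bsub>mod_quot rat_frag_module K\<^esub> \<iota> y"
    using abelian_group_embeds_divisible[OF N] by blast
  let ?D = "mod_quot rat_frag_module K"
  have D: "baer_injective int_ring ?D" using rat_frag_quotient_baer_injective[OF K] .
  have mD: "module int_ring ?D" using baer_injective_module[OF D] .
  let ?C = "coinduced_module R ?D"
  have C: "baer_injective R ?C" using baer_injective_coinduced_module[OF N.is_cring D] .
  have mC: "module R ?C" using baer_injective_module[OF C] .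
  have AR: "module int_ring (additive_module R)" using module_additive_module[OF N.R.abelian_group_axioms] .
  define e where "e n = (\<lambda>r\<in>carrier R. \<iota> (r \<odot>\<^bsub>N\<^esub> n))" for n
  have "e n \<in> mod_hom int_ring (additive_module R) ?D" if "n \<in> carrier N" for n
    by (rule additive_imp_int_mod_hom[OF AR mD])
      (use that \<iota> in \<open>auto simp: e_def N.smult_l_distr\<close>)
  hence ec: "e n \<in> carrier ?C" if "n \<in> carrier N" for n
    using that by (auto simp: coinduced_module_def e_def)
  have e: "e \<in> mod_hom R N ?C"
  proof (rule mod_homI)
    fix x y assume "x \<in> carrier N" "y \<in> carrier N"
    thus "e (x \<oplus>\<^bsub>N\<^esub> y) = e x \<oplus>\<^bsub>?C\<^esub> e y"
      by (auto simp: e_def coinduced_module_def N.smult_r_distr \<iota>(3) intro!: restrict_ext)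
  next
    fix r x assume "r \<in> carrier R" "x \<in> carrier N"
    thus "e (r \<odot>\<^bsub>N\<^esub> x) = r \<odot>\<^bsub>?C\<^esub> e x"
      by (auto simp: e_def coinduced_module_def N.smult_assoc1 intro!: restrict_ext)
  qed (use ec in auto)
  have inj_e: "inj_on e (carrier N)"
  proof (rule inj_onI)
    fix x y assume xy: "x \<in> carrier N" "y \<in> carrier N" "e x = e y"
    have "e x \<one>\<^bsub>R\<^esub> = e y \<one>\<^bsub>R\<^esub>" using xy by simp
    hence "\<iota> x = \<iota> y" using xy by (simp add: e_def)
    thus "x = y" using \<iota>(2) xy by (meson inj_onD)
  qed
  \<comment> \<open>Each coset is replaced by a chosen representative. The values then lie in
    \<open>'u \<Rightarrow>\<^sub>0 rat\<close>, whereas sets of such vectors would form a type too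
    large to return to \<open>'w\<close>. Outside the carrier all elements agree, so a constant
    default is enough.\<close>
  define t where "t f = (\<lambda>r. if r \<in> carrier R then SOME v. v \<in> f r else 0)" for f :: "'r \<Rightarrow> ('u \<Rightarrow>\<^sub>0 rat) set"
  have "inj_on t (carrier ?C)"
  proof (rule inj_onI)
    fix f g assume fg: "f \<in> carrier ?C" "g \<in> carrier ?C" "t f = t g"
    interpret S: abelian_subgroup K rat_frag_module using abelian_subgroup_submodule[OF V K] .
    have Vc: "v \<in> carrier rat_frag_module" for v :: "'u \<Rightarrow>\<^sub>0 rat" by (simp add: rat_frag_module_def)
    have rep: "A = K +>\<^bsub>rat_frag_module\<^esub> (SOME v. v \<in> A)" if "A \<in> carrier ?D" for A
    proof -
      obtain v where v: "A = K +>\<^bsub>rat_frag_module\<^esub> v" using \<open>A \<in> carrier ?D\<close> by (auto simp: mod_quot_simps(1)[OF V K])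
      hence "v \<in> A" using S.a_rcos_self[OF Vc] by simp
      hence "(SOME v. v \<in> A) \<in> A" by (rule someI)
      thus ?thesis using S.a_repr_independence'[OF _ Vc] v by blast
    qed
    have "f r = g r" if r: "r \<in> carrier R" for r
    proof -
      have "f r \<in> carrier ?D" "g r \<in> carrier ?D"
        using fg(1,2) r mod_hom_closed[of _ int_ring "additive_module R" ?D r] by (auto simp: coinduced_module_def)
      moreover have "(SOME v. v \<in> f r) = (SOME v. v \<in> g r)" using fun_cong[OF fg(3), of r] r by (simp add: t_def)
      ultimately show ?thesis using rep by metis
    qed
    thus "f = g" using fg(1,2) by (auto simp: coinduced_module_def intro: extensionalityI)
  qed
  hence inj: "inj_on (j \<circ> t) (carrier ?C)" using j by (intro comp_inj_on) (auto simp: inj_on_def)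
  let ?I = "map_module (j \<circ> t) ?C"
  have "(\<lambda>n. (j \<circ> t) (e n)) \<in> mod_hom R N ?I" using mod_hom_compose[OF e map_module_hom(1)[OF mC inj]] .
  moreover have "inj_on (\<lambda>n. (j \<circ> t) (e n)) (carrier N)"
    using inj_e inj ec by (auto simp: inj_on_def)
  ultimately show ?thesis using baer_injective_map_module[OF C inj] by blast
qed

subsection \<open>Injective resolutions\<close>

text \<open>The natural number in the argument is decoded into a list index and an argument for that
  entry; the one in the result carries, beside the value of the entry, the length of the list and
  the extra number.\<close>

lemma inj_list_code:
  "\<exists>g :: ('a \<times> nat \<Rightarrow> 'b \<times> nat) list \<times> nat \<Rightarrow> ('a \<times> nat \<Rightarrow> 'b \<times> nat). inj g"
proof -
  define sel :: "('a \<times> nat \<Rightarrow> 'b \<times> nat) list \<Rightarrow> 'a \<Rightarrow> nat \<Rightarrow> 'b \<times> nat" where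
    "sel xs r k = (if fst (prod_decode k) < length xs then xs ! fst (prod_decode k) else (\<lambda>_. undefined))
       (r, snd (prod_decode k))" for xs r k
  define g :: "('a \<times> nat \<Rightarrow> 'b \<times> nat) list \<times> nat \<Rightarrow> ('a \<times> nat \<Rightarrow> 'b \<times> nat)" where
    "g p = (\<lambda>y. (fst (sel (fst p) (fst y) (snd y)),
       prod_encode (snd (sel (fst p) (fst y) (snd y)), prod_encode (length (fst p), snd p))))" for p
  have "inj g"
  proof (rule injI)
    fix p p' assume eq: "g p = g p'"
    obtain xs q ys q' where p: "p = (xs, q)" "p' = (ys, q')" by (cases p, cases p')
    have "g p y = g p' y" for y using eq by simp
    hence *: "fst (sel xs (fst y) (snd y)) = fst (sel ys (fst y) (snd y))"
      "snd (sel xs (fst y) (snd y)) = snd (sel ys (fst y) (snd y))" "length xs = length ys" "q = q'" for y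
      by (simp_all add: g_def p prod_encode_eq)
    hence sel: "sel xs r k = sel ys r k" for r k using *(1,2)[of "(r, k)"] by (simp add: prod_eq_iff)
    have "xs ! i = ys ! i" if "i < length xs" for i
    proof
      fix y :: "'a \<times> nat"
      show "(xs ! i) y = (ys ! i) y"
        using sel[of "fst y" "prod_encode (i, snd y)"] that *(3) by (simp add: sel_def)
    qed
    thus "p = p'" using *(3,4) p by (simp add: nth_equalityI)
  qed
  thus ?thesis by blast
qed

text \<open>A vector is determined by a list of its finite support together with the list of its
  coefficients, and a list of rationals is coded by one number.\<close>

lemma inj_frag_code: "\<exists>b :: ('u \<Rightarrow>\<^sub>0 rat) \<Rightarrow> 'u list \<times> nat. inj b"
proof -
  define xs where "xs p = (SOME xs. set xs = Poly_Mapping.keys p)" for p :: "'u \<Rightarrow>\<^sub>0 rat"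
  have xs: "set (xs p) = Poly_Mapping.keys p" for p
    unfolding xs_def by (rule someI_ex) (simp add: finite_list)
  define b where "b p = (xs p, to_nat (map (Poly_Mapping.lookup p) (xs p)))" for p
  have "inj b"
  proof (rule injI)
    fix p p' assume "b p = b p'"
    hence eq: "xs p = xs p'" "map (Poly_Mapping.lookup p) (xs p) = map (Poly_Mapping.lookup p') (xs p)"
      by (auto simp: b_def)
    have k: "Poly_Mapping.keys p = Poly_Mapping.keys p'" using eq(1) xs by metis
    show "p = p'"
    proof (rule poly_mapping_eqI)
      fix x
      show "Poly_Mapping.lookup p x = Poly_Mapping.lookup p' x"
      proof (cases "x \<in> Poly_Mapping.keys p")
        case True
        thus ?thesis using eq(2) xs[of p] by auto
      next
        case False
        thus ?thesis using k by (metis in_keys_iff)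
      qed
    qed
  qed
  thus ?thesis by blast
qed

text \<open>Uncurrying leads to functions on \<open>'a \<times> ('a \<times> nat)\<close>, and this
  type injects into \<open>'a \<times> nat\<close> because an infinite set is equinumerous with its
  square.\<close>

lemma inj_fun_code:
  "\<exists>c :: ('a \<Rightarrow> ('a \<times> nat \<Rightarrow> 'b)) \<Rightarrow> ('a \<times> nat \<Rightarrow> 'b). inj c"
proof -
  let ?A = "UNIV :: ('a \<times> nat) set"
  have "infinite ?A" using finite_prod[where 'a = 'a and 'b = nat] infinite_UNIV_nat by auto
  hence "|?A \<times> ?A| =o |?A|" by (rule card_of_Times_same_infinite)
  hence "|?A \<times> ?A| \<le>o |?A|" by (rule ordIso_imp_ordLeq)
  then obtain f :: "('a \<times> nat) \<times> ('a \<times> nat) \<Rightarrow> 'a \<times> nat" where f: "inj f"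
    by (metis UNIV_Times_UNIV card_of_ordLeq)
  define t where "t p = f ((fst p, 0), snd p)" for p
  have t: "inj t" by (rule injI) (use f in \<open>simp add: t_def inj_eq prod.expand\<close>)
  define c where "c F = (\<lambda>y. F (fst (inv_into UNIV t y)) (snd (inv_into UNIV t y)))" for F :: "'a \<Rightarrow> ('a \<times> nat \<Rightarrow> 'b)"
  have "inj c"
  proof (rule injI)
    fix F G assume "c F = c G"
    hence "c F (t (r, a)) = c G (t (r, a))" for r a by simp
    thus "F = G" using t by (intro ext) (simp add: c_def)
  qed
  thus ?thesis by blast
qed

text \<open>The representatives used for coinduced modules over the carrier type of
  \<open>local_cohomology\<close> can be coded in that same type, so building an injective module
  does not leave it.\<close>

lemma inj_coinduced_code:
  "\<exists>j :: ('r \<Rightarrow> (('r \<times> nat \<Rightarrow> 'm \<times> nat) \<Rightarrow>\<^sub>0 rat)) \<Rightarrow> ('r \<times> nat \<Rightarrow> 'm \<times> nat). inj j"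
proof -
  obtain g :: "('r \<times> nat \<Rightarrow> 'm \<times> nat) list \<times> nat \<Rightarrow> ('r \<times> nat \<Rightarrow> 'm \<times> nat)" where g: "inj g"
    using inj_list_code by blast
  obtain b :: "(('r \<times> nat \<Rightarrow> 'm \<times> nat) \<Rightarrow>\<^sub>0 rat) \<Rightarrow> ('r \<times> nat \<Rightarrow> 'm \<times> nat) list \<times> nat" where b: "inj b"
    using inj_frag_code by blast
  obtain c :: "('r \<Rightarrow> ('r \<times> nat \<Rightarrow> 'm \<times> nat)) \<Rightarrow> ('r \<times> nat \<Rightarrow> 'm \<times> nat)" where c: "inj c"
    using inj_fun_code by blast
  have "inj (\<lambda>h. c (\<lambda>r. g (b (h r))))"
  proof (rule injI)
    fix h h' assume "c (\<lambda>r. g (b (h r))) = c (\<lambda>r. g (b (h' r)))"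
    hence "(\<lambda>r. g (b (h r))) = (\<lambda>r. g (b (h' r)))" using c by (simp add: inj_eq)
    hence "g (b (h r)) = g (b (h' r))" for r by (rule fun_cong)
    thus "h = h'" using g b by (intro ext) (simp add: inj_eq)
  qed
  thus ?thesis by blast
qed

text \<open>One step of a resolution. The type \<open>'u\<close> occurs on both sides, which makes
  the step repeatable.\<close>

lemma cokernel_embeds_injective:
  fixes N :: "('r, 'u) module" and R :: "('r, 'k) ring_scheme"
    and j :: "('r \<Rightarrow> ('u \<Rightarrow>\<^sub>0 rat)) \<Rightarrow> 'u"
  assumes N: "module R N" and S: "submodule S R N" and j: "inj j"
  shows "\<exists>(I :: ('r, 'u) module) d. baer_injective R I \<and> d \<in> mod_hom R N I \<and> mod_ker N I d = S"
proof -
  let ?Q = "mod_quot N S"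
  have Q: "module R ?Q" using module_mod_quot[OF N S] .
  interpret A: abelian_subgroup S N using abelian_subgroup_submodule[OF N S] .
  \<comment> \<open>Representatives bring the quotient by \<open>S\<close> back from sets to the
    type \<open>'u\<close> before it is embedded.\<close>
  define t where "t A = (SOME v. v \<in> A \<and> v \<in> carrier N)" for A
  have t: "A = S +>\<^bsub>N\<^esub> t A" if "A \<in> carrier ?Q" for A
  proof -
    obtain v where v: "A = S +>\<^bsub>N\<^esub> v" "v \<in> carrier N"
      using \<open>A \<in> carrier ?Q\<close> by (auto simp: mod_quot_simps(1)[OF N S])
    hence "v \<in> A \<and> v \<in> carrier N" using A.a_rcos_self by simp
    hence "t A \<in> A \<and> t A \<in> carrier N" unfolding t_def by (rule someI)
    thus ?thesis using A.a_repr_independence' v by blast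
  qed
  have inj: "inj_on t (carrier ?Q)" by (rule inj_onI) (metis t)
  let ?M = "map_module t ?Q"
  have M: "module R ?M" using module_map_module[OF Q inj] .
  obtain I :: "('r, 'u) module" and e where I: "baer_injective R I" "e \<in> mod_hom R ?M I" "inj_on e (carrier ?M)"
    using module_embeds_injective[OF M j] by blast
  define d where "d n = e (t (S +>\<^bsub>N\<^esub> n))" for n
  note h1 = mod_quot_hom[OF N S] and h2 = map_module_hom(1)[OF Q inj]
  have h12: "(\<lambda>n. t (S +>\<^bsub>N\<^esub> n)) \<in> mod_hom R N ?M" using mod_hom_compose[OF h1 h2] .
  have d: "d \<in> mod_hom R N I" unfolding d_def using mod_hom_compose[OF h12 I(2)] .
  have "d n = \<zero>\<^bsub>I\<^esub> \<longleftrightarrow> n \<in> S" if n: "n \<in> carrier N" for n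
  proof -
    have z: "\<zero>\<^bsub>?M\<^esub> \<in> carrier ?M" "\<zero>\<^bsub>?Q\<^esub> \<in> carrier ?Q"
      using abelian_monoid.zero_closed[OF abelian_group.axioms(1)[OF module.axioms(2)]] M Q by auto
    have "d n = \<zero>\<^bsub>I\<^esub> \<longleftrightarrow> e (t (S +>\<^bsub>N\<^esub> n)) = e \<zero>\<^bsub>?M\<^esub>"
      using mod_hom_zero[OF M baer_injective_module[OF I(1)] I(2)] by (simp add: d_def)
    also have "\<dots> \<longleftrightarrow> t (S +>\<^bsub>N\<^esub> n) = t \<zero>\<^bsub>?Q\<^esub>"
      using inj_on_eq_iff[OF I(3) mod_hom_closed[OF h12 n] z(1)] by (simp add: map_module_simps(2)[OF inj])
    also have "\<dots> \<longleftrightarrow> S +>\<^bsub>N\<^esub> n = \<zero>\<^bsub>?Q\<^esub>" using inj_on_eq_iff[OF inj mod_hom_closed[OF h1 n] z(2)] .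
    also have "\<dots> \<longleftrightarrow> n \<in> S" using mod_quot_simps(2,5)[OF N S] n by simp
    finally show ?thesis .
  qed
  hence "mod_ker N I d = S" using submodule_subset[OF S] by (auto simp: mod_ker_def)
  thus ?thesis using I(1) d by blast
qed

theorem injective_resolution_exists:
  fixes M :: "('r, 'm, 'l) module_scheme" and R :: "('r, 'k) ring_scheme"
  assumes M: "module R M"
  shows "\<exists>(I :: nat \<Rightarrow> ('r, 'r \<times> nat \<Rightarrow> 'm \<times> nat) module) d. injective_resolution R M I d"
proof -
  obtain j :: "('r \<Rightarrow> (('r \<times> nat \<Rightarrow> 'm \<times> nat) \<Rightarrow>\<^sub>0 rat)) \<Rightarrow> ('r \<times> nat \<Rightarrow> 'm \<times> nat)" where j: "inj j"
    using inj_coinduced_code by blast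
  interpret M: module R M by fact
  define k :: "'m \<Rightarrow> ('r \<times> nat \<Rightarrow> 'm \<times> nat)" where "k m = (\<lambda>_. (m, 0))" for m
  have k: "inj_on k (carrier M)" by (rule inj_onI) (metis k_def fst_conv)
  let ?M = "map_module k M"
  have M': "module R ?M" using module_map_module[OF M k] .
  obtain I0 :: "('r, 'r \<times> nat \<Rightarrow> 'm \<times> nat) module" and e where
    e: "baer_injective R I0" "e \<in> mod_hom R ?M I0" "inj_on e (carrier ?M)"
    using module_embeds_injective[OF M' j] by blast
  define \<epsilon> where "\<epsilon> m = e (k m)" for m
  have \<epsilon>: "\<epsilon> \<in> mod_hom R M I0" unfolding \<epsilon>_def using mod_hom_compose[OF map_module_hom(1)[OF M k] e(2)] .
  have \<epsilon>_inj: "inj_on \<epsilon> (carrier M)"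
    using e(3) k by (auto simp: inj_on_def \<epsilon>_def map_module_simps(1)[OF k])
  \<comment> \<open>A state of the recursion is an injective module together with the submodule that
    the next differential must have as its kernel; \<open>Q\<close> makes the image of that
    differential the next such submodule.\<close>
  define P where "P (n::nat) p \<longleftrightarrow> baer_injective R (fst p) \<and> submodule (snd p) R (fst p) \<and>
     (n = 0 \<longrightarrow> p = (I0, \<epsilon> ` carrier M))" for n and p :: "('r, 'r \<times> nat \<Rightarrow> 'm \<times> nat) module \<times> _ set"
  define Q where "Q (n::nat) p q \<longleftrightarrow> (\<exists>d \<in> mod_hom R (fst p) (fst q). mod_ker (fst p) (fst q) d = snd p \<and>
     snd q = d ` carrier (fst p))" for n and p q :: "('r, 'r \<times> nat \<Rightarrow> 'm \<times> nat) module \<times> _ set"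
  have "P 0 (I0, \<epsilon> ` carrier M)"
    using e(1) submodule_mod_hom_image[OF M baer_injective_module[OF e(1)] \<epsilon> M.carrier_is_submodule]
    by (simp add: P_def)
  moreover have "\<exists>q. P (Suc n) q \<and> Q n p q" if p: "P n p" for n p
  proof -
    have mp: "module R (fst p)" "submodule (snd p) R (fst p)" using p baer_injective_module by (auto simp: P_def)
    obtain I' :: "('r, 'r \<times> nat \<Rightarrow> 'm \<times> nat) module" and d where
      I': "baer_injective R I'" "d \<in> mod_hom R (fst p) I'" "mod_ker (fst p) I' d = snd p"
      using cokernel_embeds_injective[OF mp j] by blast
    have "submodule (d ` carrier (fst p)) R I'"
      using submodule_mod_hom_image[OF mp(1) baer_injective_module[OF I'(1)] I'(2) module.carrier_is_submodule[OF mp(1)]] .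
    thus ?thesis using I' by (intro exI[of _ "(I', d ` carrier (fst p))"]) (auto simp: P_def Q_def)
  qed
  ultimately obtain F where F: "\<And>n. P n (F n)" "\<And>n. Q n (F n) (F (Suc n))"
    using dependent_nat_choice[of P Q] by blast
  define I where "I n = fst (F n)" for n
  have "\<exists>d. \<forall>n. d n \<in> mod_hom R (I n) (I (Suc n)) \<and> mod_ker (I n) (I (Suc n)) (d n) = snd (F n) \<and>
     snd (F (Suc n)) = d n ` carrier (I n)"
    using F(2) unfolding Q_def I_def by (intro choice) blast
  then obtain d where d: "\<And>n. d n \<in> mod_hom R (I n) (I (Suc n))"
    "\<And>n. mod_ker (I n) (I (Suc n)) (d n) = snd (F n)" "\<And>n. snd (F (Suc n)) = d n ` carrier (I n)"
    by blast
  have I0: "F 0 = (I0, \<epsilon> ` carrier M)" using F(1)[of 0] by (simp add: P_def)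
  have "injective_resolution R M I d"
    unfolding injective_resolution_def
  proof (intro conjI allI)
    show "injective_module R (I i)" for i
      using F(1)[of i] baer_injective_imp_injective_module by (auto simp: P_def I_def)
    show "d i \<in> mod_hom R (I i) (I (Suc i))" for i by (rule d(1))
    show "d i ` carrier (I i) = mod_ker (I (Suc i)) (I (Suc (Suc i))) (d (Suc i))" for i
      using d(2)[of "Suc i"] d(3)[of i] by simp
    show "\<exists>\<epsilon>\<in>mod_hom R M (I 0). inj_on \<epsilon> (carrier M) \<and> \<epsilon> ` carrier M = mod_ker (I 0) (I 1) (d 0)"
      using \<epsilon> \<epsilon>_inj d(2)[of 0] I0 by (intro bexI[of _ \<epsilon>]) (auto simp: I_def)
  qed
  thus ?thesis by blast
qed

section \<open>Local cohomology\<close>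

lemma cohomology_torsion_eq:
  "cohomology (\<lambda>j. torsion_part R \<aa> (I j)) d n =
     mod_quot ((I n)\<lparr>carrier := cocycles R \<aa> I d n\<rparr>) (coboundaries R \<aa> I d n)"
proof -
  have "mod_ker (torsion_part R \<aa> (I n)) (torsion_part R \<aa> (I (Suc n))) (d n) = cocycles R \<aa> I d n"
    by (auto simp: mod_ker_def cocycles_def torsion_elements_def torsion_part_def)
  moreover have "(torsion_part R \<aa> (I n))\<lparr>carrier := X\<rparr> = (I n)\<lparr>carrier := X\<rparr>" for X
    by (simp add: torsion_part_def)
  moreover have "(case n of 0 \<Rightarrow> {\<zero>\<^bsub>torsion_part R \<aa> (I 0)\<^esub>} | Suc j \<Rightarrow> d j ` carrier (torsion_part R \<aa> (I j))) =
      coboundaries R \<aa> I d n"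
    by (cases n) (auto simp: coboundaries_def torsion_elements_def torsion_part_def)
  ultimately show ?thesis by (simp add: cohomology_def)
qed

context injective_complex
begin

lemma submodule_coboundaries_cocycles:
  assumes "ideal \<aa> R"
  shows "submodule (coboundaries R \<aa> I d n) R ((I n)\<lparr>carrier := cocycles R \<aa> I d n\<rparr>)"
  using coboundaries_subset_cocycles[OF assms] submodule_zero[OF submodule_coboundaries[OF assms]]
    submodule_add[OF submodule_coboundaries[OF assms]] submodule_smult[OF submodule_coboundaries[OF assms]]
  by (intro submodule_if_closed[OF module_restrict_carrier[OF mod submodule_cocycles[OF assms]]]) auto

end

lemma zero_module_cohomology_iff:
  fixes I :: "nat \<Rightarrow> ('r, 'i) module"
  assumes "injective_complex R I d" "ideal \<aa> R"
  shows "zero_module (cohomology (\<lambda>j. torsion_part R \<aa> (I j)) d n) \<longleftrightarrow>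
     cocycles R \<aa> I d n \<subseteq> coboundaries R \<aa> I d n"
proof -
  interpret injective_complex R I d by fact
  show ?thesis
    unfolding cohomology_torsion_eq
    using zero_module_mod_quot_iff[OF module_restrict_carrier[OF mod submodule_cocycles[OF assms(2)]]
        submodule_coboundaries_cocycles[OF assms(2)]] by simp
qed

lemma module_cohomology:
  fixes I :: "nat \<Rightarrow> ('r, 'i) module"
  assumes "injective_complex R I d" "ideal \<aa> R"
  shows "module R (cohomology (\<lambda>j. torsion_part R \<aa> (I j)) d n)"
proof -
  interpret injective_complex R I d by fact
  show ?thesis
    unfolding cohomology_torsion_eq using assms(2)
    by (intro module_mod_quot module_restrict_carrier[OF mod submodule_cocycles] submodule_coboundaries_cocycles)
qed

lemma injective_resolution_complex:
  assumes "injective_resolution R M I d" "module R M"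
  shows "injective_complex R I d"
    and "\<exists>\<epsilon>. augmentation R M I d \<epsilon> \<and> (\<forall>m\<in>carrier M. \<epsilon> m = \<zero>\<^bsub>I 0\<^esub> \<longrightarrow> m = \<zero>\<^bsub>M\<^esub>)"
proof -
  interpret M: module R M by fact
  have r: "\<And>i. injective_module R (I i)" "\<And>i. d i \<in> mod_hom R (I i) (I (Suc i))"
    "\<And>i. d i ` carrier (I i) = mod_ker (I (Suc i)) (I (Suc (Suc i))) (d (Suc i))"
    using assms(1) by (auto simp: injective_resolution_def)
  show "injective_complex R I d"
  proof
    show "baer_injective R (I n)" for n using injective_module_imp_baer_injective[OF r(1)] .
    show "d n \<in> mod_hom R (I n) (I (Suc n))" for n by (rule r(2))
    show "d (Suc n) (d n a) = \<zero>\<^bsub>I (Suc (Suc n))\<^esub>" if "a \<in> carrier (I n)" for a n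
    proof -
      have "d n a \<in> mod_ker (I (Suc n)) (I (Suc (Suc n))) (d (Suc n))" using that r(3)[of n] by blast
      thus ?thesis by (simp add: mod_ker_def)
    qed
    show "\<exists>b\<in>carrier (I n). d n b = a"
      if "a \<in> carrier (I (Suc n))" "d (Suc n) a = \<zero>\<^bsub>I (Suc (Suc n))\<^esub>" for a n
    proof -
      have "a \<in> d n ` carrier (I n)" using that r(3)[of n] by (simp add: mod_ker_def)
      thus ?thesis by blast
    qed
  qed
  obtain \<epsilon> where \<epsilon>: "\<epsilon> \<in> mod_hom R M (I 0)" "inj_on \<epsilon> (carrier M)" "\<epsilon> ` carrier M = mod_ker (I 0) (I 1) (d 0)"
    using assms(1) by (auto simp: injective_resolution_def)
  have "\<epsilon> \<zero>\<^bsub>M\<^esub> = \<zero>\<^bsub>I 0\<^esub>"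
    using mod_hom_zero[OF assms(2) baer_injective_module[OF injective_module_imp_baer_injective[OF r(1)]] \<epsilon>(1)] .
  hence "m = \<zero>\<^bsub>M\<^esub>" if "m \<in> carrier M" "\<epsilon> m = \<zero>\<^bsub>I 0\<^esub>" for m
    using inj_onD[OF \<epsilon>(2), of m "\<zero>\<^bsub>M\<^esub>"] that by simp
  thus "\<exists>\<epsilon>. augmentation R M I d \<epsilon> \<and> (\<forall>m\<in>carrier M. \<epsilon> m = \<zero>\<^bsub>I 0\<^esub> \<longrightarrow> m = \<zero>\<^bsub>M\<^esub>)"
    using \<epsilon> assms(2) by (auto simp: augmentation_def)
qed

text \<open>Existence of a resolution validates the \<open>SOME\<close>. The choice depends on
  \<open>R\<close> and \<open>M\<close> alone, so one complex serves all ideals and degrees.\<close>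

lemma local_cohomology_complex:
  fixes M :: "('r, 'm, 'l) module_scheme" and R :: "('r, 'k) ring_scheme"
  assumes M: "module R M"
  shows "\<exists>(I :: nat \<Rightarrow> ('r, 'r \<times> nat \<Rightarrow> 'm \<times> nat) module) d \<epsilon>.
     injective_complex R I d \<and> augmentation R M I d \<epsilon> \<and>
     (\<forall>m\<in>carrier M. \<epsilon> m = \<zero>\<^bsub>I 0\<^esub> \<longrightarrow> m = \<zero>\<^bsub>M\<^esub>) \<and>
     (\<forall>\<aa> n. local_cohomology R \<aa> M n = cohomology (\<lambda>j. torsion_part R \<aa> (I j)) d n)"
proof -
  define p where "p = (SOME (I :: nat \<Rightarrow> ('r, 'r \<times> nat \<Rightarrow> 'm \<times> nat) module, d). injective_resolution R M I d)"
  obtain I d where p: "p = (I, d)" by (cases p)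
  have "case p of (I, d) \<Rightarrow> injective_resolution R M I d"
    unfolding p_def by (rule someI_ex) (use injective_resolution_exists[OF M] in auto)
  hence r: "injective_resolution R M I d" by (simp add: p)
  have "local_cohomology R \<aa> M n = cohomology (\<lambda>j. torsion_part R \<aa> (I j)) d n" for \<aa> n
    unfolding local_cohomology_def p_def[symmetric] p by simp
  thus ?thesis using injective_resolution_complex[OF r M] by blast
qed

text \<open>Composing the augmentation with the projection makes \<open>M\<close> itself the source,
  with kernel \<open>N\<close>; complexes for different quotients can then be compared over one
  module.\<close>

lemma local_cohomology_quotient_complex:
  fixes M :: "('r, 'm, 'l) module_scheme" and R :: "('r, 'k) ring_scheme"
  assumes M: "module R M" and N: "submodule N R M"
  shows "\<exists>(J :: nat \<Rightarrow> ('r, 'r \<times> nat \<Rightarrow> 'm set \<times> nat) module) e \<eta>.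
     injective_complex R J e \<and> augmentation R M J e \<eta> \<and> (\<forall>m\<in>carrier M. \<eta> m = \<zero>\<^bsub>J 0\<^esub> \<longleftrightarrow> m \<in> N) \<and>
     (\<forall>\<aa> n. local_cohomology R \<aa> (mod_quot M N) n = cohomology (\<lambda>j. torsion_part R \<aa> (J j)) e n)"
proof -
  let ?Q = "mod_quot M N"
  have Q: "module R ?Q" using module_mod_quot[OF M N] .
  obtain J :: "nat \<Rightarrow> ('r, 'r \<times> nat \<Rightarrow> 'm set \<times> nat) module" and e \<epsilon> where
    J: "injective_complex R J e" "augmentation R ?Q J e \<epsilon>"
    "\<forall>q\<in>carrier ?Q. \<epsilon> q = \<zero>\<^bsub>J 0\<^esub> \<longrightarrow> q = \<zero>\<^bsub>?Q\<^esub>"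
    "\<forall>\<aa> n. local_cohomology R \<aa> ?Q n = cohomology (\<lambda>j. torsion_part R \<aa> (J j)) e n"
    using local_cohomology_complex[OF Q] by (elim exE conjE) (rule that, assumption+)
  define \<eta> where "\<eta> m = \<epsilon> (N +>\<^bsub>M\<^esub> m)" for m
  have \<epsilon>: "\<epsilon> \<in> mod_hom R ?Q (J 0)" "\<epsilon> ` carrier ?Q = mod_ker (J 0) (J 1) (e 0)"
    using J(2) by (auto simp: augmentation_def)
  note h = mod_quot_hom[OF M N]
  have "\<eta> \<in> mod_hom R M (J 0)" unfolding \<eta>_def using mod_hom_compose[OF h \<epsilon>(1)] .
  moreover have "\<eta> ` carrier M = mod_ker (J 0) (J 1) (e 0)"
    using \<epsilon>(2) unfolding mod_quot_simps(1)[OF M N] image_image \<eta>_def .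
  ultimately have "augmentation R M J e \<eta>" using M by (simp add: augmentation_def)
  moreover have "\<eta> m = \<zero>\<^bsub>J 0\<^esub> \<longleftrightarrow> m \<in> N" if m: "m \<in> carrier M" for m
  proof -
    have "\<epsilon> \<zero>\<^bsub>?Q\<^esub> = \<zero>\<^bsub>J 0\<^esub>" using mod_hom_zero[OF Q injective_complex.mod[OF J(1)] \<epsilon>(1)] .
    hence "\<eta> m = \<zero>\<^bsub>J 0\<^esub> \<longleftrightarrow> N +>\<^bsub>M\<^esub> m = \<zero>\<^bsub>?Q\<^esub>"
      using bspec[OF J(3) mod_hom_closed[OF h m]] by (auto simp: \<eta>_def)
    thus ?thesis using mod_quot_simps(2,5)[OF M N] m by simp
  qed
  ultimately show ?thesis using J(1,4) by blast
qed

section \<open>Torsion against multiplication by \<open>x\<close>\<close>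

lemma torsion_pow_smult:
  assumes "module R M" "x \<in> \<aa>" "z \<in> torsion_elements R \<aa> M"
  shows "\<exists>p::nat. (x [^]\<^bsub>R\<^esub> p) \<odot>\<^bsub>M\<^esub> z = \<zero>\<^bsub>M\<^esub>"
proof -
  interpret module R M by fact
  obtain p where "\<forall>r\<in>ideal_power R \<aa> p. r \<odot>\<^bsub>M\<^esub> z = \<zero>\<^bsub>M\<^esub>" using assms(3) by (auto simp: torsion_elements_iff)
  thus ?thesis using nat_pow_in_ideal_power[OF R.ring_axioms assms(2), of p] by blast
qed

context multiplication_sequence
begin

text \<open>Some power of \<open>x\<close> kills the given cocycle, and injectivity on cohomology
  cancels the factors one at a time.\<close>

lemma injective_imp_vanishing:
  assumes xa: "x \<in> \<aa>" and inj: "\<And>z. z \<in> ZI n \<Longrightarrow> x \<odot>\<^bsub>I n\<^esub> z \<in> BI n \<Longrightarrow> z \<in> BI n"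
  shows "ZI n \<subseteq> BI n"
proof
  fix z assume z: "z \<in> ZI n"
  have *: "(x [^]\<^bsub>R\<^esub> (p::nat)) \<odot>\<^bsub>I n\<^esub> z \<in> BI n \<Longrightarrow> z \<in> BI n" if "z \<in> ZI n" for p z
    using that
  proof (induction p arbitrary: z)
    case 0
    thus ?case using submodule_subset[OF ZI] by (auto simp: subset_iff)
  next
    case (Suc p)
    have zc: "z \<in> carrier (I n)" using Suc.prems submodule_subset[OF ZI] by blast
    have "(x [^]\<^bsub>R\<^esub> Suc p) \<odot>\<^bsub>I n\<^esub> z = (x [^]\<^bsub>R\<^esub> p) \<odot>\<^bsub>I n\<^esub> (x \<odot>\<^bsub>I n\<^esub> z)"
      using x zc by (simp add: I.smult_assoc1)
    hence "x \<odot>\<^bsub>I n\<^esub> z \<in> BI n"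
      using Suc.IH[of "x \<odot>\<^bsub>I n\<^esub> z"] Suc.prems submodule_smult[OF ZI x] by simp
    thus ?case using inj Suc.prems by blast
  qed
  have "z \<in> TI n" using z by (simp add: cocycles_def)
  from torsion_pow_smult[OF X.mod xa this] show "z \<in> BI n" using *[OF z] submodule_zero[OF BI] by metis
qed

lemma vanishing_zero: "x \<in> \<aa> \<Longrightarrow> ZI 0 \<subseteq> BI 0"
  by (rule injective_imp_vanishing)
    (use x_inj in \<open>auto simp: coboundaries_def cocycles_def dest: torsion_elements_carrier\<close>)

lemma vanishing_Suc: "x \<in> \<aa> \<Longrightarrow> ZJ n \<subseteq> BJ n \<Longrightarrow> ZI (Suc n) \<subseteq> BI (Suc n)"
  by (rule injective_imp_vanishing) (auto intro: multiplication_injective)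

text \<open>Degree \<open>k\<close> of \<open>J\<close> vanishes because \<open>x\<close> is
  surjective on \<open>K\<close>; the connecting homomorphism moves the kernel of \<open>x\<close>
  on \<open>K\<close> to degree \<open>k - 1\<close>; elsewhere the neighbouring terms are
  zero.\<close>

lemma coregular_step:
  assumes xa: "x \<in> \<aa>" and H: "module R H" and K: "submodule K R H" "K \<noteq> {\<zero>\<^bsub>H\<^esub>}"
    and \<rho>: "cohomology_graph R \<aa> I d k H K \<rho>"
    and van: "\<And>j. j \<noteq> k \<Longrightarrow> ZI j \<subseteq> BI j"
    and coreg: "\<And>h. h \<in> K \<Longrightarrow> \<exists>h'\<in>K. x \<odot>\<^bsub>H\<^esub> h' = h"
  shows "\<exists>k' \<rho>'. k = Suc k' \<and> (\<forall>j. j \<noteq> k' \<longrightarrow> ZJ j \<subseteq> BJ j) \<and>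
     cohomology_graph R \<aa> J e k' H {h \<in> K. x \<odot>\<^bsub>H\<^esub> h = \<zero>\<^bsub>H\<^esub>} \<rho>' \<and>
     {h \<in> K. x \<odot>\<^bsub>H\<^esub> h = \<zero>\<^bsub>H\<^esub>} \<noteq> {\<zero>\<^bsub>H\<^esub>}"
proof -
  interpret H: module R H by fact
  have Kc: "h \<in> carrier H" if "h \<in> K" for h using that submodule_subset[OF K(1)] by blast
  have sub: "submodule \<rho> R (prod_module (I k) H)" using \<rho> by (simp add: cohomology_graph_def)
  have \<rho>sub: "a \<in> ZI k" "h \<in> K" if "(a, h) \<in> \<rho>" for a h
    using \<rho> that by (auto simp: cohomology_graph_def)
  have tot: "\<exists>h. (a, h) \<in> \<rho>" if "a \<in> ZI k" for a using \<rho> that by (auto simp: cohomology_graph_def)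
  have sur: "\<exists>a. (a, h) \<in> \<rho>" if "h \<in> K" for h using \<rho> that by (auto simp: cohomology_graph_def)
  have iff: "a \<in> BI k \<longleftrightarrow> h = \<zero>\<^bsub>H\<^esub>" if "(a, h) \<in> \<rho>" for a h
    using \<rho> that by (auto simp: cohomology_graph_def)
  have sm: "(r \<odot>\<^bsub>I k\<^esub> a, r \<odot>\<^bsub>H\<^esub> h) \<in> \<rho>" if "(a, h) \<in> \<rho>" "r \<in> carrier R" for a h r
    using submodule_smult[OF sub that(2,1)] by simp
  have ZIc: "a \<in> carrier (I n)" if "a \<in> ZI n" for a n using that submodule_subset[OF ZI] by blast
  obtain h0 where h0: "h0 \<in> K" "h0 \<noteq> \<zero>\<^bsub>H\<^esub>" using K(2) submodule_zero[OF K(1)] by blast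
  obtain z0 where z0: "(z0, h0) \<in> \<rho>" using sur[OF h0(1)] by blast
  have "\<not> ZI k \<subseteq> BI k" using \<rho>sub(1)[OF z0] iff[OF z0] h0(2) by blast
  \<comment> \<open>In degree 0 the cohomology of \<open>I\<close> is zero since \<open>x\<close> is
    regular on the resolved module, so the surviving degree can be lowered by one.\<close>
  hence "k \<noteq> 0" using vanishing_zero[OF xa] by metis
  then obtain k' where k: "k = Suc k'" using not0_implies_Suc by blast
  obtain \<rho>' where \<rho>': "cohomology_graph R \<aa> J e k' H {h \<in> K. x \<odot>\<^bsub>H\<^esub> h = \<zero>\<^bsub>H\<^esub>} \<rho>'"
    using cohomology_graph_step[OF H \<rho>[unfolded k] van submodule_subset[OF K(1)]] k by auto
  have "ZJ j \<subseteq> BJ j" if j: "j \<noteq> k'" for j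
  proof (rule quotient_cohomology_zero)
    fix z assume z: "z \<in> ZI j"
    show "\<exists>z'\<in>ZI j. z \<ominus>\<^bsub>I j\<^esub> x \<odot>\<^bsub>I j\<^esub> z' \<in> BI j"
    proof (cases "j = k")
      case False
      have "z \<ominus>\<^bsub>I j\<^esub> x \<odot>\<^bsub>I j\<^esub> \<zero>\<^bsub>I j\<^esub> = z" using x ZIc[OF z] by simp
      thus ?thesis using van[OF False] z submodule_zero[OF ZI] by (metis subsetD)
    next
      case True
      obtain h where h: "(z, h) \<in> \<rho>" using tot z True by blast
      obtain h' where h': "h' \<in> K" "x \<odot>\<^bsub>H\<^esub> h' = h" using coreg[OF \<rho>sub(2)[OF h]] by blast
      obtain z' where z': "(z', h') \<in> \<rho>" using sur[OF h'(1)] by blast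
      have "(z, h) \<ominus>\<^bsub>prod_module (I k) H\<^esub> (x \<odot>\<^bsub>I k\<^esub> z', h) \<in> \<rho>"
        using submodule_minus[OF module_prod_module[OF X.mod H] sub h] sm[OF z' x] h'(2) by simp
      hence "(z \<ominus>\<^bsub>I k\<^esub> x \<odot>\<^bsub>I k\<^esub> z', \<zero>\<^bsub>H\<^esub>) \<in> \<rho>"
        using Kc[OF \<rho>sub(2)[OF h]] ZIc[OF \<rho>sub(1)[OF h]] ZIc[OF \<rho>sub(1)[OF z']] x
        by (simp add: prod_module_minus[OF X.mod H])
      hence "z \<ominus>\<^bsub>I k\<^esub> x \<odot>\<^bsub>I k\<^esub> z' \<in> BI k" using iff by blast
      thus ?thesis using \<rho>sub(1)[OF z'] True by blast
    qed
  next
    fix z assume "z \<in> ZI (Suc j)"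
    thus "z \<in> BI (Suc j)" using van[of "Suc j"] j k by blast
  qed
  moreover have "{h \<in> K. x \<odot>\<^bsub>H\<^esub> h = \<zero>\<^bsub>H\<^esub>} \<noteq> {\<zero>\<^bsub>H\<^esub>}"
  proof
    \<comment> \<open>Then all powers of \<open>x\<close> would be injective on \<open>K\<close>,
      although one of them kills the cocycle \<open>z0\<close> representing the nonzero
      \<open>h0\<close>.\<close>
    assume eq: "{h \<in> K. x \<odot>\<^bsub>H\<^esub> h = \<zero>\<^bsub>H\<^esub>} = {\<zero>\<^bsub>H\<^esub>}"
    have inj: "h = \<zero>\<^bsub>H\<^esub>" if "h \<in> K" "(x [^]\<^bsub>R\<^esub> (p::nat)) \<odot>\<^bsub>H\<^esub> h = \<zero>\<^bsub>H\<^esub>" for h p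
      using that
    proof (induction p arbitrary: h)
      case 0
      thus ?case using Kc by simp
    next
      case (Suc p)
      have "(x [^]\<^bsub>R\<^esub> p) \<odot>\<^bsub>H\<^esub> (x \<odot>\<^bsub>H\<^esub> h) = \<zero>\<^bsub>H\<^esub>"
        using Suc.prems x Kc by (simp add: H.smult_assoc1)
      hence "x \<odot>\<^bsub>H\<^esub> h = \<zero>\<^bsub>H\<^esub>" using Suc.IH submodule_smult[OF K(1) x Suc.prems(1)] by blast
      thus ?case using eq Suc.prems(1) by blast
    qed
    have "z0 \<in> TI k" using \<rho>sub(1)[OF z0] by (simp add: cocycles_def)
    then obtain p :: nat where p: "(x [^]\<^bsub>R\<^esub> p) \<odot>\<^bsub>I k\<^esub> z0 = \<zero>\<^bsub>I k\<^esub>" using torsion_pow_smult[OF X.mod xa] by blast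
    have xp: "x [^]\<^bsub>R\<^esub> p \<in> carrier R" using x by simp
    have "(x [^]\<^bsub>R\<^esub> p) \<odot>\<^bsub>H\<^esub> h0 = \<zero>\<^bsub>H\<^esub>"
      using iff[OF sm[OF z0 xp]] p submodule_zero[OF BI] by simp
    thus False using inj[OF h0(1)] h0(2) by blast
  qed
  ultimately show ?thesis using k \<rho>' by blast
qed

end

text \<open>This passes from the resolution that defines \<open>H\<close> to another one of the same
  module. The graph is that of the comparison map \<open>q\<close>, followed by the projection of
  cocycles of \<open>I\<close> onto \<open>H\<close>.\<close>

lemma cohomology_graph_comparison:
  fixes I :: "nat \<Rightarrow> ('r, 'i) module" and J :: "nat \<Rightarrow> ('r, 'j) module" and k :: nat
  assumes X: "injective_complex R I d" and Y: "injective_complex R J e" and \<aa>: "ideal \<aa> R"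
    and M: "augmentation R M I d \<epsilon>" "augmentation R M J e \<eta>"
    and ker: "\<And>m. m \<in> carrier M \<Longrightarrow> \<epsilon> m = \<zero>\<^bsub>I 0\<^esub> \<longleftrightarrow> \<eta> m = \<zero>\<^bsub>J 0\<^esub>"
  defines "H \<equiv> cohomology (\<lambda>j. torsion_part R \<aa> (I j)) d k"
  shows "\<exists>\<rho>. cohomology_graph R \<aa> J e k H (carrier H) \<rho>"
    and "cocycles R \<aa> I d n \<subseteq> coboundaries R \<aa> I d n \<longleftrightarrow> cocycles R \<aa> J e n \<subseteq> coboundaries R \<aa> J e n"
proof -
  interpret X: injective_complex R I d by fact
  interpret Y: injective_complex R J e by fact
  obtain q where q: "\<And>n. q n \<in> mod_hom R (J n) (I n)"
     "\<And>n z. z \<in> cocycles R \<aa> J e n \<Longrightarrow> q n z \<in> cocycles R \<aa> I d n"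
     "\<And>n z. z \<in> coboundaries R \<aa> J e n \<Longrightarrow> q n z \<in> coboundaries R \<aa> I d n"
     "\<And>n z. z \<in> cocycles R \<aa> J e n \<Longrightarrow> q n z \<in> coboundaries R \<aa> I d n \<Longrightarrow> z \<in> coboundaries R \<aa> J e n"
     "\<And>n z. z \<in> cocycles R \<aa> I d n \<Longrightarrow> \<exists>z'\<in>cocycles R \<aa> J e n. q n z' \<ominus>\<^bsub>I n\<^esub> z \<in> coboundaries R \<aa> I d n"
    using torsion_cohomology_comparison[OF X Y \<aa> M ker] by metis
  let ?Z = "(I k)\<lparr>carrier := cocycles R \<aa> I d k\<rparr>" and ?B = "coboundaries R \<aa> I d k"
  note ZI = X.submodule_cocycles[OF \<aa>] and ZJ = Y.submodule_cocycles[OF \<aa>]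
    and BI = X.submodule_coboundaries[OF \<aa>] and BJ = Y.submodule_coboundaries[OF \<aa>]
  have Z: "module R ?Z" using module_restrict_carrier[OF X.mod ZI] .
  have B: "submodule ?B R ?Z" using X.submodule_coboundaries_cocycles[OF \<aa>] .
  have H: "H = mod_quot ?Z ?B" unfolding H_def by (rule cohomology_torsion_eq)
  have mH: "module R H" unfolding H using module_mod_quot[OF Z B] .
  have ZJc: "z \<in> carrier (J n)" if "z \<in> cocycles R \<aa> J e n" for z n using that submodule_subset[OF ZJ] by blast
  define \<kappa> where "\<kappa> z = ?B +>\<^bsub>?Z\<^esub> q k z" for z
  have "q k \<in> mod_hom R ((J k)\<lparr>carrier := cocycles R \<aa> J e k\<rparr>) ?Z"
    using mod_hom_into_carrier[OF mod_hom_restrict_carrier[OF q(1) submodule_subset[OF ZJ]]] q(2)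
    by (simp add: image_subset_iff)
  hence \<kappa>: "\<kappa> \<in> mod_hom R ((J k)\<lparr>carrier := cocycles R \<aa> J e k\<rparr>) H"
    unfolding \<kappa>_def H by (rule mod_hom_compose[OF _ mod_quot_hom[OF Z B]])
  have mZJ: "module R ((J k)\<lparr>carrier := cocycles R \<aa> J e k\<rparr>)" using module_restrict_carrier[OF Y.mod ZJ] .
  define \<rho> where "\<rho> = (\<lambda>z. (z, \<kappa> z)) ` cocycles R \<aa> J e k"
  have "submodule \<rho> R (prod_module (J k) H)"
    by (rule submodule_if_closed[OF module_prod_module[OF Y.mod mH]])
      (use ZJc mod_hom_closed[OF \<kappa>] mod_hom_zero[OF mZJ mH \<kappa>] mod_hom_add[OF \<kappa>] mod_hom_smult[OF \<kappa>]
        submodule_zero[OF ZJ] submodule_add[OF ZJ] submodule_smult[OF ZJ] in \<open>auto simp: \<rho>_def image_iff\<close>)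
  moreover have "\<rho> \<subseteq> cocycles R \<aa> J e k \<times> carrier H" using mod_hom_closed[OF \<kappa>] by (auto simp: \<rho>_def)
  moreover have "\<exists>z. (z, h) \<in> \<rho>" if "h \<in> carrier H" for h
  proof -
    obtain a where a: "a \<in> cocycles R \<aa> I d k" "h = ?B +>\<^bsub>?Z\<^esub> a"
      using \<open>h \<in> carrier H\<close> unfolding H mod_quot_simps(1)[OF Z B] by auto
    obtain z where z: "z \<in> cocycles R \<aa> J e k" "q k z \<ominus>\<^bsub>I k\<^esub> a \<in> ?B" using q(5)[OF a(1)] by blast
    interpret Ik: module R "I k" by (rule X.mod)
    interpret Zk: module R ?Z by fact
    have ac: "a \<in> carrier (I k)" using a(1) submodule_subset[OF ZI] by blast
    have qc: "q k z \<in> carrier (I k)" using mod_hom_closed[OF q(1) ZJc[OF z(1)]] .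
    have "\<ominus>\<^bsub>?Z\<^esub> a = \<ominus>\<^bsub>I k\<^esub> a"
      using module_a_inv_eq_smult[OF Z, of a] module_a_inv_eq_smult[OF X.mod ac] a(1) by simp
    \<comment> \<open>\<open>q(5)\<close> subtracts in \<open>I k\<close> and
      \<open>coset_eq_iff\<close> in \<open>?Z\<close>; both inverses are multiplication by minus
      one.\<close>
    hence "q k z \<ominus>\<^bsub>?Z\<^esub> a \<in> ?B" using z(2) by (simp add: a_minus_def)
    hence "\<kappa> z = h" unfolding \<kappa>_def a(2) using coset_eq_iff[OF Z B, of "q k z" a] q(2)[OF z(1)] a(1) by simp
    thus ?thesis using z(1) by (auto simp: \<rho>_def)
  qed
  moreover have "z \<in> coboundaries R \<aa> J e k \<longleftrightarrow> h = \<zero>\<^bsub>H\<^esub>" if "(z, h) \<in> \<rho>" for z h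
  proof -
    have zh: "z \<in> cocycles R \<aa> J e k" "h = \<kappa> z" using that by (auto simp: \<rho>_def)
    have "h = \<zero>\<^bsub>H\<^esub> \<longleftrightarrow> q k z \<in> ?B"
      using mod_quot_simps(2,5)[OF Z B] q(2)[OF zh(1)] unfolding H zh(2) \<kappa>_def by simp
    thus ?thesis using q(3,4) zh(1) by blast
  qed
  ultimately show "\<exists>\<rho>. cohomology_graph R \<aa> J e k H (carrier H) \<rho>"
    unfolding cohomology_graph_def by (intro exI[of _ \<rho>]) (auto simp: \<rho>_def)
  show "cocycles R \<aa> I d n \<subseteq> coboundaries R \<aa> I d n \<longleftrightarrow> cocycles R \<aa> J e n \<subseteq> coboundaries R \<aa> J e n"
  proof
    assume "cocycles R \<aa> I d n \<subseteq> coboundaries R \<aa> I d n"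
    thus "cocycles R \<aa> J e n \<subseteq> coboundaries R \<aa> J e n" using q(2,4) by blast
  next
    assume v: "cocycles R \<aa> J e n \<subseteq> coboundaries R \<aa> J e n"
    show "cocycles R \<aa> I d n \<subseteq> coboundaries R \<aa> I d n"
    proof
      fix a assume a: "a \<in> cocycles R \<aa> I d n"
      interpret In: module R "I n" by (rule X.mod)
      obtain z where z: "z \<in> cocycles R \<aa> J e n" "q n z \<ominus>\<^bsub>I n\<^esub> a \<in> coboundaries R \<aa> I d n" using q(5)[OF a] by blast
      have qz: "q n z \<in> coboundaries R \<aa> I d n" using q(3) v z(1) by blast
      have c: "a \<in> carrier (I n)" "q n z \<in> carrier (I n)"
        using a submodule_subset[OF ZI] mod_hom_closed[OF q(1) ZJc[OF z(1)]] by auto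
      have "q n z \<ominus>\<^bsub>I n\<^esub> (q n z \<ominus>\<^bsub>I n\<^esub> a) \<in> coboundaries R \<aa> I d n"
        using submodule_minus[OF X.mod BI qz z(2)] .
      thus "a \<in> coboundaries R \<aa> I d n" using c
        by (simp add: a_minus_def In.M.minus_add In.M.r_neg2 In.M.minus_minus)
    qed
  qed
qed

text \<open>A submodule containing the images of the generators has as preimage a submodule
  containing the generators, hence all of \<open>M\<close>.\<close>

lemma fin_gen_module_mod_quot:
  assumes "fin_gen_module R M" "submodule N R M"
  shows "fin_gen_module R (mod_quot M N)"
proof -
  have M: "module R M" using assms(1) by (simp add: fin_gen_module_def)
  interpret M: module R M by fact
  let ?Q = "mod_quot M N" and ?\<pi> = "\<lambda>m. N +>\<^bsub>M\<^esub> m"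
  have Q: "module R ?Q" using module_mod_quot[OF M assms(2)] .
  interpret Q: module R ?Q by fact
  note h = mod_quot_hom[OF M assms(2)]
  obtain S where S: "finite S" "S \<subseteq> carrier M" "module_span R M S = carrier M"
    using assms(1) by (auto simp: fin_gen_module_def)
  have "carrier ?Q \<subseteq> L" if L: "submodule L R ?Q" "?\<pi> ` S \<subseteq> L" for L
  proof -
    let ?P = "{m \<in> carrier M. ?\<pi> m \<in> L}"
    have "submodule ?P R M"
      by (rule submodule_if_closed[OF M])
        (use submodule_zero[OF L(1)] submodule_add[OF L(1)] submodule_smult[OF L(1)]
          mod_hom_zero[OF M Q h] mod_hom_add[OF h] mod_hom_smult[OF h] in auto)
    moreover have "S \<subseteq> ?P" using S(2) L(2) by blast
    ultimately have "module_span R M S \<subseteq> ?P" unfolding module_span_def by (intro Inter_lower) simp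
    thus ?thesis using S(3) by (auto simp: mod_quot_simps(1)[OF M assms(2)])
  qed
  hence "module_span R ?Q (?\<pi> ` S) = carrier ?Q"
    using Q.carrier_is_submodule S(2) mod_hom_closed[OF h] unfolding module_span_def by blast
  thus ?thesis unfolding fin_gen_module_def using Q S(1,2) mod_hom_closed[OF h] by blast
qed

section \<open>Relative Cohen-Macaulay modules\<close>

lemma relative_CM_quotient_iff:
  fixes R :: "('r, 'k) ring_scheme" and M :: "('r, 'm, 'l) module_scheme"
  assumes R: "noetherian_ring R" "local_ring R \<mm>"
    and hull: "injective_hull R (mod_quot (self_module R) \<mm>) E"
    and \<aa>: "ideal \<aa> R" and fg: "fin_gen_module R M" and cd: "cd R \<aa> M = ereal (real c)"
    and xs: "set xs \<subseteq> \<aa>" and reg: "regular_sequence R M xs"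
    and dreg: "regular_sequence R (matlis_dual R E (local_cohomology R \<aa> M c)) xs"
  shows "relative_CM R \<aa> M \<longleftrightarrow> relative_CM R \<aa> (mod_quot_mult R M (set xs))"
proof -
  have M: "module R M" using fg by (simp add: fin_gen_module_def)
  interpret M: module R M by fact
  obtain I :: "nat \<Rightarrow> ('r, 'r \<times> nat \<Rightarrow> 'm \<times> nat) module" and d \<epsilon> where
    I: "injective_complex R I d" "augmentation R M I d \<epsilon>"
    "\<forall>m\<in>carrier M. \<epsilon> m = \<zero>\<^bsub>I 0\<^esub> \<longrightarrow> m = \<zero>\<^bsub>M\<^esub>"
    "\<forall>\<aa> n. local_cohomology R \<aa> M n = cohomology (\<lambda>j. torsion_part R \<aa> (I j)) d n"
    using local_cohomology_complex[OF M] by (elim exE conjE) (rule that, assumption+)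
  define H where "H = local_cohomology R \<aa> M c"
  have mH: "module R H" using module_cohomology[OF I(1) \<aa>] I(4) by (simp add: H_def)
  define vanI where "vanI n \<longleftrightarrow> cocycles R \<aa> I d n \<subseteq> coboundaries R \<aa> I d n" for n
  have vanI: "zero_module (local_cohomology R \<aa> M n) \<longleftrightarrow> vanI n" for n
    using zero_module_cohomology_iff[OF I(1) \<aa>] I(4) by (simp add: vanI_def)
  define X where "X i = set (take i xs)" for i
  define S where "S i = mult_submodule R M (X i)" for i
  have xsR: "set xs \<subseteq> carrier R" using reg by (simp add: regular_sequence_def)
  have XR: "X i \<subseteq> carrier R" for i using xsR set_take_subset[of i xs] by (auto simp: X_def)
  have S: "submodule (S i) R M" for i unfolding S_def by (rule submodule_mult_submodule[OF M XR])
  \<comment> \<open>Complex, differential and augmentation form one tuple, so that a single choice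
    for each \<open>i\<close> fixes all three consistently.\<close>
  define good where "good i t \<longleftrightarrow> (case t of (J, e, \<eta>) \<Rightarrow>
     injective_complex R J e \<and> augmentation R M J e \<eta> \<and> (\<forall>m\<in>carrier M. \<eta> m = \<zero>\<^bsub>J 0\<^esub> \<longleftrightarrow> m \<in> S i) \<and>
     (\<forall>\<aa> n. local_cohomology R \<aa> (mod_quot M (S i)) n = cohomology (\<lambda>j. torsion_part R \<aa> (J j)) e n))"
    for i and t :: "(nat \<Rightarrow> ('r, 'r \<times> nat \<Rightarrow> 'm set \<times> nat) module) \<times> _"
  have "\<exists>t. good i t" for i
    using local_cohomology_quotient_complex[OF M S[of i]] by (simp add: good_def)
  then obtain T where T: "\<And>i. good i (T i)" by metis
  define J where "J i = fst (T i)" for i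
  define e where "e i = fst (snd (T i))" for i
  define \<eta> where "\<eta> i = snd (snd (T i))" for i
  have T': "good i (J i, e i, \<eta> i)" for i using T[of i] by (simp add: J_def e_def \<eta>_def)
  have J: "injective_complex R (J i) (e i)" and aug: "augmentation R M (J i) (e i) (\<eta> i)"
    and ker: "m \<in> carrier M \<Longrightarrow> \<eta> i m = \<zero>\<^bsub>J i 0\<^esub> \<longleftrightarrow> m \<in> S i"
    and lc: "local_cohomology R \<aa> (mod_quot M (S i)) n = cohomology (\<lambda>j. torsion_part R \<aa> (J i j)) (e i) n" for i m n
    using T'[of i] by (auto simp: good_def)
  define van where "van i n \<longleftrightarrow> cocycles R \<aa> (J i) (e i) n \<subseteq> coboundaries R \<aa> (J i) (e i) n" for i n
  have van: "zero_module (local_cohomology R \<aa> (mod_quot M (S i)) n) \<longleftrightarrow> van i n" for i n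
    unfolding lc van_def using zero_module_cohomology_iff[OF J \<aa>] .
  have \<eta>: "\<eta> i \<in> mod_hom R M (J i 0)" for i using aug[of i] by (simp add: augmentation_def)
  have \<epsilon>: "\<epsilon> \<in> mod_hom R M (I 0)" using I(2) by (simp add: augmentation_def)

  \<comment> \<open>\<open>M/0\<close> consists of cosets, and its chosen resolution lives over
    another type than that of \<open>M\<close>. The comparison lemmas link the two at the start of
    the sequence.\<close>
  have S0: "S 0 = {\<zero>\<^bsub>M\<^esub>}" using mult_submodule_empty[OF M] by (simp add: S_def X_def)
  have ker0: "\<epsilon> m = \<zero>\<^bsub>I 0\<^esub> \<longleftrightarrow> \<eta> 0 m = \<zero>\<^bsub>J 0 0\<^esub>" if "m \<in> carrier M" for m
    using bspec[OF I(3) that] ker[OF that, of 0] mod_hom_zero[OF M injective_complex.mod[OF I(1)] \<epsilon>]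
    by (auto simp: S0)
  have van0: "vanI n \<longleftrightarrow> van 0 n" for n
    unfolding vanI_def van_def by (rule cohomology_graph_comparison(2)[OF I(1) J \<aa> I(2) aug ker0])
  have graph0: "\<exists>\<rho>. cohomology_graph R \<aa> (J 0) (e 0) c H (carrier H) \<rho>"
    using cohomology_graph_comparison(1)[OF I(1) J \<aa> I(2) aug ker0, of c] I(4) by (simp add: H_def)

  have XSuc: "X (Suc i) = insert (xs ! i) (X i)" if "i < length xs" for i
    using that by (simp add: X_def take_Suc_conv_app_nth)
  have step: "\<exists>\<psi> s. multiplication_sequence R (J i) (e i) (J (Suc i)) (e (Suc i)) \<aa> (xs ! i) \<psi> s"
    if i: "i < length xs" for i
  proof (rule multiplication_sequence_exists[OF J J \<aa> _ aug aug])
    interpret J: injective_complex R "J i" "e i" by (rule J)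
    interpret J0: module R "J i 0" by (rule J.mod)
    show x: "xs ! i \<in> carrier R" using xsR i by auto
    have "nonzerodivisor_on (mod_quot M (S i)) (xs ! i)"
      using reg i by (simp add: regular_sequence_def mod_quot_mult_eq S_def X_def)
    hence nzd: "m \<in> S i" if "m \<in> carrier M" "xs ! i \<odot>\<^bsub>M\<^esub> m \<in> S i" for m
      using nonzerodivisor_on_mod_quot_iff[OF M S x] that by blast
    fix m assume m: "m \<in> carrier M"
    show "\<eta> i m = \<zero>\<^bsub>J i 0\<^esub>" if "\<eta> i (xs ! i \<odot>\<^bsub>M\<^esub> m) = \<zero>\<^bsub>J i 0\<^esub>"
      using that nzd[OF m] ker m x by simp
    have "\<eta> (Suc i) m = \<zero>\<^bsub>J (Suc i) 0\<^esub> \<longleftrightarrow> (\<exists>m'\<in>carrier M. m \<ominus>\<^bsub>M\<^esub> xs ! i \<odot>\<^bsub>M\<^esub> m' \<in> S i)"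
      using ker[OF m, of "Suc i"] mult_submodule_insert[OF M XR x m, of i] by (simp add: S_def XSuc[OF i])
    moreover have "m \<ominus>\<^bsub>M\<^esub> xs ! i \<odot>\<^bsub>M\<^esub> m' \<in> S i \<longleftrightarrow> \<eta> i m = \<eta> i (xs ! i \<odot>\<^bsub>M\<^esub> m')" if m': "m' \<in> carrier M" for m'
    proof -
      have xm: "xs ! i \<odot>\<^bsub>M\<^esub> m' \<in> carrier M" using x m' by simp
      have "m \<ominus>\<^bsub>M\<^esub> xs ! i \<odot>\<^bsub>M\<^esub> m' \<in> S i \<longleftrightarrow> \<eta> i m \<ominus>\<^bsub>J i 0\<^esub> \<eta> i (xs ! i \<odot>\<^bsub>M\<^esub> m') = \<zero>\<^bsub>J i 0\<^esub>"
        using ker[OF M.M.minus_closed[OF m xm], of i] mod_hom_minus[OF M J.mod \<eta> m xm] by simp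
      thus ?thesis using mod_hom_closed[OF \<eta> m] mod_hom_closed[OF \<eta> xm] by simp
    qed
    ultimately show "\<eta> (Suc i) m = \<zero>\<^bsub>J (Suc i) 0\<^esub> \<longleftrightarrow> (\<exists>m'\<in>carrier M. \<eta> i m = \<eta> i (xs ! i \<odot>\<^bsub>M\<^esub> m'))"
      by blast
  qed
  have xa: "xs ! i \<in> \<aa>" if "i < length xs" for i using xs that by auto

  let ?n = "length xs"
  have Q: "mod_quot_mult R M (set xs) = mod_quot M (S ?n)" by (simp add: mod_quot_mult_eq S_def X_def)
  have fgQ: "fin_gen_module R (mod_quot M (S ?n))" using fin_gen_module_mod_quot[OF fg S] .
  have cmM: "relative_CM R \<aa> M \<longleftrightarrow> (\<exists>!k. \<not> vanI k)" using fg by (simp add: relative_CM_def vanI)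
  have cmQ: "relative_CM R \<aa> (mod_quot M (S ?n)) \<longleftrightarrow> (\<exists>!k. \<not> van ?n k)"
    using fgQ by (simp add: relative_CM_def van)
  have cdM: "(SUP i \<in> {i. \<not> vanI i}. ereal (real i)) = ereal (real c)" using cd by (simp add: cd_def vanI)

  \<comment> \<open>The induction removes elements from the end of the sequence. Each removal raises
    the only degree that may survive by one, so \<open>k0 + ?n\<close> remains for
    \<open>M\<close>.\<close>
  have backward: "\<not> van ?n k0 \<Longrightarrow> \<exists>!k. \<not> vanI k" if k0: "\<And>k. k \<noteq> k0 \<Longrightarrow> van ?n k" for k0
  proof -
    have "\<forall>k. k \<noteq> k0 + j \<longrightarrow> van (?n - j) k" if "j \<le> ?n" for j
      using that
    proof (induction j)
      case 0
      show ?case using k0 by simp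
    next
      case (Suc j)
      define i where "i = ?n - Suc j"
      have i: "i < ?n" "Suc i = ?n - j" using Suc.prems by (auto simp: i_def)
      obtain \<psi> s where "multiplication_sequence R (J i) (e i) (J (Suc i)) (e (Suc i)) \<aa> (xs ! i) \<psi> s"
        using step[OF i(1)] by blast
      then interpret ms: multiplication_sequence R "J i" "e i" "J (Suc i)" "e (Suc i)" \<aa> "xs ! i" \<psi> s .
      have "van i k" if k: "k \<noteq> k0 + Suc j" for k
      proof (cases k)
        case 0
        thus ?thesis using ms.vanishing_zero[OF xa[OF i(1)]] by (simp add: van_def)
      next
        case (Suc k')
        have "van (Suc i) k'" using Suc.IH Suc.prems i(2) Suc k by simp
        thus ?thesis using ms.vanishing_Suc[OF xa[OF i(1)]] Suc by (simp add: van_def)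
      qed
      thus ?case by (simp add: i_def)
    qed
    from this[of ?n] have *: "vanI k" if "k \<noteq> k0 + ?n" for k using that van0 by simp
    have "\<exists>k. \<not> vanI k"
    proof (rule ccontr)
      \<comment> \<open>If every degree vanished, the supremum would be taken over the empty set and
        equal minus infinity.\<close>
      assume "\<not> ?thesis"
      thus False using cdM by (simp add: bot_ereal_def)
    qed
    thus "\<exists>!k. \<not> vanI k" using * by metis
  qed

  have forward: "\<exists>!k. \<not> van ?n k" if cm: "\<exists>!k. \<not> vanI k"
  proof -
    obtain k1 where k1: "\<not> vanI k1" "\<And>k. \<not> vanI k \<Longrightarrow> k = k1" using cm by blast
    hence "{i. \<not> vanI i} = {k1}" by blast
    hence "k1 = c" using cdM by simp
    hence c: "\<not> vanI c" "\<And>k. k \<noteq> c \<Longrightarrow> vanI k" using k1 by blast+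
    \<comment> \<open>Vanishing alone is not inductive: regularity on the dual speaks about the part
      of \<open>H\<close> killed by the first \<open>i\<close> elements, so the surviving cohomology
      has to be tied to that part at each stage. The bound \<open>i \<le> c\<close> keeps
      \<open>c - i\<close> a true difference.\<close>
    have "i \<le> c \<and> (\<forall>k. k \<noteq> c - i \<longrightarrow> van i k) \<and>
       (\<exists>\<rho>. cohomology_graph R \<aa> (J i) (e i) (c - i) H (annihilated H (X i)) \<rho>) \<and>
       annihilated H (X i) \<noteq> {\<zero>\<^bsub>H\<^esub>}" if "i \<le> ?n" for i
      using that
    proof (induction i)
      case 0
      have a: "annihilated H (X 0) = carrier H" by (simp add: annihilated_def X_def)
      have "carrier H \<noteq> {\<zero>\<^bsub>H\<^esub>}" using c(1) vanI[of c] by (simp add: zero_module_def H_def)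
      thus ?case using graph0 c(2) van0 by (simp add: a)
    next
      case (Suc i)
      hence i: "i < ?n" by simp
      obtain \<rho> where IH: "i \<le> c" "\<And>k. k \<noteq> c - i \<Longrightarrow> van i k" "annihilated H (X i) \<noteq> {\<zero>\<^bsub>H\<^esub>}"
        "cohomology_graph R \<aa> (J i) (e i) (c - i) H (annihilated H (X i)) \<rho>" using Suc by auto
      obtain \<psi> s where "multiplication_sequence R (J i) (e i) (J (Suc i)) (e (Suc i)) \<aa> (xs ! i) \<psi> s"
        using step[OF i] by blast
      then interpret ms: multiplication_sequence R "J i" "e i" "J (Suc i)" "e (Suc i)" \<aa> "xs ! i" \<psi> s .
      have dual: "nonzerodivisor_on (mod_quot_mult R (matlis_dual R E H) (X i)) (xs ! i)"
        using dreg i by (simp add: regular_sequence_def X_def H_def)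
      have fin: "finite (X i)" by (simp add: X_def)
      obtain k' \<rho>' where k': "c - i = Suc k'" "\<And>j. j \<noteq> k' \<Longrightarrow> van (Suc i) j"
        "cohomology_graph R \<aa> (J (Suc i)) (e (Suc i)) k' H
          {h \<in> annihilated H (X i). xs ! i \<odot>\<^bsub>H\<^esub> h = \<zero>\<^bsub>H\<^esub>} \<rho>'"
        "{h \<in> annihilated H (X i). xs ! i \<odot>\<^bsub>H\<^esub> h = \<zero>\<^bsub>H\<^esub>} \<noteq> {\<zero>\<^bsub>H\<^esub>}"
        using ms.coregular_step[OF xa[OF i] mH submodule_annihilated[OF mH XR] IH(3,4) IH(2)[unfolded van_def]
            dual_regular_imp_coregular[OF R hull mH fin XR ms.x dual]]
        unfolding van_def by blast
      have "{h \<in> annihilated H (X i). xs ! i \<odot>\<^bsub>H\<^esub> h = \<zero>\<^bsub>H\<^esub>} = annihilated H (X (Suc i))"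
        by (auto simp: annihilated_def XSuc[OF i])
      moreover have "k' = c - Suc i" "Suc i \<le> c" using k'(1) by simp_all
      ultimately show ?case using k'(2-4) by auto
    qed
    from this[of ?n] obtain \<rho> where P: "\<And>k. k \<noteq> c - ?n \<Longrightarrow> van ?n k"
      "cohomology_graph R \<aa> (J ?n) (e ?n) (c - ?n) H (annihilated H (X ?n)) \<rho>"
      "annihilated H (X ?n) \<noteq> {\<zero>\<^bsub>H\<^esub>}" by auto
    obtain h where h: "h \<in> annihilated H (X ?n)" "h \<noteq> \<zero>\<^bsub>H\<^esub>"
      using P(3) submodule_zero[OF submodule_annihilated[OF mH XR]] by blast
    then obtain z where z: "(z, h) \<in> \<rho>" using P(2) unfolding cohomology_graph_def by blast
    have "z \<in> cocycles R \<aa> (J ?n) (e ?n) (c - ?n)" "z \<notin> coboundaries R \<aa> (J ?n) (e ?n) (c - ?n)"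
      using P(2) z h(2) unfolding cohomology_graph_def by blast+
    hence "\<not> van ?n (c - ?n)" by (auto simp: van_def)
    thus ?thesis using P(1) by metis
  qed
  show ?thesis unfolding Q cmM cmQ
  proof
    assume "\<exists>!k. \<not> van ?n k"
    then obtain k0 where k0: "\<not> van ?n k0" "\<forall>k. \<not> van ?n k \<longrightarrow> k = k0" by (rule ex1E)
    have "van ?n k" if "k \<noteq> k0" for k using k0(2) that by blast
    from backward[OF this k0(1)] show "\<exists>!k. \<not> vanI k" .
  qed (rule forward)
qed

text \<open>The first condition on a sequence refers to \<open>M\<close> modulo the empty set, whose
  elements are cosets of the zero submodule; regularity has to be carried over from
  \<open>M\<close>.\<close>

lemma regular_element_imp_regular_sequence:
  assumes "module R M" "regular_element R M x"
  shows "regular_sequence R M [x]"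
proof -
  have x: "x \<in> carrier R" using assms(2) by (simp add: regular_element_def)
  have "nonzerodivisor_on (mod_quot_mult R M {}) x"
    unfolding mod_quot_mult_eq
    using nonzerodivisor_on_mod_quot_iff[OF assms(1) submodule_mult_submodule[OF assms(1), of "{}"] x] assms(2)
    by (auto simp: mult_submodule_empty[OF assms(1)] regular_element_def nonzerodivisor_on_def)
  thus ?thesis using assms(2) by (simp add: regular_sequence_def regular_element_def)
qed

theorem corollary1p2:
  fixes R :: "('r, 'k) ring_scheme"
    and \<mm> \<aa> :: "'r set"
    and E :: "('r, 'e, 'j) module_scheme"
    and M :: "('r, 'm, 'l) module_scheme"
    and c :: nat
  assumes "noetherian_ring R"
    and "local_ring R \<mm>"
    and "injective_hull R (mod_quot (self_module R) \<mm>) E"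
    and "ideal \<aa> R" and "\<aa> \<noteq> carrier R"
    and "fin_gen_module R M"
    and "cd R \<aa> M = ereal (real c)" and "c > 0"
  shows "(\<forall>x\<in>\<aa>.
        regular_element R M x \<longrightarrow>
        regular_element R (matlis_dual R E (local_cohomology R \<aa> M c)) x \<longrightarrow>
        (relative_CM R \<aa> M \<longleftrightarrow> relative_CM R \<aa> (mod_quot_mult R M {x}))) \<and>
     (\<forall>xs. set xs \<subseteq> \<aa> \<longrightarrow>
        regular_sequence R M xs \<longrightarrow>
        regular_sequence R (matlis_dual R E (local_cohomology R \<aa> M c)) xs \<longrightarrow>
        (relative_CM R \<aa> M \<longleftrightarrow> relative_CM R \<aa> (mod_quot_mult R M (set xs))))"
proof (intro conjI ballI allI impI)
  have M: "module R M" using assms(6) by (simp add: fin_gen_module_def)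
  show seq: "relative_CM R \<aa> M \<longleftrightarrow> relative_CM R \<aa> (mod_quot_mult R M (set xs))"
    if "set xs \<subseteq> \<aa>" "regular_sequence R M xs"
      "regular_sequence R (matlis_dual R E (local_cohomology R \<aa> M c)) xs" for xs
    using relative_CM_quotient_iff[OF assms(1-4,6,7) that] .
  fix x assume x: "x \<in> \<aa>" "regular_element R M x"
    "regular_element R (matlis_dual R E (local_cohomology R \<aa> M c)) x"
  have "module R (local_cohomology R \<aa> M c)"
    using local_cohomology_complex[OF M] module_cohomology[OF _ assms(4)] by metis
  moreover have "module R E" using assms(3) by (simp add: injective_hull_def injective_module_def)
  ultimately have "module R (matlis_dual R E (local_cohomology R \<aa> M c))"
    unfolding matlis_dual_def by (rule module_Hom_module)
  \<comment> \<open>Part (i) is part (ii) for a sequence of length one.\<close>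
  hence "relative_CM R \<aa> M \<longleftrightarrow> relative_CM R \<aa> (mod_quot_mult R M (set [x]))"
    using x M by (intro seq regular_element_imp_regular_sequence) auto
  thus "relative_CM R \<aa> M \<longleftrightarrow> relative_CM R \<aa> (mod_quot_mult R M {x})" by simp
qed

end
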